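(* Let $p_-<0<p_+$ and $\lambda_-,\lambda_+>0$. Let $(\mathsf{P}^t)_{t\ge0}$ be the Markov semigroup of the piecewise deterministic Markov process on $\mathbb{R}^2\times I$, $I=\{-1,1\}$, obtained by switching between the two planar vector fields which, in polar coordinates $(\theta,r)$, are $$g_{-1}(\theta,r)=(1,\;p_-r-r^3)^\top,\qquad g_1(\theta,r)=(1,\;p_+r-r^3)^\top,$$ with rate $\lambda_-$ of switching from $g_{-1}$ to $g_1$ and rate $\lambda_+$ of switching from $g_1$ to $g_{-1}$. Let $\delta$ be the product of the Dirac measure at the origin of $\mathbb{R}^2$ and the probability measure on $I$ assigning mass $\frac{\lambda_+}{\lambda_++\lambda_-}$ to $-1$ and mass $\frac{\lambda_-}{\lambda_++\lambda_-}$ to $1$. Then: 1. If $\frac{\lambda_+}{p_+}<-\frac{\lambda_-}{p_-}$, then $(\mathsf{P}^t)$ admits exactly two ergodic invariant probability measures: the measure $\delta$, and a measure $\mu$ that (in polar coordinates) is the product of Lebesgue measure on the unit circle $S^1$, normalized by the factor $\frac1{2\pi}$, and the measure $\nu$, where $\nu$ is the unique invariant probability measure on $(0,\infty)\times I$ of the piecewise deterministic Markov process induced by switching between the one-dimensional vector fields $f_{-1}(r)=p_-r-r^3$ and $f_1(r)=p_+r-r^3$, $r>0$, at rates $\lambda_-$ (from $f_{-1}$ to $f_1$) and $\lambda_+$ (from $f_1$ to $f_{-1}$). 2. If $\frac{\lambda_+}{p_+}\ge-\frac{\lambda_-}{p_-}$, then $\delta$ is the unique invariant probability measure of $(\ma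thsf{P}^t)$.
   Context: In Cartesian coordinates $(x_1,x_2)=(r\cos\theta,r\sin\theta)$ the vector fields are those of the system $x_1'=px_1-x_2-x_1(x_1^2+x_2^2)$, $x_2'=x_1+px_2-x_2(x_1^2+x_2^2)$ with $p=p_-$ (index $-1$) and $p=p_+$ (index $1$). The origin is an equilibrium of both. The punctured plane $\mathbb{R}^2\setminus\{0\}$ is identified with $S^1\times(0,\infty)$ by polar coordinates, so a measure on $S^1\times(0,\infty)\times I$ is regarded as a measure on $\mathbb{R}^2\times I$. Piecewise deterministic Markov process with vector fields $h_{-1},h_1$ and rates $\lambda_-,\lambda_+$: $E=(E_t)_{t\ge0}$ is the continuous-time Markov chain on $I=\{-1,1\}$ that jumps from $-1$ to $1$ at rate $\lambda_-$ and from $1$ to $-1$ at rate $\lambda_+$ (independently of the position), $X$ solves $X_t=X_0+\int_0^t h_{E_s}(X_s)\,ds$, and the process is the Markov process $(X,E)$. An invariant probability measure (IPM) of a Markov semigroup $(\mathsf{P}^t)$ is a probability measure $\mu$ on the state space with $\mu\mathsf{P}^t=\mu$ for all $t\ge0$. An IPM $\mu$ is ergodic if $\mu(A)\in\{0,1\}$ for every measurable set $A$ of the state space such that for all $t\ge0$, $\mathsf{P}^t_z(A)=1$ for $\mu$-almost every $z\in A$. When $\frac{\lambda_+}{p_+}<-\frac{\lambda_-}{p_-}$, the one-dimensional process with vector fields $f_{-1},f_1$ on $(0,\infty)$ has exactly one IPM on $(0,\infty)\times I$. *)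

theory Defs
  imports "HOL-Probability.Probability"
begin

definition by_index :: "'b \<Rightarrow> 'b \<Rightarrow> int \<Rightarrow> 'b" where
  "by_index a b i = (if i = -1 then a else b)"

definition state_space :: "'a::euclidean_space set \<Rightarrow> ('a \<times> int) measure" where
  "state_space S = restrict_space borel S \<Otimes>\<^sub>M count_space {-1, 1}"

text \<open>
  The continuous-time Markov chain on \<open>{-1, 1}\<close> that leaves state \<open>j\<close> at rate \<open>q j\<close>, started
  in \<open>i\<close>, in its jump-chain/holding-time form: the \<open>n\<close>-th visited state is \<open>i * (-1) ^ n\<close>, the holding
  times \<open>\<tau> n\<close> are independent and exponential with the rate of that state, and the \<open>n\<close>-th jump
  (counting from \<open>0\<close>) occurs at time \<open>\<Sum>k\<le>n. \<tau> k\<close>. The set of jumps up to time \<open>t\<close> is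
  almost surely finite.
\<close>

definition holding_times :: "(int \<Rightarrow> real) \<Rightarrow> int \<Rightarrow> (nat \<Rightarrow> real) measure" where
  "holding_times q i =
     (\<Pi>\<^sub>M n\<in>UNIV. density lborel (\<lambda>s. ennreal (exponential_density (q (i * (-1) ^ n)) s)))"

definition index_path :: "int \<Rightarrow> (nat \<Rightarrow> real) \<Rightarrow> real \<Rightarrow> int" where
  "index_path i \<tau> t = i * (-1) ^ card {n. (\<Sum>k\<le>n. \<tau> k) \<le> t}"

text \<open>
  The value at time \<open>t\<close> of the solution in \<open>S\<close> of \<open>X s = x + (integral of h (e u) (X u) for u from 0 to s)\<close>.
\<close>

definition position ::
  "'a::euclidean_space set \<Rightarrow> (int \<Rightarrow> 'a \<Rightarrow> 'a) \<Rightarrow> (real \<Rightarrow> int) \<Rightarrow> 'a \<Rightarrow> real \<Rightarrow> 'a" where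
  "position S h e x t = (THE y. \<exists>X. X t = y \<and>
     (\<forall>s\<in>{0..t}. X s \<in> S \<and> ((\<lambda>u. h (e u) (X u)) has_integral (X s - x)) {0..s}))"

text \<open>\<open>pdmp S h q t z\<close> is the law at time \<open>t\<close> of the process \<open>(X, E)\<close> started at \<open>z\<close>.\<close>

definition pdmp ::
  "'a::euclidean_space set \<Rightarrow> (int \<Rightarrow> 'a \<Rightarrow> 'a) \<Rightarrow> (int \<Rightarrow> real) \<Rightarrow>
    real \<Rightarrow> 'a \<times> int \<Rightarrow> ('a \<times> int) measure" where
  "pdmp S h q t = (\<lambda>(x, i). distr (holding_times q i) (state_space S)
     (\<lambda>\<tau>. (position S h (index_path i \<tau>) x t, index_path i \<tau> t)))"

definition invariant_prob ::
  "'z measure \<Rightarrow> (real \<Rightarrow> 'z \<Rightarrow> 'z measure) \<Rightarrow> 'z measure \<Rightarrow> bool" where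
  "invariant_prob M P \<mu> \<longleftrightarrow>
     prob_space \<mu> \<and> sets \<mu> = sets M \<and> (\<forall>t\<ge>0. \<mu> \<bind> P t = \<mu>)"

definition ergodic_prob ::
  "'z measure \<Rightarrow> (real \<Rightarrow> 'z \<Rightarrow> 'z measure) \<Rightarrow> 'z measure \<Rightarrow> bool" where
  "ergodic_prob M P \<mu> \<longleftrightarrow> invariant_prob M P \<mu> \<and>
     (\<forall>A\<in>sets M. (\<forall>t\<ge>0. AE z in \<mu>. z \<in> A \<longrightarrow> measure (P t z) A = 1) \<longrightarrow>
        measure \<mu> A = 0 \<or> measure \<mu> A = 1)"

definition radial_field :: "real \<Rightarrow> real \<Rightarrow> real" where
  "radial_field p r = p * r - r ^ 3"

definition planar_field :: "real \<Rightarrow> real \<times> real \<Rightarrow> real \<times> real" where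
  "planar_field p = (\<lambda>(x1, x2).
     (p * x1 - x2 - x1 * (x1\<^sup>2 + x2\<^sup>2), x1 + p * x2 - x2 * (x1\<^sup>2 + x2\<^sup>2)))"

definition planar_pdmp ::
  "real \<Rightarrow> real \<Rightarrow> real \<Rightarrow> real \<Rightarrow> real \<Rightarrow>
    (real \<times> real) \<times> int \<Rightarrow> ((real \<times> real) \<times> int) measure" where
  "planar_pdmp pm pp lm lp =
     pdmp UNIV (by_index (planar_field pm) (planar_field pp)) (by_index lm lp)"

definition radial_pdmp ::
  "real \<Rightarrow> real \<Rightarrow> real \<Rightarrow> real \<Rightarrow> real \<Rightarrow>
    real \<times> int \<Rightarrow> (real \<times> int) measure" where
  "radial_pdmp pm pp lm lp =
     pdmp {0<..} (by_index (radial_field pm) (radial_field pp)) (by_index lm lp)"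

definition polar :: "real \<Rightarrow> real \<Rightarrow> real \<times> real" where
  "polar \<theta> r = (r * cos \<theta>, r * sin \<theta>)"

text \<open>
  The planar field is the image of the field \<open>(1, radial_field p r)\<close> under the derivative of
  the polar coordinate map.
\<close>

lemma planar_field_polar:
  obtains D where "((\<lambda>(\<theta>, r). polar \<theta> r) has_derivative D) (at (\<theta>, r))"
    and "D (1, radial_field p r) = planar_field p (polar \<theta> r)"
proof
  let ?D = "\<lambda>v::real \<times> real.
    (snd v * cos \<theta> - r * (fst v * sin \<theta>), snd v * sin \<theta> + r * (fst v * cos \<theta>))"
  show "((\<lambda>(\<theta>, r). polar \<theta> r) has_derivative ?D) (at (\<theta>, r))"
    unfolding polar_def case_prod_beta
    by (auto intro!: derivative_eq_intros)
  have sq: "(r * cos \<theta>)\<^sup>2 + (r * sin \<theta>)\<^sup>2 = r\<^sup>2"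
    by (simp add: power_mult_distrib flip: distrib_left)
  show "?D (1, radial_field p r) = planar_field p (polar \<theta> r)"
    unfolding planar_field_def polar_def radial_field_def prod.case sq
    by (simp add: algebra_simps power2_eq_square power3_eq_cube)
qed

definition origin_measure :: "real \<Rightarrow> real \<Rightarrow> ((real \<times> real) \<times> int) measure" where
  "origin_measure lm lp = return borel 0 \<Otimes>\<^sub>M
     point_measure {-1, 1} (\<lambda>i. ennreal (by_index (lp / (lp + lm)) (lm / (lp + lm)) i))"

text \<open>
  The product of the normalized Lebesgue measure on the circle, parametrized by the angle in
  \<open>{0..<2 * pi}\<close>, and \<open>\<nu>\<close>, transported to the plane by polar coordinates.
\<close>

definition circle_product :: "(real \<times> int) measure \<Rightarrow> ((real \<times> real) \<times> int) measure" where
  "circle_product \<nu> = distr (uniform_measure lborel {0..<2 * pi} \<Otimes>\<^sub>M \<nu>) (state_space UNIV)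
     (\<lambda>(\<theta>, r, i). (polar \<theta> r, i))"

end

theory Submission
  imports Defs
begin

text \<open>
  Let \<open>a\<close> be the integral of \<open>p\<close> along the index path and \<open>j\<close> the integral of \<open>exp (2 * a)\<close>. The
  equation can be solved explicitly: the point \<open>x\<close> is rotated by the angle \<open>t\<close> and scaled by the
  factor \<open>exp a / sqrt (1 + 2 * |x|\<^sup>2 * j)\<close>. Conditioning on the first jump gives a renewal
  equation with unique bounded solutions, which yields the Chapman-Kolmogorov equation and the law
  of the index.

  For a measure \<open>\<mu>\<close> on states, the function \<open>F c k\<close>, the mass of the points \<open>(x, k)\<close> with
  \<open>c * |x|\<^sup>2 \<ge> 1\<close>, evolves by a dual semigroup that is monotone in \<open>F\<close>. Started from \<open>r = \<infinity>\<close> and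
  the stationary index, it decreases to a largest fixed point. Integrating the fixed point equation
  against \<open>dc / c\<close> shows that the only fixed point is \<open>0\<close> if the mean growth rate is at most \<open>0\<close>, and
  that all fixed points are multiples of the largest one if the rate is positive. In the latter case
  the largest fixed point is not \<open>0\<close>, since otherwise \<open>ln j\<close> would grow too slowly. It is the
  distribution function of \<open>\<nu>\<close>. In the plane, the same applies at time \<open>2 * pi\<close>, where the rotation is
  trivial, to the part of an invariant measure over a set of directions; invariance under all
  rotations makes the distribution of the direction uniform. Ergodicity follows from uniqueness by
  conditioning on an absorbing set.
\<close>

text \<open>The scaling factor comes from the substitution \<open>u = 1 / |x|^2\<close>, which turns
  the radial equation into the linear equation \<open>u' = 2 - 2 * p * u\<close>. From the initial
  value \<open>u\<close> it leads at time \<open>t\<close> to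
  \<open>exp (- 2 * a) * (u + 2 * j)\<close>, a random affine map, and \<open>F\<close> is the
  distribution function of \<open>u\<close>: infinite radius corresponds to \<open>u = 0\<close>,
  the origin to \<open>u = \<infinity>\<close>. The weight \<open>dc / c\<close> is chosen because
  it is invariant under scaling: the factor \<open>exp (2 * a)\<close> only moves the upper end of
  the integral, by \<open>2 * a\<close> on the logarithmic scale, whereas the shift by
  \<open>2 * j\<close> causes a loss that is strict unless \<open>F\<close> vanishes. Mass at the
  origin is invisible in \<open>F\<close>, so a fixed point may have any total mass up to 1, and the
  measure at the origin corresponds to \<open>F = 0\<close>. The definition of
  \<open>position\<close> refers to every sequence of holding times, also to those whose jump times
  accumulate. The explicit solution is therefore proved for all of them, so the processes can be
  replaced by explicit kernels without exceptional sets.\<close>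

subsection \<open>Paths of the index\<close>

text \<open>Holding times are arbitrary reals here, so jump times may accumulate. One accumulation
  time \<open>T\<close> suffices: past it \<open>index_path\<close> counts an infinite set, whose
  \<open>card\<close> is 0, and is constant again.\<close>

definition almost_step :: "(real \<Rightarrow> 'b) \<Rightarrow> real \<Rightarrow> bool" where
  "almost_step e b \<longleftrightarrow> (\<exists>T\<in>{0..b}. \<exists>K. (\<forall>s<T. finite (K \<inter> {0..s})) \<and> finite (K \<inter> {T..b}) \<and>
     (\<forall>u\<in>{0<..<b} - K. \<forall>\<^sub>F v in nhds u. e v = e u))"

lemma almost_step_index_path:
  assumes b: "0 \<le> b"
  shows "almost_step (index_path i \<tau>) b"
proof -
  define S where "S n = (\<Sum>k\<le>n. \<tau> k)" for n
  have ip: "index_path i \<tau> t = i * (-1) ^ card {n. S n \<le> t}" for t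
    by (simp add: index_path_def S_def)
  define D where "D = {u\<in>{0..b}. finite {n. S n \<le> u}}"
  \<comment> \<open>The last time up to which the jumps are locally finite; the default 0 covers the
    case that infinitely many partial sums are already at most 0.\<close>
  define T where "T = (if D = {} then 0 else Sup D)"
  define K where "K = insert T {S n | n. S n < T}"
  have bdd: "bdd_above D" unfolding D_def by (auto intro!: bdd_aboveI[of _ b])
  have T: "T \<in> {0..b}"
  proof (cases "D = {}")
    case False
    then obtain u where u: "u \<in> D" by auto
    then have "u \<le> Sup D" using bdd by (rule cSup_upper)
    moreover have "0 \<le> u" using u by (auto simp: D_def)
    moreover have "Sup D \<le> b" using False by (intro cSup_least) (auto simp: D_def)
    ultimately show ?thesis using False by (auto simp: T_def)
  qed (use b in \<open>auto simp: T_def\<close>)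
  have below: "\<exists>u\<in>D. s < u" if "s < T" "0 \<le> s" for s
  proof -
    have "D \<noteq> {}" using that by (auto simp: T_def)
    with that show ?thesis using bdd by (auto simp: T_def less_cSup_iff)
  qed
  have above: "infinite {n. S n \<le> u}" if "T < u" "u \<le> b" for u
  proof
    assume "finite {n. S n \<le> u}"
    then have "u \<in> D" using that T by (auto simp: D_def)
    then have "u \<le> T" using bdd by (auto simp: T_def intro: cSup_upper)
    then show False using that by simp
  qed
  show ?thesis unfolding almost_step_def
  proof (intro bexI exI conjI allI ballI impI)
    show "T \<in> {0..b}" by fact
    show "finite (K \<inter> {0..s})" if s: "s < T" for s
    proof (cases "0 \<le> s")
      case True
      then obtain u where u: "u \<in> D" "s < u" using below s by blast
      have "K \<inter> {0..s} \<subseteq> S ` {n. S n \<le> u}" using s u by (auto simp: K_def)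
      moreover have "finite {n. S n \<le> u}" using u by (auto simp: D_def)
      ultimately show ?thesis by (meson finite_imageI finite_subset)
    qed auto
    have "K \<inter> {T..b} \<subseteq> {T}" by (auto simp: K_def)
    then show "finite (K \<inter> {T..b})" by (meson finite.emptyI finite_insert finite_subset)
    fix u assume u: "u \<in> {0<..<b} - K"
    show "\<forall>\<^sub>F v in nhds u. index_path i \<tau> v = index_path i \<tau> u"
    proof (cases "u < T")
      case True
      then obtain u' where u': "u' \<in> D" "u < u'" using below[of u] u True by auto
      \<comment> \<open>Only finitely many partial sums are at most \<open>u'\<close>, and
        \<open>u\<close> is none of them, so no comparison with them changes near
        \<open>u\<close>.\<close>
      define W where "W = S ` {n. S n \<le> u'}"
      have fW: "finite W" using u' by (auto simp: D_def W_def)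
      have "u \<notin> W" using u True by (auto simp: W_def K_def)
      then have "\<forall>\<^sub>F v in nhds u. (\<forall>w\<in>W. (w \<le> v) = (w \<le> u))"
      proof (intro eventually_ball_finite[OF fW] ballI)
        fix w assume "w \<in> W" "u \<notin> W"
        then have "w < u \<or> u < w" by (metis neq_iff)
        then show "\<forall>\<^sub>F v in nhds u. (w \<le> v) = (w \<le> u)"
        proof
          assume "w < u"
          then have "\<forall>\<^sub>F v in nhds u. v \<in> {w<..}" by (intro eventually_nhds_in_open) auto
          then show ?thesis by eventually_elim (use \<open>w < u\<close> in auto)
        next
          assume "u < w"
          then have "\<forall>\<^sub>F v in nhds u. v \<in> {..<w}" by (intro eventually_nhds_in_open) auto
          then show ?thesis by eventually_elim (use \<open>u < w\<close> in auto)
        qed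
      qed
      moreover have "\<forall>\<^sub>F v in nhds u. v \<in> {..<u'}" using u' by (intro eventually_nhds_in_open) auto
      ultimately show ?thesis
      proof eventually_elim
        case (elim v)
        have "{n. S n \<le> v} = {n. S n \<le> u}" using elim u'
            by (auto simp: W_def) (metis less_eq_real_def order.trans not_le)+
        then show ?case by (simp add: ip)
      qed
    next
      case False
      then have "T < u" using u by (auto simp: K_def)
      then have "\<forall>\<^sub>F v in nhds u. v \<in> {T<..<b}" using u by (intro eventually_nhds_in_open) auto
      then show ?thesis
        by eventually_elim (use above \<open>T < u\<close> u in \<open>simp add: ip\<close>)
    qed
  qed
qed

lemma index_path_cases: "i \<in> {-1, 1} \<Longrightarrow> index_path i \<tau> t \<in> {-1, 1}"
  by (cases "even (card {n. (\<Sum>k\<le>n. \<tau> k) \<le> t})") (auto simp: index_path_def)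

lemma sets_holding_times [measurable_cong]:
  "sets (holding_times q i) = sets (\<Pi>\<^sub>M n\<in>UNIV. borel)"
  unfolding holding_times_def by (intro sets_PiM_cong) auto

lemma space_holding_times [simp]: "space (holding_times q i) = UNIV"
  by (simp add: holding_times_def space_PiM PiE_def)

lemma measurable_index_path [measurable]:
  "(\<lambda>(\<tau>, t). index_path i \<tau> t) \<in> (\<Pi>\<^sub>M n\<in>UNIV. borel) \<Otimes>\<^sub>M borel \<rightarrow>\<^sub>M count_space UNIV"
proof -
  have [measurable]: "(\<lambda>x. fst x k) \<in> borel_measurable ((\<Pi>\<^sub>M n\<in>UNIV. borel :: real measure) \<Otimes>\<^sub>M (borel
      :: real measure))" for k :: nat
    by (rule measurable_compose[OF measurable_fst]) simp
  have "(\<lambda>x. card {n::nat. (\<Sum>k\<le>n. fst x k) \<le> snd x})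
      \<in> ((\<Pi>\<^sub>M n\<in>UNIV. borel :: real measure) \<Otimes>\<^sub>M (borel :: real measure)) \<rightarrow>\<^sub>M count_space (UNIV :: nat
          set)"
    by (rule measurable_card) (simp add: pred_def[symmetric])
  then show ?thesis
    unfolding index_path_def case_prod_beta by (rule measurable_compose) simp
qed

lemma measurable_index_path' [measurable (raw)]:
  assumes [measurable]: "f \<in> M \<rightarrow>\<^sub>M (\<Pi>\<^sub>M n\<in>UNIV. borel)" "g \<in> borel_measurable M"
  shows "(\<lambda>x. index_path i (f x) (g x)) \<in> M \<rightarrow>\<^sub>M count_space UNIV"
  using measurable_compose[of "\<lambda>x. (f x, g x)", OF _ measurable_index_path[of i]] by simp

subsection \<open>The explicit solution\<close>

text \<open>The exceptional points may accumulate at \<open>b\<close>. The fundamental theorem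
  applies on \<open>{a..s}\<close> for every \<open>s < b\<close>, and both sides are continuous in
  \<open>s\<close>.\<close>

lemma integral_of_deriv_limit:
  fixes X :: "real \<Rightarrow> 'a::banach"
  assumes ab: "a \<le> b" and X: "continuous_on {a..b} X" and f: "f integrable_on {a..b}"
    and K: "\<And>s. s < b \<Longrightarrow> finite (K \<inter> {a..s})"
    and d: "\<And>u. u \<in> {a<..<b} - K \<Longrightarrow> (X has_vector_derivative f u) (at u)"
  shows "(f has_integral (X b - X a)) {a..b}"
proof (cases "a = b")
  case False
  then have "a < b" using ab by simp
  define g where "g s = X s - X a - integral {a..s} f" for s
  have g0: "g s = 0" if "s \<in> {a..<b}" for s
  proof -
    have "(f has_integral (X s - X a)) {a..s}"
      using that by (intro fundamental_theorem_of_calculus_interior_strong[OF K[of s]]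
        d continuous_on_subset[OF X]) auto
    then show ?thesis by (simp add: g_def integral_unique)
  qed
  have "continuous_on {a..b} g"
    unfolding g_def by (intro continuous_intros X indefinite_integral_continuous_1 f)
  then have "(g \<longlongrightarrow> g b) (at b within {a..b})" using ab by (auto simp: continuous_on_def)
  then have "(g \<longlongrightarrow> g b) (at_left b)"
    using \<open>a < b\<close> by (simp add: at_within_Icc_at_left)
  moreover have "(g \<longlongrightarrow> 0) (at_left b)"
  proof (rule tendsto_eventually)
    show "\<forall>\<^sub>F x in at_left b. g x = 0"
      using eventually_at_left_real[OF \<open>a < b\<close>] by eventually_elim (auto intro: g0)
  qed
  ultimately have "g b = 0" using tendsto_unique trivial_limit_at_left_real by blast
  then show ?thesis using f by (auto simp: g_def has_integral_integrable_integral)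
qed auto

text \<open>The limit version handles the jumps that accumulate at \<open>T\<close> from below, the
  ordinary fundamental theorem the finitely many exceptional times from \<open>T\<close> on.\<close>

lemma integral_of_deriv_almost_step:
  fixes X :: "real \<Rightarrow> 'a::banach"
  assumes b: "0 \<le> b" and X: "continuous_on {0..b} X" and f: "f integrable_on {0..b}"
    and e: "almost_step e b"
    and d: "\<And>u. u \<in> {0<..<b} \<Longrightarrow> \<forall>\<^sub>F v in nhds u. e v = e u \<Longrightarrow> (X has_vector_derivative f u) (at u)"
  shows "(f has_integral (X b - X 0)) {0..b}"
proof -
  obtain T K where T: "T \<in> {0..b}" and K: "\<And>s. s < T \<Longrightarrow> finite (K \<inter> {0..s})" "finite (K \<inter> {T..b})"
    and ev: "\<And>u. u \<in> {0<..<b} - K \<Longrightarrow> \<forall>\<^sub>F v in nhds u. e v = e u"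
    using e unfolding almost_step_def by blast
  have "(f has_integral (X T - X 0)) {0..T}"
    using T K by (intro integral_of_deriv_limit[where K = K] continuous_on_subset[OF X]
      integrable_subinterval_real[OF f] d ev) auto
  moreover have "(f has_integral (X b - X T)) {T..b}"
    using T by (intro fundamental_theorem_of_calculus_interior_strong[OF K(2)]
        continuous_on_subset[OF X]
      d ev) auto
  ultimately have "(f has_integral ((X T - X 0) + (X b - X T))) {0..b}"
    using T by (intro has_integral_combine[of 0 T b]) auto
  then show ?thesis by simp
qed

lemma nonincreasing_finite:
  fixes N :: "real \<Rightarrow> real"
  assumes "a \<le> b" "finite K" "continuous_on {a..b} N"
    and "\<And>u. u \<in> {a<..<b} - K \<Longrightarrow> (N has_real_derivative N' u) (at u)" "\<And>u. N' u \<le> 0"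
  shows "N b \<le> N a"
proof -
  have "(N' has_integral (N b - N a)) {a..b}"
    using assms by (intro fundamental_theorem_of_calculus_interior_strong[where S = K])
      (auto simp flip: has_real_derivative_iff_has_vector_derivative)
  then have "N b - N a \<le> 0" using has_integral_le[OF _ has_integral_0] assms(5) by blast
  then show ?thesis by simp
qed

text \<open>
  The distance of two solutions of an equation with a one-sided Lipschitz field grows at most
  exponentially.
\<close>
lemma position_eqI:
  fixes h :: "int \<Rightarrow> 'a::euclidean_space \<Rightarrow> 'a"
  assumes t: "0 \<le> t" and e: "almost_step e t" and h: "\<And>k. continuous_on UNIV (h k)"
    and L: "\<And>k x y. (h k x - h k y) \<bullet> (x - y) \<le> L * ((x - y) \<bullet> (x - y))"
    and X: "\<And>s. s \<in> {0..t} \<Longrightarrow> X s \<in> S \<and> ((\<lambda>u. h (e u) (X u)) has_integral (X s - x)) {0..s}"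
  shows "position S h e x t = X t"
  unfolding position_def
proof (rule the_equality)
  fix y
  assume "\<exists>Y. Y t = y \<and> (\<forall>s\<in>{0..t}. Y s \<in> S \<and> ((\<lambda>u. h (e u) (Y u)) has_integral (Y s - x)) {0..s})"
  then obtain Y where Yt: "Y t = y" and
    Y: "\<And>s. s \<in> {0..t} \<Longrightarrow> Y s \<in> S \<and> ((\<lambda>u. h (e u) (Y u)) has_integral (Y s - x)) {0..s}"
    by blast
  obtain T K where T: "T \<in> {0..t}" and K: "\<And>s. s < T \<Longrightarrow> finite (K \<inter> {0..s})" "finite (K \<inter> {T..t})"
    and ev: "\<And>u. u \<in> {0<..<t} - K \<Longrightarrow> \<forall>\<^sub>F v in nhds u. e v = e u"
    using e unfolding almost_step_def by blast
  \<comment> \<open>Where the index is locally constant the integrand is continuous, so a solution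
    of the integral equation satisfies the differential equation there.\<close>
  have sol: "continuous_on {0..t} Z \<and> Z 0 = x \<and>
      (\<forall>u\<in>{0<..<t} - K. (Z has_vector_derivative h (e u) (Z u)) (at u))"
    if Z: "\<And>s. s \<in> {0..t} \<Longrightarrow> Z s \<in> S \<and> ((\<lambda>u. h (e u) (Z u)) has_integral (Z s - x)) {0..s}" for Z
  proof (intro conjI ballI)
    let ?f = "\<lambda>u. h (e u) (Z u)"
    have int: "?f integrable_on {0..t}" using Z[of t] t by auto
    have Zeq: "Z s = x + integral {0..s} ?f" if "s \<in> {0..t}" for s
      using Z[OF that] by (auto simp: integral_unique)
    have c: "continuous_on {0..t} (\<lambda>s. x + integral {0..s} ?f)"
      by (intro continuous_intros indefinite_integral_continuous_1 int)
    then show cont: "continuous_on {0..t} Z"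
      by (rule continuous_on_cong[THEN iffD1, OF refl, rotated]) (use Zeq in auto)
    show "Z 0 = x" using Zeq[of 0] t by simp
    fix u assume u: "u \<in> {0<..<t} - K"
    have at_eq: "at u within {0..t} = at u" using u by (intro at_within_interior) auto
    have "isCont Z u" using cont u by (auto simp: continuous_on_interior)
    then have c': "isCont (\<lambda>v. h (e u) (Z v)) u"
      by (rule isCont_o2) (use h[of "e u"] in \<open>simp add: continuous_on_eq_continuous_at\<close>)
    have ev': "\<forall>\<^sub>F v in nhds u. h (e u) (Z v) = ?f v"
      using ev[OF u] by eventually_elim simp
    have "isCont ?f u" by (rule iffD1[OF isCont_cong[OF ev'] c'])
    then have "((\<lambda>s. integral {0..s} ?f) has_vector_derivative ?f u) (at u)"
      using integral_has_vector_derivative_continuous_at[OF int, of u "{}"] u at_eq by auto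
    then have "((\<lambda>s. x + integral {0..s} ?f) has_vector_derivative ?f u) (at u)"
      by (auto intro!: derivative_eq_intros)
    then show "(Z has_vector_derivative ?f u) (at u)"
      by (rule has_vector_derivative_transform_within_open[where S =
          "{0<..<t}"]) (use u Zeq in auto)
  qed
  define D where "D s = X s - Y s" for s
  \<comment> \<open>The factor \<open>exp (- 2 * L * s)\<close> turns the one-sided Lipschitz bound
    into \<open>N' u \<le> 0\<close>, so the damped squared distance cannot leave 0.\<close>
  define N where "N s = exp (- 2 * L * s) * (D s \<bullet> D s)" for s
  define N' where "N' u = exp (- 2 * L * u) * (2 * ((h (e u) (X u) - h (e u) (Y u)) \<bullet> D u) - 2 * L *
      (D u \<bullet> D u))" for u
  note sX = sol[of X, OF X] and sY = sol[of Y, OF Y]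
  have cX: "continuous_on {0..t} X" and cY: "continuous_on {0..t} Y" and X0: "X 0 = x"
      and Y0: "Y 0 = x"
    using conjunct1[OF sX] conjunct1[OF sY] conjunct1[OF conjunct2[OF sX]] conjunct1[OF conjunct2[OF
        sY]] by auto
  have N0: "N 0 = 0" by (simp add: N_def D_def X0 Y0)
  have Npos: "N s \<ge> 0" for s by (simp add: N_def)
  have cN: "continuous_on {0..t} N" unfolding N_def D_def by (intro continuous_intros cX cY)
  have dN: "(N has_real_derivative N' u) (at u)" if u: "u \<in> {0<..<t} - K" for u
  proof -
    have "(X has_vector_derivative h (e u) (X u)) (at u)" "(Y has_vector_derivative h (e u) (Y u))
        (at u)"
      using bspec[OF conjunct2[OF conjunct2[OF sX]] u] bspec[OF conjunct2[OF conjunct2[OF sY]] u]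
          by auto
    then have dD: "(D has_vector_derivative (h (e u) (X u) - h (e u) (Y u))) (at u)"
      unfolding D_def by (auto intro!: derivative_eq_intros)
    then have "((\<lambda>s. D s \<bullet> D s) has_derivative
        (\<lambda>d. D u \<bullet> (d *\<^sub>R (h (e u) (X u) - h (e u) (Y u))) + (d *\<^sub>R (h (e u) (X u) - h (e u) (Y u))) \<bullet>
            D u)) (at u)"
      unfolding has_vector_derivative_def by (intro has_derivative_inner)
    then have "((\<lambda>s. D s \<bullet> D s) has_real_derivative 2 * ((h (e u) (X u) - h (e u) (Y u)) \<bullet> D u)) (at
        u)"
      unfolding has_field_derivative_def by (rule has_derivative_eq_rhs) (auto simp: inner_commute)
    note dDD = this
    have "((\<lambda>s. exp (- 2 * L * s)) has_real_derivative - 2 * L * exp (- 2 * L * u)) (at u)"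
      by (auto intro!: derivative_eq_intros)
    from DERIV_mult[OF this dDD] show ?thesis unfolding N_def N'_def
      by (rule DERIV_cong) (simp add: algebra_simps)
  qed
  have N'neg: "N' u \<le> 0" for u
    using L[of "e u" "X u" "Y u"] unfolding N'_def D_def by (auto intro!: mult_nonneg_nonpos)
  have Ns: "N s = 0" if "s \<in> {0..<T}" for s
  proof -
    have "N s \<le> N 0"
      by (rule nonincreasing_finite[where K = "K \<inter> {0..s}" and N' = N',
        OF _ _ continuous_on_subset[OF cN] dN N'neg]) (use that T K(1)[of s] in auto)
    then show ?thesis using Npos[of s] N0 by simp
  qed
  \<comment> \<open>Infinitely many exceptional times may precede \<open>T\<close>; continuity
    carries the value 0 up to it.\<close>
  have "N T = 0"
  proof (cases "T = 0")
    case False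
    then have "0 < T" using T by simp
    have "(N \<longlongrightarrow> N T) (at T within {0..T})"
      using continuous_on_subset[OF cN, of "{0..T}"] T by (auto simp: continuous_on_def)
    then have "(N \<longlongrightarrow> N T) (at_left T)" using \<open>0 < T\<close> by (simp add: at_within_Icc_at_left)
    moreover have "(N \<longlongrightarrow> 0) (at_left T)"
    proof (rule tendsto_eventually)
      show "\<forall>\<^sub>F x in at_left T. N x = 0"
        using eventually_at_left_real[OF \<open>0 < T\<close>] by eventually_elim (auto intro: Ns)
    qed
    ultimately show ?thesis using tendsto_unique trivial_limit_at_left_real by blast
  qed (simp add: N0)
  moreover have "N t \<le> N T"
    by (rule nonincreasing_finite[where K = "K \<inter> {T..t}" and N' = N',
      OF _ K(2) continuous_on_subset[OF cN] dN N'neg]) (use T in auto)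
  ultimately have "N t = 0" using Npos[of t] by simp
  then show "y = X t" by (simp add: N_def D_def Yt)
qed (rule exI[of _ X], use X in simp)

lemma set_integral_Icc_same [simp]: "(LINT u:{t::real}|lborel. f u) = (0 :: real)"
  unfolding set_lebesgue_integral_def
  by (rule integral_eq_zero_AE) (use AE_lborel_singleton[of t] in eventually_elim, auto)

lemma integrable_on_bounded_borel:
  fixes f :: "real \<Rightarrow> 'a::euclidean_space"
  assumes [measurable]: "f \<in> borel_measurable borel" and B: "\<And>u. u \<in> {s..t} \<Longrightarrow> norm (f u) \<le> B"
  shows "f integrable_on {s..t}"
proof -
  have "set_integrable lborel {s..t} f"
    unfolding set_integrable_def
    by (rule integrableI_bounded_set[where A = "{s..t}" and B = B])
      (auto intro!: B simp: indicator_def emeasure_lborel_Icc_eq)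
  then show ?thesis by (rule set_borel_integral_eq_integral)
qed

text \<open>The product is half the sum of a square and a nonnegative multiple of
  \<open>|x - y|^2\<close>. The cubic part of the fields is thus dissipative, and only the linear
  part enters the one-sided Lipschitz constant.\<close>

lemma cubic_monotone:
  fixes x y :: "'a::real_inner"
  shows "0 \<le> ((x \<bullet> x) *\<^sub>R x - (y \<bullet> y) *\<^sub>R y) \<bullet> (x - y)"
proof -
  have "((x \<bullet> x) *\<^sub>R x - (y \<bullet> y) *\<^sub>R y) \<bullet> (x - y) =
      ((x \<bullet> x - y \<bullet> y)\<^sup>2 + (x \<bullet> x + y \<bullet> y) * ((x - y) \<bullet> (x - y))) / 2"
    by (simp add: inner_diff_left inner_diff_right inner_commute algebra_simps power2_eq_square
        field_simps)
  then show ?thesis by (simp only:) simp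
qed

text \<open>For \<open>n = |x|\<^sup>2\<close>, \<open>gain a j n * |x|\<close> is the radius reached from \<open>x\<close> when the growth is \<open>a\<close>
    and the mass \<open>j\<close>.\<close>

definition gain :: "real \<Rightarrow> real \<Rightarrow> real \<Rightarrow> real" where
  "gain a j n = exp a / sqrt (1 + 2 * n * j)"

lemma gain_pos: "0 \<le> n \<Longrightarrow> 0 \<le> j \<Longrightarrow> 0 < gain a j n"
  by (simp add: gain_def add_pos_nonneg)

lemma gain_0 [simp]: "gain 0 0 n = 1"
  by (simp add: gain_def)

lemma gain_measurable [measurable]:
  assumes [measurable]: "f \<in> borel_measurable M" "g \<in> borel_measurable M" "h \<in> borel_measurable M"
  shows "(\<lambda>x. gain (f x) (g x) (h x)) \<in> borel_measurable M"
  unfolding gain_def by measurable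

definition rot :: "real \<Rightarrow> real \<times> real \<Rightarrow> real \<times> real" where
  "rot t = (\<lambda>(a, b). (a * cos t - b * sin t, a * sin t + b * cos t))"

lemma norm_rot [simp]: "norm (rot t x) = norm x"
proof -
  have "(a * cos t - b * sin t)\<^sup>2 + (a * sin t + b * cos t)\<^sup>2 = a\<^sup>2 + b\<^sup>2" for a b :: real
  proof -
    have "(a * cos t - b * sin t)\<^sup>2 + (a * sin t + b * cos t)\<^sup>2 = (a\<^sup>2 + b\<^sup>2) * ((sin t)\<^sup>2 + (cos t)\<^sup>2)"
      by (simp only: power2_eq_square) algebra
    then show ?thesis by simp
  qed
  then show ?thesis by (cases x) (simp add: rot_def norm_Pair)
qed

lemma rot_scaleR: "rot t (c *\<^sub>R x) = c *\<^sub>R rot t x"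
  by (cases x) (simp add: rot_def algebra_simps)

lemma rot_0 [simp]: "rot 0 x = x" by (cases x) (simp add: rot_def)

lemma rot_2pi [simp]: "rot (2 * pi) x = x" by (cases x) (simp add: rot_def)

lemma planar_field_eq: "planar_field a x = a *\<^sub>R x + (- snd x, fst x) - (x \<bullet> x) *\<^sub>R x"
  by (cases x) (simp add: planar_field_def algebra_simps power2_eq_square)

lemma rot_has_derivative:
  "((\<lambda>s. rot s x) has_vector_derivative (- snd (rot u x), fst (rot u x))) (at u)"
  unfolding rot_def case_prod_beta
  by (rule has_vector_derivative_Pair[THEN has_vector_derivative_eq_rhs])
    (auto intro!: derivative_eq_intros simp flip: has_real_derivative_iff_has_vector_derivative)

section \<open>Growth and mass along an index path\<close>

locale switching =
  fixes pm pp lm lp :: real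
  assumes pm: "pm < 0" and pp: "0 < pp" and lm: "0 < lm" and lp: "0 < lp"
begin

definition p :: "int \<Rightarrow> real" where "p = by_index pm pp"
definition q :: "int \<Rightarrow> real" where "q = by_index lm lp"

text \<open>Since \<open>pm < 0 < pp\<close>, this bounds \<open>|pm|\<close> and \<open>pp\<close>
  at once; it also serves as one-sided Lipschitz constant of both fields.\<close>

definition C :: real where "C = pp - pm"

definition growth :: "(real \<Rightarrow> int) \<Rightarrow> real \<Rightarrow> real" where
  "growth e t = (LINT u:{0..t}|lborel. p (e u))"

text \<open>The linear equation for \<open>1 / |x|^2\<close> has the integrating factor
  \<open>exp (2 * growth e s)\<close> and the constant inhomogeneity 2; this is the integral that
  its solution contains.\<close>

definition mass :: "(real \<Rightarrow> int) \<Rightarrow> real \<Rightarrow> real" where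
  "mass e t = (LINT s:{0..t}|lborel. exp (2 * growth e s))"

abbreviation index_meas :: "(real \<Rightarrow> int) \<Rightarrow> bool" where
  "index_meas e \<equiv> e \<in> borel \<rightarrow>\<^sub>M count_space UNIV"

lemma p_measurable [measurable]: "p \<in> borel_measurable (count_space UNIV)"
  by simp

lemma q_pos: "0 < q i"
  using lm lp by (simp add: q_def by_index_def)

lemma C_pos: "0 < C" using pm pp by (simp add: C_def)

lemma p_bound: "\<bar>p k\<bar> \<le> C"
  using pm pp by (auto simp: p_def by_index_def C_def)

lemma set_integrable_p:
  assumes [measurable]: "index_meas e"
  shows "set_integrable lborel {s..t} (\<lambda>u. p (e u))"
  unfolding set_integrable_def
  by (rule integrableI_bounded_set[where A = "{s..t}" and B = C])
    (auto intro!: p_bound simp: indicator_def emeasure_lborel_Icc_eq)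

lemma growth_eq_integral: "index_meas e \<Longrightarrow> growth e t = integral {0..t} (\<lambda>u. p (e u))"
  unfolding growth_def by (intro set_borel_integral_eq_integral set_integrable_p)

lemma p_integrable_on: "index_meas e \<Longrightarrow> (\<lambda>u. p (e u)) integrable_on {s..t}"
  by (intro set_borel_integral_eq_integral set_integrable_p)

lemma growth_0 [simp]: "growth e 0 = 0"
  by (simp add: growth_def)

lemma growth_diff:
  assumes e: "index_meas e" and "0 \<le> s" "s \<le> t"
  shows "growth e t - growth e s = integral {s..t} (\<lambda>u. p (e u))"
  using Henstock_Kurzweil_Integration.integral_combine[where a = 0 and c = s and b = t
      and f = "\<lambda>u. p (e u)"] assms p_integrable_on[OF e, of 0 t]
  by (simp add: growth_eq_integral)

lemma growth_lipschitz:
  assumes e: "index_meas e" and "0 \<le> s" "s \<le> t"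
  shows "\<bar>growth e t - growth e s\<bar> \<le> C * (t - s)"
proof -
  have "norm (integral {s..t} (\<lambda>u. p (e u))) \<le> integral {s..t} (\<lambda>u. C)"
    using p_integrable_on[OF e, of s t] p_bound
    by (intro integral_norm_bound_integral) auto
  then show ?thesis using assms by (simp add: growth_diff mult.commute)
qed

lemma growth_bound: "index_meas e \<Longrightarrow> 0 \<le> t \<Longrightarrow> \<bar>growth e t\<bar> \<le> C * t"
  using growth_lipschitz[of e 0 t] by simp

lemma growth_bound_Icc:
  assumes "index_meas e" "u \<in> {0..t}"
  shows "\<bar>growth e u\<bar> \<le> C * t"
proof -
  have "\<bar>growth e u\<bar> \<le> C * u" using assms by (intro growth_bound) auto
  also have "\<dots> \<le> C * t" using assms C_pos by (intro mult_left_mono) auto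
  finally show ?thesis .
qed

lemma growth_continuous: "index_meas e \<Longrightarrow> continuous_on {0..t} (growth e)"
  using indefinite_integral_continuous_1[OF p_integrable_on[of e 0 t]]
      by (simp add: growth_eq_integral)

lemma growth_measurable [measurable]:
  assumes [measurable]: "index_meas e"
  shows "growth e \<in> borel_measurable borel"
  unfolding growth_def[abs_def] set_lebesgue_integral_def indicator_def atLeastAtMost_iff
      by measurable

text \<open>The value at \<open>t\<close> itself is left out because two paths are compared up to a
  time \<open>t\<close> at which one of them may jump.\<close>

lemma growth_cong:
  assumes "index_meas e" "index_meas e'" "\<And>u. 0 \<le> u \<Longrightarrow> u < t \<Longrightarrow> e u = e' u"
  shows "growth e t = growth e' t"
  using assms by (simp add: growth_eq_integral)
    (intro integral_spike[of "{t}"]; force)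

lemma index_meas_shift: "index_meas e \<Longrightarrow> index_meas (\<lambda>u. e (s + u))"
  by (rule measurable_compose[of "\<lambda>u. s + u" borel borel e]) auto

lemma growth_add:
  assumes e: "index_meas e" and "0 \<le> s" "0 \<le> t"
  shows "growth e (s + t) = growth e s + growth (\<lambda>u. e (s + u)) t"
proof -
  have "growth e (s + t) - growth e s = integral {s..s+t} (\<lambda>u. p (e u))"
    using assms by (intro growth_diff) auto
  also have "\<dots> = integral {0..t} (\<lambda>u. p (e (s + u)))"
    using integral_shift_Icc_real[of 0 t "\<lambda>u. p (e u)" s] by (simp add: o_def add.commute)
  also have "\<dots> = growth (\<lambda>u. e (s + u)) t"
    by (simp add: growth_eq_integral index_meas_shift[OF e])
  finally show ?thesis by simp
qed

lemma growth_const: "0 \<le> t \<Longrightarrow> growth (\<lambda>_. i) t = p i * t"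
  by (simp add: growth_eq_integral mult.commute)

lemma set_integrable_exp_growth:
  assumes [measurable]: "index_meas e" and "0 \<le> s"
  shows "set_integrable lborel {s..t} (\<lambda>u. exp (2 * growth e u))"
  using assms by (intro borel_integrable_atLeastAtMost' continuous_intros continuous_on_subset[OF
      growth_continuous[of e t]]) auto

lemma mass_eq_integral: "index_meas e \<Longrightarrow> mass e t = integral {0..t} (\<lambda>u. exp (2 * growth e u))"
  unfolding mass_def by (intro set_borel_integral_eq_integral set_integrable_exp_growth) auto

lemma exp_growth_integrable_on:
  "index_meas e \<Longrightarrow> 0 \<le> s \<Longrightarrow> (\<lambda>u. exp (2 * growth e u)) integrable_on {s..t}"
  by (intro set_borel_integral_eq_integral set_integrable_exp_growth) auto

lemma mass_0 [simp]: "mass e 0 = 0"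
  by (simp add: mass_def)

lemma mass_diff:
  assumes e: "index_meas e" and "0 \<le> s" "s \<le> t"
  shows "mass e t - mass e s = integral {s..t} (\<lambda>u. exp (2 * growth e u))"
  using Henstock_Kurzweil_Integration.integral_combine[where a = 0 and c = s and b = t
      and f = "\<lambda>u. exp (2 * growth e u)"] assms exp_growth_integrable_on[OF e, of 0 t]
  by (simp add: mass_eq_integral)

lemma mass_cong:
  assumes "index_meas e" "index_meas e'" "\<And>u. 0 \<le> u \<Longrightarrow> u < t \<Longrightarrow> e u = e' u"
  shows "mass e t = mass e' t"
proof -
  have "growth e s = growth e' s" if "s \<le> t" for s
    by (rule growth_cong) (use assms that in auto)
  then show ?thesis using assms by (auto simp: mass_eq_integral intro!: integral_cong)
qed

text \<open>Together with \<open>growth_add\<close> this is the composition law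
  \<open>(a, j) (a', j') = (a + a', j + exp (2 * a) * j')\<close> of the affine maps by which the
  flow acts on \<open>1 / |x|^2\<close>.\<close>

lemma mass_add:
  assumes e: "index_meas e" and st: "0 \<le> s" "0 \<le> t"
  shows "mass e (s + t) = mass e s + exp (2 * growth e s) * mass (\<lambda>u. e (s + u)) t"
proof -
  have "mass e (s + t) - mass e s = integral {s..s+t} (\<lambda>u. exp (2 * growth e u))"
    using assms by (intro mass_diff) auto
  also have "\<dots> = integral {0..t} (\<lambda>u. exp (2 * growth e (s + u)))"
    using integral_shift_Icc_real[of 0 t "\<lambda>u. exp (2 * growth e u)" s]
        by (simp add: o_def add.commute)
  also have "\<dots> = integral {0..t} (\<lambda>u. exp (2 * growth e s) * exp (2 * growth (\<lambda>u. e (s + u)) u))"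
    using assms by (intro integral_cong) (auto simp: growth_add[OF e] distrib_left exp_add)
  also have "\<dots> = exp (2 * growth e s) * mass (\<lambda>u. e (s + u)) t"
    by (simp add: mass_eq_integral index_meas_shift[OF e])
  finally show ?thesis by simp
qed

lemma mass_mono: "index_meas e \<Longrightarrow> 0 \<le> s \<Longrightarrow> s \<le> t \<Longrightarrow> mass e s \<le> mass e t"
  using mass_diff[of e s t] integral_nonneg[OF exp_growth_integrable_on[of e s t]] by simp

lemma mass_nonneg: "index_meas e \<Longrightarrow> 0 \<le> t \<Longrightarrow> 0 \<le> mass e t"
  using mass_mono[of e 0 t] by simp

text \<open>The growth stays within \<open>C * t\<close> on \<open>{0..t}\<close>. The point of
  these crude bounds is that they are uniform over all paths.\<close>

lemma mass_bounds:
  assumes e: "index_meas e" and t: "0 \<le> t"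
  shows "t * exp (- 2 * C * t) \<le> mass e t" "mass e t \<le> t * exp (2 * C * t)"
proof -
  have *: "\<bar>growth e u\<bar> \<le> C * t" if "u \<in> {0..t}" for u
    by (rule growth_bound_Icc[OF e that])
  have "integral {0..t} (\<lambda>u. exp (- 2 * C * t)) \<le> mass e t"
    unfolding mass_eq_integral[OF e]
  proof (intro integral_le exp_growth_integrable_on e)
    show "exp (- 2 * C * t) \<le> exp (2 * growth e u)" if "u \<in> {0..t}" for u
      using *[OF that] by (auto simp: abs_le_iff algebra_simps)
  qed auto
  then show "t * exp (- 2 * C * t) \<le> mass e t" using t by simp
  have "mass e t \<le> integral {0..t} (\<lambda>u. exp (2 * C * t))"
    unfolding mass_eq_integral[OF e]
  proof (intro integral_le exp_growth_integrable_on e)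
    show "exp (2 * growth e u) \<le> exp (2 * C * t)" if "u \<in> {0..t}" for u
      using *[OF that] by simp
  qed auto
  then show "mass e t \<le> t * exp (2 * C * t)" using t by simp
qed

lemma mass_continuous: "index_meas e \<Longrightarrow> continuous_on {0..t} (mass e)"
  using indefinite_integral_continuous_1[OF exp_growth_integrable_on[of e 0 t]]
      by (simp add: mass_eq_integral)

lemma mass_has_derivative:
  assumes e: "index_meas e" and u: "0 < u"
  shows "(mass e has_real_derivative exp (2 * growth e u)) (at u)"
proof -
  have "((\<lambda>t. integral {0..t} (\<lambda>u. exp (2 * growth e u))) has_real_derivative exp (2 * growth e u))
      (at u within {0..u+1})"
    using u by (intro integral_has_real_derivative continuous_intros growth_continuous e) auto
  moreover have "at u within {0..u+1} = at u" using u by (intro at_within_interior) auto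
  ultimately show ?thesis by (simp add: mass_eq_integral[OF e, abs_def])
qed

lemma growth_has_derivative:
  assumes e: "index_meas e" and u: "0 < u" and ev: "\<forall>\<^sub>F v in nhds u. e v = e u"
  shows "(growth e has_real_derivative p (e u)) (at u)"
proof -
  have "isCont (\<lambda>v. p (e v)) u \<longleftrightarrow> isCont (\<lambda>v. p (e u)) u"
    by (rule isCont_cong) (use ev in eventually_elim, simp)
  then have "isCont (\<lambda>v. p (e v)) u" by simp
  moreover have "at u within {0..u+1} = at u" using u by (intro at_within_interior) auto
  ultimately have "((\<lambda>t. integral {0..t} (\<lambda>u. p (e u))) has_vector_derivative p (e u)) (at u)"
    using integral_has_vector_derivative_continuous_at[OF p_integrable_on[OF e, of 0 "u+1"], of u
        "{}"] u by simp
  then show ?thesis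
    by (simp add: growth_eq_integral[OF e, abs_def] has_real_derivative_iff_has_vector_derivative)
qed

text \<open>Multiplied by \<open>|x|\<close>, with \<open>n = |x|^2\<close>, this is the radial
  equation \<open>r' = p * r - r ^ 3\<close>. Stating it for the factor instead of the radius covers
  the origin, where \<open>n = 0\<close>.\<close>

lemma gain_has_derivative:
  assumes e: "index_meas e" and u: "0 < u" and ev: "\<forall>\<^sub>F v in nhds u. e v = e u" and n: "0 \<le> n"
  shows "((\<lambda>s. gain (growth e s) (mass e s) n) has_real_derivative
    p (e u) * gain (growth e u) (mass e u) n - n * gain (growth e u) (mass e u) n ^ 3) (at u)"
proof -
  let ?a = "growth e u" and ?j = "mass e u"
  let ?D = "1 + 2 * n * ?j"
  have D: "0 < ?D" using mass_nonneg[OF e, of u] u n by (simp add: add_pos_nonneg)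
  have 1: "((\<lambda>s. exp (growth e s)) has_real_derivative exp ?a * p (e u)) (at u)"
    by (rule DERIV_fun_exp[OF growth_has_derivative[OF e u ev]])
  have 2: "((\<lambda>s. 1 + 2 * n * mass e s) has_real_derivative 2 * n * exp (2 * ?a)) (at u)"
    by (auto intro!: derivative_eq_intros mass_has_derivative e u)
  have 3: "((\<lambda>s. sqrt (1 + 2 * n * mass e s)) has_real_derivative inverse (sqrt ?D) / 2 * (2 * n *
      exp (2 * ?a))) (at u)"
    by (rule DERIV_chain2[OF DERIV_real_sqrt[OF D] 2])
  have "((\<lambda>s. gain (growth e s) (mass e s) n) has_real_derivative
      (exp ?a * p (e u) * sqrt ?D - exp ?a * (inverse (sqrt ?D) / 2 * (2 * n * exp (2 * ?a)))) /
          (sqrt ?D * sqrt ?D)) (at u)"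
    unfolding gain_def by (rule DERIV_divide[OF 1 3]) (use D in simp)
  moreover have "(exp ?a * p (e u) * sqrt ?D - exp ?a * (inverse (sqrt ?D) / 2 * (2 * n * exp (2 *
      ?a)))) / (sqrt ?D * sqrt ?D)
     = p (e u) * gain ?a ?j n - n * gain ?a ?j n ^ 3"
  proof -
    define y where "y = sqrt ?D"
    have y: "0 < y" unfolding y_def using D by simp
    have ex: "exp (2 * ?a) = exp ?a * exp ?a" by (simp flip: exp_add)
    show ?thesis unfolding gain_def y_def[symmetric] ex using y
      by (simp add: field_simps power3_eq_cube)
  qed
  ultimately show ?thesis by simp
qed

lemma gain_continuous:
  assumes e: "index_meas e" and n: "0 \<le> n"
  shows "continuous_on {0..t} (\<lambda>s. gain (growth e s) (mass e s) n)"
proof -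
  have "sqrt (1 + 2 * n * mass e s) \<noteq> 0" if "s \<in> {0..t}" for s
    using mass_nonneg[OF e, of s] that n by (simp add: add_nonneg_eq_0_iff)
  then show ?thesis unfolding gain_def
    by (intro continuous_intros growth_continuous mass_continuous e) auto
qed

lemma mass_measurable [measurable]:
  assumes [measurable]: "index_meas e"
  shows "mass e \<in> borel_measurable borel"
  unfolding mass_def[abs_def] set_lebesgue_integral_def indicator_def atLeastAtMost_iff
      by measurable

lemma gain_le:
  assumes e: "index_meas e" and u: "u \<in> {0..t}" and n: "0 \<le> n"
  shows "gain (growth e u) (mass e u) n \<le> exp (C * t)"
proof -
  have "\<bar>growth e u\<bar> \<le> C * t"
    by (rule growth_bound_Icc[OF e u])
  moreover have "1 \<le> sqrt (1 + 2 * n * mass e u)" using mass_nonneg[OF e, of u] u n by simp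
  ultimately have "exp (growth e u) / sqrt (1 + 2 * n * mass e u) \<le> exp (C * t) / 1"
    by (intro frac_le) auto
  then show ?thesis by (simp add: gain_def)
qed

lemma position_radial:
  assumes e: "index_meas e" and st: "\<And>s. 0 \<le> s \<Longrightarrow> almost_step e s" and t: "0 \<le> t" and x: "0 < x"
  shows "position {0<..} (by_index (radial_field pm) (radial_field pp)) e x t
     = gain (growth e t) (mass e t) (x\<^sup>2) * x"
proof -
  let ?h = "by_index (radial_field pm) (radial_field pp)"
  have h: "?h k = radial_field (p k)" for k by (simp add: by_index_def p_def)
  let ?X = "\<lambda>s. gain (growth e s) (mass e s) (x\<^sup>2) * x"
  show ?thesis
  proof (rule position_eqI[OF t st[OF t], where L = C and X = ?X])
    show "continuous_on UNIV (?h k)" for k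
      unfolding h radial_field_def by (intro continuous_intros)
    show "(?h k a - ?h k b) \<bullet> (a - b) \<le> C * ((a - b) \<bullet> (a - b))" for k a b
    proof -
      have "(?h k a - ?h k b) \<bullet> (a - b) = p k * ((a - b) * (a - b)) - ((a \<bullet> a) *\<^sub>R a - (b \<bullet> b) *\<^sub>R b)
          \<bullet> (a - b)"
        by (simp add: h radial_field_def algebra_simps power3_eq_cube)
      also have "\<dots> \<le> C * ((a - b) * (a - b)) - 0"
        using p_bound[of k] by (intro diff_mono mult_right_mono cubic_monotone) auto
      finally show ?thesis by simp
    qed
    fix s assume s: "s \<in> {0..t}"
    have cX: "continuous_on {0..s} ?X" by (intro continuous_intros gain_continuous e) auto
    have pos: "?X u > 0" if "0 \<le> u" for u
      using gain_pos[OF _ mass_nonneg[OF e that]] x by simp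
    have bd: "\<bar>?X u\<bar> \<le> exp (C * s) * x" if "u \<in> {0..s}" for u
      using gain_le[OF e that, of "x\<^sup>2"] pos[of u] that x by auto
    have "((\<lambda>u. ?h (e u) (?X u)) has_integral (?X s - ?X 0)) {0..s}"
    proof (rule integral_of_deriv_almost_step[OF _ cX _ st])
      let ?B = "exp (C * s) * x"
      show "(\<lambda>u. ?h (e u) (?X u)) integrable_on {0..s}"
        unfolding h radial_field_def
      proof (rule integrable_on_bounded_borel[where B = "C * ?B + ?B ^ 3"])
        show "(\<lambda>u. p (e u) * ?X u - ?X u ^ 3) \<in> borel_measurable borel" using e by simp
        fix u assume u: "u \<in> {0..s}"
        have "norm (p (e u) * ?X u - ?X u ^ 3) \<le> \<bar>p (e u)\<bar> * \<bar>?X u\<bar> + \<bar>?X u\<bar> ^ 3"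
          by (metis abs_mult norm_triangle_ineq4 power_abs real_norm_def)
        also have "\<dots> \<le> C * ?B + ?B ^ 3"
          using bd[OF u] p_bound C_pos by (intro add_mono mult_mono power_mono) auto
        finally show "norm (p (e u) * ?X u - ?X u ^ 3) \<le> C * ?B + ?B ^ 3" .
      qed
      fix u assume u: "u \<in> {0<..<s}" and ev: "\<forall>\<^sub>F v in nhds u. e v = e u"
      have "(?X has_real_derivative (p (e u) * gain (growth e u) (mass e u) (x\<^sup>2)
          - x\<^sup>2 * gain (growth e u) (mass e u) (x\<^sup>2) ^ 3) * x) (at u)"
        using u by (intro DERIV_cmult_right gain_has_derivative e ev) auto
      then show "(?X has_vector_derivative ?h (e u) (?X u)) (at u)"
        unfolding has_real_derivative_iff_has_vector_derivative[symmetric] h radial_field_def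
        by (rule DERIV_cong) (simp add: algebra_simps power2_eq_square power3_eq_cube)
    qed (use s in auto)
    then show "?X s \<in> {0<..} \<and> ((\<lambda>u. ?h (e u) (?X u)) has_integral (?X s - x)) {0..s}"
      using pos[of s] s by simp
  qed
qed

text \<open>The field is \<open>p * x + J x - |x|^2 * x\<close> with \<open>J\<close> the quarter
  turn. \<open>J\<close> generates \<open>rot\<close>, commutes with scalars and satisfies
  \<open>J v \<bullet> v = 0\<close>, so it affects neither the radial factor nor the one-sided
  Lipschitz estimate.\<close>

lemma position_planar:
  assumes e: "index_meas e" and st: "\<And>s. 0 \<le> s \<Longrightarrow> almost_step e s" and t: "0 \<le> t"
  shows "position UNIV (by_index (planar_field pm) (planar_field pp)) e x t
     = gain (growth e t) (mass e t) ((norm x)\<^sup>2) *\<^sub>R rot t x"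
proof -
  let ?h = "by_index (planar_field pm) (planar_field pp)"
  have h: "?h k = planar_field (p k)" for k by (simp add: by_index_def p_def)
  let ?g = "\<lambda>s. gain (growth e s) (mass e s) ((norm x)\<^sup>2)"
  let ?X = "\<lambda>s. ?g s *\<^sub>R rot s x"
  show ?thesis
  proof (rule position_eqI[OF t st[OF t], where L = C and X = ?X])
    show "continuous_on UNIV (?h k)" for k
      unfolding h planar_field_eq by (intro continuous_intros)
    show "(?h k a - ?h k b) \<bullet> (a - b) \<le> C * ((a - b) \<bullet> (a - b))" for k a b
    proof -
      have "(?h k a - ?h k b) \<bullet> (a - b) = p k * ((a - b) \<bullet> (a - b)) - ((a \<bullet> a) *\<^sub>R a - (b \<bullet> b) *\<^sub>R b)
          \<bullet> (a - b)"
        by (cases a; cases b) (simp add: h planar_field_eq inner_simps algebra_simps)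
      also have "\<dots> \<le> C * ((a - b) \<bullet> (a - b)) - 0"
        using p_bound[of k] by (intro diff_mono mult_right_mono cubic_monotone) auto
      finally show ?thesis by simp
    qed
    fix s assume s: "s \<in> {0..t}"
    have cX: "continuous_on {0..s} ?X"
      by (intro continuous_intros gain_continuous e)
        (auto intro!: continuous_at_imp_continuous_on has_vector_derivative_continuous[OF
            rot_has_derivative])
    have gpos: "?g u > 0" if "0 \<le> u" for u
      using gain_pos[OF _ mass_nonneg[OF e that]] by simp
    have bd: "norm (?X u) \<le> exp (C * s) * norm x" if "u \<in> {0..s}" for u
      using gain_le[OF e that, of "(norm x)\<^sup>2"] gpos[of u] that by (auto intro!: mult_right_mono)
    have "((\<lambda>u. ?h (e u) (?X u)) has_integral (?X s - ?X 0)) {0..s}"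
    proof (rule integral_of_deriv_almost_step[OF _ cX _ st])
      let ?B = "exp (C * s) * norm x"
      show "(\<lambda>u. ?h (e u) (?X u)) integrable_on {0..s}"
        unfolding h
      proof (rule integrable_on_bounded_borel[where B = "C * ?B + ?B + ?B\<^sup>2 * ?B"])
        have [measurable]: "(\<lambda>u. fst (?X u)) \<in> borel_measurable borel" "(\<lambda>u. snd (?X u)) \<in>
            borel_measurable borel"
          unfolding rot_def case_prod_beta using e by simp_all
        note [measurable] = e
        show "(\<lambda>u. planar_field (p (e u)) (?X u)) \<in> borel_measurable borel"
          unfolding planar_field_def case_prod_beta by (intro borel_measurable_Pair; measurable)
        fix u assume u: "u \<in> {0..s}"
        have "norm (planar_field (p (e u)) (?X u)) \<le>
            norm (p (e u) *\<^sub>R ?X u) + norm (- snd (?X u), fst (?X u)) + norm ((?X u \<bullet> ?X u) *\<^sub>R ?X u)"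
          unfolding planar_field_eq by (intro norm_triangle_le_diff norm_triangle_mono add_mono
              norm_triangle_ineq order_refl)
        also have "\<dots> = \<bar>p (e u)\<bar> * norm (?X u) + norm (?X u) + (norm (?X u))\<^sup>2 * norm (?X u)"
        proof -
          have 1: "norm (- snd z, fst z) = norm z" for z :: "real \<times> real"
            by (cases z) (simp add: norm_Pair add.commute)
          have 2: "norm ((z \<bullet> z) *\<^sub>R z) = (norm z)\<^sup>2 * norm z" for z :: "real \<times> real"
            by (simp flip: power2_norm_eq_inner)
          show ?thesis unfolding 1 2 norm_scaleR[of "p (e u)"] ..
        qed
        also have "\<dots> \<le> C * ?B + ?B + ?B\<^sup>2 * ?B"
          using bd[OF u] p_bound C_pos by (intro add_mono mult_mono power_mono) auto
        finally show "norm (planar_field (p (e u)) (?X u)) \<le> C * ?B + ?B + ?B\<^sup>2 * ?B" .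
      qed
      fix u assume u: "u \<in> {0<..<s}" and ev: "\<forall>\<^sub>F v in nhds u. e v = e u"
      have "(?X has_vector_derivative (?g u *\<^sub>R (- snd (rot u x), fst (rot u x)) +
          (p (e u) * ?g u - (norm x)\<^sup>2 * ?g u ^ 3) *\<^sub>R rot u x)) (at u)"
        using u by (intro has_vector_derivative_scaleR gain_has_derivative rot_has_derivative e ev)
            auto
      moreover have "?X u \<bullet> ?X u = (?g u)\<^sup>2 * (norm x)\<^sup>2"
        by (simp add: power2_norm_eq_inner[symmetric] power_mult_distrib)
      ultimately show "(?X has_vector_derivative ?h (e u) (?X u)) (at u)"
        unfolding h planar_field_eq
        by (auto elim!: has_vector_derivative_eq_rhs simp: scaleR_diff_left power2_eq_square
            power3_eq_cube mult_ac)
    qed (use s in auto)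
    then show "?X s \<in> UNIV \<and> ((\<lambda>u. ?h (e u) (?X u)) has_integral (?X s - x)) {0..s}"
      by simp
  qed
qed

subsection \<open>The renewal equation\<close>

abbreviation seqs :: "(nat \<Rightarrow> real) measure" where
  "seqs \<equiv> (\<Pi>\<^sub>M n\<in>UNIV. borel)"

abbreviation H :: "int \<Rightarrow> (nat \<Rightarrow> real) measure" where
  "H i \<equiv> holding_times q i"

abbreviation hold :: "int \<Rightarrow> real measure" where
  "hold i \<equiv> density lborel (\<lambda>s. ennreal (exponential_density (q i) s))"

lemma prob_space_hold: "prob_space (hold i)"
  by (rule prob_space_exponential_density[OF q_pos])

sublocale H: prob_space "H i" for i
  unfolding holding_times_def by (intro prob_space_PiM prob_space_hold)

text \<open>Behind its first holding time the chain is the same chain started in the other state,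
  because \<open>i * (-1) ^ Suc n = - i * (-1) ^ n\<close>. The two measures are compared on
  cylinders.\<close>

lemma H_eq_distr_case_nat:
  "H i = distr (hold i \<Otimes>\<^sub>M H (- i)) seqs (\<lambda>(s, \<tau>). case_nat s \<tau>)"
proof -
  let ?M = "\<lambda>n::nat. hold (i * (-1) ^ n)" and ?N = "\<lambda>n::nat. hold (- i * (-1) ^ n)"
  have N: "?N n = ?M (Suc n)" for n by simp
  have H': "H (- i) = PiM UNIV ?N" "H i = PiM UNIV ?M" by (simp_all add: holding_times_def)
  interpret M0: prob_space "hold i" by (rule prob_space_hold)
  interpret PM: product_prob_space ?M UNIV by (intro product_prob_spaceI prob_space_hold)
  interpret PN: product_prob_space ?N UNIV by (intro product_prob_spaceI prob_space_hold)
  have sf: "sigma_finite_measure (PiM UNIV ?N)"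
    by (intro prob_space_imp_sigma_finite prob_space_PiM prob_space_hold)
  have m: "(\<lambda>(s, \<tau>). case_nat s \<tau>) \<in> hold i \<Otimes>\<^sub>M PiM UNIV ?N \<rightarrow>\<^sub>M seqs"
  proof -
    have [measurable_cong]: "sets (PiM UNIV ?N) = sets seqs" by (intro sets_PiM_cong) auto
    show ?thesis unfolding case_prod_beta by measurable
  qed
  have "distr (hold i \<Otimes>\<^sub>M PiM UNIV ?N) seqs (\<lambda>(s, \<tau>). case_nat s \<tau>) = PiM UNIV ?M"
  proof (rule PM.PiM_eq)
    show "sets (distr (hold i \<Otimes>\<^sub>M PiM UNIV ?N) seqs (\<lambda>(s, \<tau>). case_nat s \<tau>)) = sets (PiM UNIV ?M)"
      by (auto intro!: sets_PiM_cong)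
    fix J E assume J: "finite J" "J \<subseteq> (UNIV :: nat set)" "\<And>j. j \<in> J \<Longrightarrow> E j \<in> sets (?M j)"
    \<comment> \<open>A cylinder over \<open>J\<close> splits into a condition on the first
      coordinate, void if \<open>0 \<notin> J\<close>, and a cylinder over the shifted index
      set.\<close>
    let ?X = "prod_emb UNIV ?M J (\<Pi>\<^sub>E j\<in>J. E j)"
    let ?E = "if 0 \<in> J then E 0 else UNIV"
    let ?F = "prod_emb UNIV ?N (Suc -` J) (\<Pi>\<^sub>E j\<in>Suc -` J. E (Suc j))"
    have eq: "(\<lambda>(s, \<tau>). case_nat s \<tau>) -` ?X \<inter> space (hold i \<Otimes>\<^sub>M PiM UNIV ?N) = ?E \<times> ?F"
      by (auto simp: space_pair_measure space_PiM PiE_iff prod_emb_def all_conj_distrib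
          split: nat.split nat.split_asm)
    have X: "?X \<in> sets seqs"
    proof -
      have "?X \<in> sets (PiM UNIV ?M)" using J by (intro sets_PiM_I) auto
      also have "sets (PiM UNIV ?M) = sets seqs" by (intro sets_PiM_cong) auto
      finally show ?thesis .
    qed
    have fin: "finite (Suc -` J)" using J by (simp add: finite_vimageI)
    have "emeasure (distr (hold i \<Otimes>\<^sub>M PiM UNIV ?N) seqs (\<lambda>(s, \<tau>). case_nat s \<tau>)) ?X
        = emeasure (hold i \<Otimes>\<^sub>M PiM UNIV ?N) (?E \<times> ?F)"
      by (subst emeasure_distr[OF m X]) (simp only: eq)
    also have "\<dots> = emeasure (hold i) ?E * emeasure (PiM UNIV ?N) ?F"
      using J fin by (intro sigma_finite_measure.emeasure_pair_measure_Times[OF sf]) (auto intro!: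
          sets_PiM_I)
    also have "emeasure (PiM UNIV ?N) ?F = (\<Prod>j\<in>Suc -` J. emeasure (?N j) (E (Suc j)))"
      using J fin by (intro PN.emeasure_PiM_emb) simp_all
    also have "\<dots> = (\<Prod>j\<in>Suc -` J. emeasure (?M (Suc j)) (E (Suc j)))" by simp
    also have "\<dots> = (\<Prod>j\<in>J - {0}. emeasure (?M j) (E j))"
      by (rule prod.reindex_bij_witness[where i = "\<lambda>x. x - 1" and j = Suc]) auto
    also have "emeasure (hold i) ?E = (if 0 \<in> J then emeasure (?M 0) (E 0) else 1)"
      using M0.emeasure_space_1 by simp
    also have "\<dots> * (\<Prod>j\<in>J - {0}. emeasure (?M j) (E j)) = (\<Prod>j\<in>J. emeasure (?M j) (E j))"
      using J(1) by (auto simp: prod.remove)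
    finally show "emeasure (distr (hold i \<Otimes>\<^sub>M PiM UNIV ?N) seqs (\<lambda>(s, \<tau>). case_nat s \<tau>)) ?X
       = (\<Prod>j\<in>J. emeasure (?M j) (E j))" .
  qed
  then show ?thesis by (simp add: H')
qed

text \<open>The source of all renewal equations: a functional of the path is averaged over the first
  holding time \<open>s\<close> and over the path that starts afresh at \<open>s\<close> in state
  \<open>- i\<close>.\<close>

lemma first_jump:
  assumes [measurable]: "G \<in> borel_measurable seqs"
  shows "(\<integral>\<^sup>+\<tau>. G \<tau> \<partial>H i) =
    (\<integral>\<^sup>+s. ennreal (q i * exp (- q i * s)) * indicator {0..} s * (\<integral>\<^sup>+\<tau>. G (case_nat s \<tau>) \<partial>H (- i))
        \<partial>lborel)"
proof -
  have [measurable]: "(\<lambda>(s, \<tau>). G (case_nat s \<tau>)) \<in> borel_measurable (borel \<Otimes>\<^sub>M H (- i))"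
    unfolding case_prod_beta by measurable
  have "(\<integral>\<^sup>+\<tau>. G \<tau> \<partial>H i) = (\<integral>\<^sup>+x. G (case_nat (fst x) (snd x)) \<partial>(hold i \<Otimes>\<^sub>M H (- i)))"
    by (subst H_eq_distr_case_nat, subst nn_integral_distr) (simp_all add: case_prod_beta)
  also have "\<dots> = (\<integral>\<^sup>+s. \<integral>\<^sup>+\<tau>. G (case_nat s \<tau>) \<partial>H (- i) \<partial>hold i)"
    by (subst H.nn_integral_fst[symmetric]) (auto simp: case_prod_beta)
  also have "\<dots> = (\<integral>\<^sup>+s. ennreal (exponential_density (q i) s) * (\<integral>\<^sup>+\<tau>. G (case_nat s \<tau>) \<partial>H (- i))
      \<partial>lborel)"
    by (subst nn_integral_density) (auto simp: case_prod_beta)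
  also have "\<dots> = (\<integral>\<^sup>+s. ennreal (q i * exp (- q i * s)) * indicator {0..} s * (\<integral>\<^sup>+\<tau>. G (case_nat s \<tau>)
      \<partial>H (- i)) \<partial>lborel)"
    by (intro nn_integral_cong) (auto simp: exponential_density_def indicator_def mult.commute)
  finally show ?thesis .
qed

lemma nn_integral_exponential_Icc:
  assumes "0 \<le> t"
  shows "(\<integral>\<^sup>+s. ennreal (q i * exp (- q i * s)) * indicator {0..t} s \<partial>lborel) =
      ennreal (1 - exp (- q i * t))"
proof -
  have "(\<integral>\<^sup>+s. ennreal (q i * exp (- q i * s)) * indicator {0..t} s \<partial>lborel)
      = ennreal (- exp (- q i * t) - (- exp (- q i * 0)))"
    using assms q_pos[of i]
    by (intro nn_integral_FTC_Icc) (auto intro!: derivative_eq_intros simp: less_imp_le)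
  then show ?thesis by simp
qed

lemma nn_integral_exponential_Ioi:
  assumes "0 \<le> t"
  shows "(\<integral>\<^sup>+s. ennreal (q i * exp (- q i * s)) * indicator {t<..} s \<partial>lborel) =
      ennreal (exp (- q i * t))"
proof -
  have "(\<integral>\<^sup>+s. ennreal (q i * exp (- q i * s)) * indicator {t<..} s \<partial>lborel)
      = (\<integral>\<^sup>+s. ennreal (q i * exp (- q i * s)) * indicator {t..} s \<partial>lborel)"
    by (intro nn_integral_cong_AE) (use AE_lborel_singleton[of t] in eventually_elim, auto simp:
        indicator_def)
  also have "\<dots> = ennreal (0 - (- exp (- q i * t)))"
  proof (intro nn_integral_FTC_atLeast)
    have "filterlim (\<lambda>s. q i * s) at_top at_top"
      using q_pos[of i] by (intro filterlim_tendsto_pos_mult_at_top[OF tendsto_const]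
          filterlim_ident)
    then have "((\<lambda>s. - exp (- (q i * s))) \<longlongrightarrow> - 0) at_top"
      by (intro tendsto_minus filterlim_compose[OF exp_at_bot] filterlim_uminus_at_bot_at_top[THEN
          filterlim_compose])
    then show "((\<lambda>s. - exp (- q i * s)) \<longlongrightarrow> 0) at_top" by simp
  qed (use q_pos[of i] in \<open>auto intro!: derivative_eq_intros simp: less_imp_le\<close>)
  finally show ?thesis by simp
qed

text \<open>Over \<open>{0..T}\<close> the renewal operator is a contraction in the supremum distance.\<close>
lemma renewal_le:
  fixes u v g :: "real \<Rightarrow> 'y \<Rightarrow> int \<Rightarrow> ennreal" and \<phi> :: "int \<Rightarrow> real \<Rightarrow> 'y \<Rightarrow> 'y"
  assumes u: "\<And>t y i. 0 \<le> t \<Longrightarrow> i \<in> {-1, 1} \<Longrightarrow> u t y i \<le> g t y i +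
      (\<integral>\<^sup>+s. ennreal (q i * exp (- q i * s)) * indicator {0..t} s * u (t - s) (\<phi> i s y) (- i)
          \<partial>lborel)"
    and v: "\<And>t y i. 0 \<le> t \<Longrightarrow> i \<in> {-1, 1} \<Longrightarrow> v t y i = g t y i +
      (\<integral>\<^sup>+s. ennreal (q i * exp (- q i * s)) * indicator {0..t} s * v (t - s) (\<phi> i s y) (- i)
          \<partial>lborel)"
    and u1: "\<And>t y i. 0 \<le> t \<Longrightarrow> u t y i \<le> 1"
    and m: "\<And>t y i. (\<lambda>s. v (t - s) (\<phi> i s y) (- i)) \<in> borel_measurable borel"
    and ti: "0 \<le> t" "i \<in> {-1, 1}"
  shows "u t y i \<le> v t y i"
proof -
  define T where "T = t"
  have T: "0 \<le> T" using ti by (simp add: T_def)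
  \<comment> \<open>Differences in \<open>ennreal\<close> are truncated at 0, so \<open>D\<close>
    measures by how much \<open>u\<close> exceeds \<open>v\<close> anywhere up to time
    \<open>T\<close>. The factor \<open>\<kappa>\<close> bounds the probability of a jump before
    \<open>T\<close> from either state, as \<open>q i \<le> lm + lp\<close>.\<close>
  define D where "D = (SUP (t, y, i) \<in> {0..T} \<times> UNIV \<times> {-1, 1}. u t y i - v t y i)"
  define \<kappa> where "\<kappa> = 1 - exp (- (lm + lp) * T)"
  have D: "u t y i - v t y i \<le> D" if "t \<in> {0..T}" "i \<in> {-1, 1}" for t y i
    unfolding D_def by (rule SUP_upper2[of "(t, y, i)"]) (use that in auto)
  have uv: "u t y i \<le> v t y i + D" if "t \<in> {0..T}" "i \<in> {-1, 1}" for t y i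
    using D[OF that, of y] by (simp only: ennreal_minus_le_iff)
  have step: "u t y i - v t y i \<le> ennreal \<kappa> * D" if t: "t \<in> {0..T}" and i: "i \<in> {-1, 1}" for t y i
  proof -
    let ?k = "\<lambda>s. ennreal (q i * exp (- q i * s)) * indicator {0..t} s"
    have "u t y i \<le> g t y i + (\<integral>\<^sup>+s. ?k s * u (t - s) (\<phi> i s y) (- i) \<partial>lborel)"
      using t i by (intro u) auto
    also have "\<dots> \<le> g t y i + (\<integral>\<^sup>+s. ?k s * (v (t - s) (\<phi> i s y) (- i) + D) \<partial>lborel)"
    proof (intro add_left_mono nn_integral_mono)
      fix s
      show "?k s * u (t - s) (\<phi> i s y) (- i) \<le> ?k s * (v (t - s) (\<phi> i s y) (- i) + D)"
      proof (cases "s \<in> {0..t}")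
        case True
        then show ?thesis using t i by (intro mult_left_mono uv) auto
      qed auto
    qed
    also have "(\<integral>\<^sup>+s. ?k s * (v (t - s) (\<phi> i s y) (- i) + D) \<partial>lborel)
       = (\<integral>\<^sup>+s. ?k s * v (t - s) (\<phi> i s y) (- i) \<partial>lborel) + (\<integral>\<^sup>+s. ?k s \<partial>lborel) * D"
      using m by (simp add: distrib_left nn_integral_add nn_integral_multc)
    also have "(\<integral>\<^sup>+s. ?k s \<partial>lborel) * D \<le> ennreal \<kappa> * D"
    proof (rule mult_right_mono)
      have "q i * t \<le> (lm + lp) * T"
        using t lm lp by (intro mult_mono) (auto simp: q_def by_index_def)
      then have "exp (- (lm + lp) * T) \<le> exp (- q i * t)"
          by (simp only: exp_le_cancel_iff mult_minus_left)
      then show "(\<integral>\<^sup>+s. ?k s \<partial>lborel) \<le> ennreal \<kappa>"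
        using t by (subst nn_integral_exponential_Icc) (auto simp: \<kappa>_def intro!: ennreal_leI)
    qed simp
    finally have "u t y i \<le> v t y i + ennreal \<kappa> * D"
      using v[of t i y] t i by (simp add: add.assoc add_left_mono)
    moreover have "u t y i \<noteq> \<top>" using u1[of t y i] t by (auto simp: top_unique)
    ultimately show ?thesis by (simp add: ennreal_minus_le_iff)
  qed
  \<comment> \<open>Finiteness of \<open>D\<close> is what lets \<open>D \<le> \<kappa> * D\<close>
    with \<open>\<kappa> < 1\<close> force \<open>D = 0\<close>.\<close>
  have D1: "D \<le> 1" unfolding D_def
    by (intro SUP_least) (auto intro!: order_trans[OF diff_le_self_ennreal u1])
  have "D \<le> ennreal \<kappa> * D"
    by (subst D_def) (intro SUP_least, use step in auto)
  moreover obtain d where d: "D = ennreal d" "0 \<le> d"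
    using D1 by (cases D) (auto simp: top_unique)
  moreover have k: "0 \<le> \<kappa>" "\<kappa> < 1" using T lm lp by (auto simp: \<kappa>_def intro!: mult_nonpos_nonneg)
  ultimately have "d \<le> \<kappa> * d" by (simp flip: ennreal_mult)
  then have "(1 - \<kappa>) * d \<le> 0" by (simp add: algebra_simps)
  then have "d \<le> 0" using k by (simp add: mult_le_0_iff)
  then have "D = 0" using d by simp
  then show ?thesis using uv[of t i y] ti by (simp add: T_def)
qed

section \<open>Non-explosion and restart at the first jump\<close>

definition good :: "(nat \<Rightarrow> real) \<Rightarrow> bool" where
  "good \<tau> \<longleftrightarrow> (\<forall>n. 0 < \<tau> n) \<and> (\<forall>t. \<exists>n. t < (\<Sum>k\<le>n. \<tau> k))"

lemma AE_H_pos: "AE \<tau> in H i. \<forall>n. 0 < \<tau> n"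
proof (subst AE_all_countable, rule allI)
  fix n
  have "AE s in lborel. 0 < ennreal (exponential_density (q (i * (-1) ^ n)) s) \<longrightarrow> 0 < s"
    using AE_lborel_singleton[of 0] by eventually_elim (auto simp: exponential_density_def)
  then have *: "AE s in hold (i * (-1) ^ n). 0 < s"
    by (simp add: AE_density)
  then show "AE \<tau> in H i. 0 < \<tau> n"
    using AE_PiM_component[of UNIV "\<lambda>n. hold (i * (-1) ^ n)" n "\<lambda>s. 0 < s"] prob_space_hold
    unfolding holding_times_def by blast
qed

lemma sum_case_nat: "(\<Sum>k\<le>n. case_nat s \<tau> k) = s + (\<Sum>k<n. \<tau> k :: real)"
  by (induction n) auto

lemma sum_case_nat_Suc: "(\<Sum>k\<le>Suc n. case_nat s \<tau> k) = s + (\<Sum>k\<le>n. \<tau> k :: real)"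
  unfolding sum_case_nat lessThan_Suc_atMost ..

text \<open>The probability \<open>\<rho> t\<close> that all jumps happen by time \<open>t\<close>
  satisfies a renewal inequality without inhomogeneity, and 0 solves the corresponding equation.
  Comparison gives \<open>\<rho> t = 0\<close>.\<close>

lemma AE_H_nonexplosive: "i \<in> {-1, 1} \<Longrightarrow> AE \<tau> in H i. \<forall>t::nat. \<exists>n. real t < (\<Sum>k\<le>n. \<tau> k)"
proof (subst AE_all_countable, rule allI)
  fix t :: nat assume i: "i \<in> {-1, 1}"
  define \<rho> :: "real \<Rightarrow> unit \<Rightarrow> int \<Rightarrow> ennreal" where
    "\<rho> t y i = emeasure (H i) {\<tau>. \<forall>n. (\<Sum>k\<le>n. \<tau> k) \<le> t}" for t y i
  have [measurable]: "{\<tau>. \<forall>n. (\<Sum>k\<le>n. \<tau> k) \<le> t} \<in> sets seqs" for t :: real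
  proof -
    have "{\<tau> \<in> space seqs. \<forall>n. (\<Sum>k\<le>n. \<tau> k) \<le> t} \<in> sets seqs" by measurable
    then show ?thesis by (simp add: space_PiM)
  qed
  have "\<rho> t () i \<le> (\<lambda>_ _ _. 0) t () i"
  proof (rule renewal_le[where g = "\<lambda>_ _ _. 0" and \<phi> = "\<lambda>_ _ _. ()"])
    fix t :: real and y i assume "0 \<le> t"
    have "\<rho> t y i = (\<integral>\<^sup>+\<tau>. indicator {\<tau>. \<forall>n. (\<Sum>k\<le>n. \<tau> k) \<le> t} \<tau> \<partial>H i)"
      unfolding \<rho>_def by (subst nn_integral_indicator) auto
    also have "\<dots> = (\<integral>\<^sup>+s. ennreal (q i * exp (- q i * s)) * indicator {0..} s *
        (\<integral>\<^sup>+\<tau>. indicator {\<tau>. \<forall>n. (\<Sum>k\<le>n. \<tau> k) \<le> t} (case_nat s \<tau>) \<partial>H (- i)) \<partial>lborel)"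
      by (rule first_jump) measurable
    also have "\<dots> \<le> (\<integral>\<^sup>+s. ennreal (q i * exp (- q i * s)) * indicator {0..t} s * \<rho> (t - s) () (- i)
        \<partial>lborel)"
    proof (intro nn_integral_mono)
      fix s
      have eq: "indicator {\<tau>. \<forall>n. (\<Sum>k\<le>n. \<tau> k) \<le> t} (case_nat s \<tau>) \<le>
          (indicator {..t} s * indicator {\<tau>. \<forall>n. (\<Sum>k\<le>n. \<tau> k) \<le> t - s} \<tau> :: ennreal)" for \<tau>
      proof -
        have "s \<le> t \<and> (\<forall>n. (\<Sum>k\<le>n. \<tau> k) \<le> t - s)" if "\<forall>n. (\<Sum>k\<le>n. case_nat s \<tau> k) \<le> t"
        proof (intro conjI allI)
          show "s \<le> t" using that[rule_format, of 0] by simp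
          show "(\<Sum>k\<le>n. \<tau> k) \<le> t - s" for n
            using that[rule_format, of "Suc n"] by (simp add: sum_case_nat_Suc del: sum.atMost_Suc)
        qed
        then show ?thesis by (auto simp: indicator_def)
      qed
      have "(\<integral>\<^sup>+\<tau>. indicator {\<tau>. \<forall>n. (\<Sum>k\<le>n. \<tau> k) \<le> t} (case_nat s \<tau>) \<partial>H (- i))
          \<le> (\<integral>\<^sup>+\<tau>. indicator {..t} s * indicator {\<tau>. \<forall>n. (\<Sum>k\<le>n. \<tau> k) \<le> t - s} \<tau> \<partial>H (- i))"
        by (intro nn_integral_mono eq)
      also have "\<dots> = indicator {..t} s * \<rho> (t - s) () (- i)"
        unfolding \<rho>_def by (subst nn_integral_cmult) auto
      finally show "ennreal (q i * exp (- q i * s)) * indicator {0..} s *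
          (\<integral>\<^sup>+\<tau>. indicator {\<tau>. \<forall>n. (\<Sum>k\<le>n. \<tau> k) \<le> t} (case_nat s \<tau>) \<partial>H (- i))
         \<le> ennreal (q i * exp (- q i * s)) * indicator {0..t} s * \<rho> (t - s) () (- i)"
        by (auto simp: indicator_def intro!: mult_left_mono split: if_splits)
    qed
    finally show "\<rho> t y i \<le> 0 + (\<integral>\<^sup>+s. ennreal (q i * exp (- q i * s)) * indicator {0..t} s * \<rho> (t -
        s) () (- i) \<partial>lborel)"
      by simp
  qed (use i in \<open>auto simp: \<rho>_def H.emeasure_le_1\<close>)
  then have "emeasure (H i) {\<tau>. \<forall>n. (\<Sum>k\<le>n. \<tau> k) \<le> real t} = 0" by (simp add: \<rho>_def)
  then show "AE \<tau> in H i. \<exists>n. real t < (\<Sum>k\<le>n. \<tau> k)"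
    by (intro AE_I[where N = "{\<tau>. \<forall>n. (\<Sum>k\<le>n. \<tau> k) \<le> real t}"]) (auto simp: not_less)
qed

lemma AE_H_good:
  assumes i: "i \<in> {-1, 1}" shows "AE \<tau> in H i. good \<tau>"
  using AE_H_pos[of i] AE_H_nonexplosive[OF i]
proof eventually_elim
  case (elim \<tau>)
  have "\<exists>n. t < (\<Sum>k\<le>n. \<tau> k)" for t
    using elim(2)[rule_format, of "nat \<lceil>t\<rceil>"] by (meson le_less_trans real_nat_ceiling_ge)
  then show ?case using elim by (auto simp: good_def)
qed

lemma good_finite:
  assumes "good \<tau>" shows "finite {n. (\<Sum>k\<le>n. \<tau> k) \<le> t}"
proof -
  obtain m where m: "t < (\<Sum>k\<le>m. \<tau> k)" using assms by (auto simp: good_def)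
  have "n < m" if "(\<Sum>k\<le>n. \<tau> k) \<le> t" for n
  proof (rule ccontr)
    assume "\<not> n < m"
    then have "(\<Sum>k\<le>m. \<tau> k) \<le> (\<Sum>k\<le>n. \<tau> k)"
      using assms by (intro sum_mono2) (auto simp: good_def less_imp_le)
    then show False using m that by simp
  qed
  then have "{n. (\<Sum>k\<le>n. \<tau> k) \<le> t} \<subseteq> {..<m}" by auto
  then show ?thesis by (rule finite_subset) simp
qed

lemma index_path_before:
  assumes "good \<tau>" "u < s"
  shows "index_path i (case_nat s \<tau>) u = i"
proof -
  have "0 \<le> (\<Sum>k<n. \<tau> k)" for n using assms by (intro sum_nonneg) (auto simp: good_def less_imp_le)
  then have "\<not> s + (\<Sum>k<n. \<tau> k) \<le> u" for n using assms(2) add_increasing2[of "\<Sum>k<n. \<tau> k" s s]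
      by (smt (verit, best))
  then show ?thesis by (simp add: index_path_def sum_case_nat)
qed

lemma index_path_after:
  assumes "good \<tau>" "s \<le> u"
  shows "index_path i (case_nat s \<tau>) u = index_path (- i) \<tau> (u - s)"
proof -
  have "{n. (\<Sum>k\<le>n. case_nat s \<tau> k) \<le> u} = insert 0 (Suc ` {n. (\<Sum>k\<le>n. \<tau> k) \<le> u - s})"
  proof (intro set_eqI)
    fix n show "n \<in> {n. (\<Sum>k\<le>n. case_nat s \<tau> k) \<le> u} \<longleftrightarrow> n \<in> insert 0 (Suc ` {n. (\<Sum>k\<le>n. \<tau> k) \<le> u - s})"
      using assms(2) by (cases n) (auto simp: sum_case_nat_Suc simp del: sum.atMost_Suc)
  qed
  then have "card {n. (\<Sum>k\<le>n. case_nat s \<tau> k) \<le> u} = Suc (card {n. (\<Sum>k\<le>n. \<tau> k) \<le> u - s})"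
    using good_finite[OF assms(1)] by (subst \<open>_ = insert 0 _\<close>) (simp add: card_image)
  then show ?thesis by (simp add: index_path_def)
qed

abbreviation gr :: "int \<Rightarrow> (nat \<Rightarrow> real) \<Rightarrow> real \<Rightarrow> real" where
  "gr i \<tau> t \<equiv> growth (index_path i \<tau>) t"

abbreviation ms :: "int \<Rightarrow> (nat \<Rightarrow> real) \<Rightarrow> real \<Rightarrow> real" where
  "ms i \<tau> t \<equiv> mass (index_path i \<tau>) t"

lemma index_meas_index_path [simp, measurable]: "index_meas (index_path i \<tau>)"
  by (rule measurable_index_path') (auto simp: space_PiM)

lemma gr_measurable [measurable (raw)]:
  assumes [measurable]: "f \<in> M \<rightarrow>\<^sub>M seqs" "g \<in> borel_measurable M"
  shows "(\<lambda>x. gr i (f x) (g x)) \<in> borel_measurable M"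
  unfolding growth_def set_lebesgue_integral_def indicator_def atLeastAtMost_iff by measurable

lemma ms_measurable [measurable (raw)]:
  assumes [measurable]: "f \<in> M \<rightarrow>\<^sub>M seqs" "g \<in> borel_measurable M"
  shows "(\<lambda>x. ms i (f x) (g x)) \<in> borel_measurable M"
  unfolding mass_def set_lebesgue_integral_def indicator_def atLeastAtMost_iff by measurable

lemma growth_after:
  assumes "good \<tau>" "0 \<le> s" "s \<le> t"
  shows "gr i (case_nat s \<tau>) t = p i * s + gr (- i) \<tau> (t - s)"
    and "ms i (case_nat s \<tau>) t = mass (\<lambda>_. i) s + exp (2 * (p i * s)) * ms (- i) \<tau> (t - s)"
    and "index_path i (case_nat s \<tau>) t = index_path (- i) \<tau> (t - s)"
proof -
  let ?e = "index_path i (case_nat s \<tau>)"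
  have g: "growth ?e s = p i * s"
    using assms by (subst growth_cong[of _ "\<lambda>_. i"]) (auto simp: index_path_before growth_const)
  have m: "mass ?e s = mass (\<lambda>_. i) s"
    using assms by (intro mass_cong) (auto simp: index_path_before)
  have g': "growth (\<lambda>u. ?e (s + u)) (t - s) = gr (- i) \<tau> (t - s)"
    using assms by (intro growth_cong index_meas_shift) (auto simp: index_path_after)
  have m': "mass (\<lambda>u. ?e (s + u)) (t - s) = ms (- i) \<tau> (t - s)"
    using assms by (intro mass_cong index_meas_shift) (auto simp: index_path_after)
  show "gr i (case_nat s \<tau>) t = p i * s + gr (- i) \<tau> (t - s)"
    using growth_add[of ?e s "t - s"] assms by (simp add: g g')
  show "ms i (case_nat s \<tau>) t = mass (\<lambda>_. i) s + exp (2 * (p i * s)) * ms (- i) \<tau> (t - s)"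
    using mass_add[of ?e s "t - s"] assms by (simp add: g m m')
  show "index_path i (case_nat s \<tau>) t = index_path (- i) \<tau> (t - s)"
    using assms by (simp add: index_path_after)
qed

lemma growth_before:
  assumes "good \<tau>" "0 \<le> t" "t < s"
  shows "gr i (case_nat s \<tau>) t = p i * t" "ms i (case_nat s \<tau>) t = mass (\<lambda>_. i) t"
    "index_path i (case_nat s \<tau>) t = i"
  using assms
  by (subst growth_cong[of _ "\<lambda>_. i"]; auto simp: index_path_before growth_const)
    (use assms in \<open>auto intro!: mass_cong simp: index_path_before\<close>)

section \<open>The Chapman-Kolmogorov equation\<close>

abbreviation obs :: "(real \<Rightarrow> real \<Rightarrow> int \<Rightarrow> ennreal) \<Rightarrow> bool" where
  "obs F \<equiv> (\<lambda>(a, j, k). F a j k) \<in> borel_measurable (borel \<Otimes>\<^sub>M borel \<Otimes>\<^sub>M count_space UNIV)"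

lemma obs_compose:
  assumes F: "obs F" and [measurable]: "f \<in> borel_measurable M" "g \<in> borel_measurable M" "h \<in>
      M \<rightarrow>\<^sub>M count_space UNIV"
  shows "(\<lambda>x. F (f x) (g x) (h x)) \<in> borel_measurable M"
proof -
  have "(\<lambda>x. (f x, g x, h x)) \<in> M \<rightarrow>\<^sub>M borel \<Otimes>\<^sub>M borel \<Otimes>\<^sub>M count_space UNIV"
      by (intro measurable_Pair assms)
  from measurable_compose[OF this F] show ?thesis by (simp only: prod.case)
qed

text \<open>The growth \<open>a\<close> and the mass \<open>j\<close> accumulated so far are
  arguments, because the rest of the path adds to them through the composition law; this closes the
  family under conditioning on the first jump.\<close>

definition expect :: "(real \<Rightarrow> real \<Rightarrow> int \<Rightarrow> ennreal) \<Rightarrow> real \<Rightarrow> real \<Rightarrow> real \<Rightarrow> int \<Rightarrow> ennreal" where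
  "expect F t a j i = (\<integral>\<^sup>+\<tau>. F (a + gr i \<tau> t) (j + exp (2 * a) * ms i \<tau> t) (index_path i \<tau> t) \<partial>H i)"

lemma expect_measurable [measurable (raw)]:
  assumes F: "obs F" and [measurable]: "f \<in> borel_measurable M" "g \<in> borel_measurable M" "h \<in>
      borel_measurable M"
  shows "(\<lambda>x. expect F (f x) (g x) (h x) i) \<in> borel_measurable M"
proof -
  have "(\<lambda>(x, \<tau>). F (g x + gr i \<tau> (f x)) (h x + exp (2 * g x) * ms i \<tau> (f x)) (index_path i \<tau> (f
      x)))
      \<in> borel_measurable (M \<Otimes>\<^sub>M H i)"
    unfolding case_prod_beta by (rule obs_compose[OF F]) measurable
  then show ?thesis unfolding expect_def by (rule H.borel_measurable_nn_integral)
qed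

lemma obs_expect [measurable]: "obs F \<Longrightarrow> obs (expect F t)"
proof -
  assume [measurable]: "obs F"
  have "(\<lambda>x. expect F t (fst x) (fst (snd x)) (snd (snd x))) \<in> borel_measurable (borel \<Otimes>\<^sub>M borel \<Otimes>\<^sub>M
      count_space UNIV)"
    by (rule measurable_compose_countable[where f = "\<lambda>k x. expect F t (fst x) (fst (snd x)) k"
        and g = "\<lambda>x. snd (snd x)"]) measurable
  then show ?thesis by (simp add: case_prod_beta)
qed

lemma emeasure_H_UNIV [simp]: "emeasure (H i) UNIV = 1"
  using H.emeasure_space_1[of i] by simp

lemma expect_le_1: "(\<And>a j k. F a j k \<le> 1) \<Longrightarrow> expect F t a j i \<le> 1"
  unfolding expect_def by (rule order_trans[OF nn_integral_mono[where v =
      "\<lambda>_. 1"]]) (auto simp: H.emeasure_space_1)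

text \<open>With probability \<open>exp (- q i * t)\<close> there is no jump before
  \<open>t\<close>, which gives the first term. A first jump at \<open>s \<le> t\<close> restarts
  the functional in state \<open>- i\<close> from the values that \<open>a\<close> and
  \<open>j\<close> have reached.\<close>

lemma expect_renewal:
  assumes F [measurable]: "obs F" and t: "0 \<le> t" and i: "i \<in> {-1, 1}"
  shows "expect F t a j i = ennreal (exp (- q i * t)) * F (a + p i * t) (j +
      exp (2 * a) * mass (\<lambda>_. i) t) i +
    (\<integral>\<^sup>+s. ennreal (q i * exp (- q i * s)) * indicator {0..t} s *
      expect F (t - s) (a + p i * s) (j + exp (2 * a) * mass (\<lambda>_. i) s) (- i) \<partial>lborel)"
proof -
  let ?G = "\<lambda>\<tau>. F (a + gr i \<tau> t) (j + exp (2 * a) * ms i \<tau> t) (index_path i \<tau> t)"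
  let ?c = "F (a + p i * t) (j + exp (2 * a) * mass (\<lambda>_. i) t) i"
  let ?V = "\<lambda>s. expect F (t - s) (a + p i * s) (j + exp (2 * a) * mass (\<lambda>_. i) s) (- i)"
  let ?k = "\<lambda>s. ennreal (q i * exp (- q i * s))"
  have good: "AE \<tau> in H (- i). good \<tau>" using i by (intro AE_H_good) auto
  have "expect F t a j i = (\<integral>\<^sup>+s. ?k s * indicator {0..} s * (\<integral>\<^sup>+\<tau>. ?G (case_nat s \<tau>) \<partial>H (- i))
      \<partial>lborel)"
    unfolding expect_def by (rule first_jump, rule obs_compose[OF F]) measurable
  also have "\<dots> = (\<integral>\<^sup>+s. ?k s * indicator {t<..} s * ?c + ?k s * indicator {0..t} s * ?V s \<partial>lborel)"
  proof (intro nn_integral_cong)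
    fix s :: real
    consider "s < 0" | "0 \<le> s" "s \<le> t" | "0 \<le> s" "t < s" by linarith
    then show "?k s * indicator {0..} s * (\<integral>\<^sup>+\<tau>. ?G (case_nat s \<tau>) \<partial>H (- i)) =
        ?k s * indicator {t<..} s * ?c + ?k s * indicator {0..t} s * ?V s"
    proof cases
      case 2
      have "(\<integral>\<^sup>+\<tau>. ?G (case_nat s \<tau>) \<partial>H (- i)) = ?V s"
        unfolding expect_def
        by (intro nn_integral_cong_AE, use good in eventually_elim)
          (use 2 in \<open>simp add: growth_after distrib_left exp_add ac_simps\<close>)
      then show ?thesis using 2 by simp
    next
      case 3
      have "(\<integral>\<^sup>+\<tau>. ?G (case_nat s \<tau>) \<partial>H (- i)) = (\<integral>\<^sup>+\<tau>. ?c \<partial>H (- i))"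
        by (intro nn_integral_cong_AE, use good in eventually_elim) (use 3 t in \<open>simp add:
            growth_before\<close>)
      then show ?thesis using 3 by (simp add: H.emeasure_space_1)
    qed (use t in auto)
  qed
  also have "\<dots> = (\<integral>\<^sup>+s. ?k s * indicator {t<..} s * ?c \<partial>lborel) +
      (\<integral>\<^sup>+s. ?k s * indicator {0..t} s * ?V s \<partial>lborel)"
    by (rule nn_integral_add) measurable
  also have "(\<integral>\<^sup>+s. ?k s * indicator {t<..} s * ?c \<partial>lborel) = ennreal (exp (- q i * t)) * ?c"
    by (subst nn_integral_multc) (simp, simp only: nn_integral_exponential_Ioi[OF t])
  finally show ?thesis .
qed

lemma mass_const_add:
  "0 \<le> s \<Longrightarrow> 0 \<le> t \<Longrightarrow> mass (\<lambda>_. i) (s + t) = mass (\<lambda>_. i) s + exp (2 * (p i * s)) * mass (\<lambda>_. i) t"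
  using mass_add[of "\<lambda>_. i" s t] by (simp add: growth_const)

text \<open>As functions of \<open>t\<close> both sides solve the same renewal equation, so
  \<open>renewal_le\<close> applies in both directions. The memoryless property enters as the
  factorization of the exponential at \<open>t\<close>.\<close>

lemma chapman_kolmogorov:
  assumes F: "obs F" and F1: "\<And>a j k. F a j k \<le> 1" and s: "0 \<le> s" and t: "0 \<le> t"
      and i: "i \<in> {-1, 1}"
  shows "expect F (t + s) a j i = expect (expect F s) t a j i"
proof -
  note [measurable] = F
  \<comment> \<open>The motion of the pair \<open>(a, j)\<close> while the index stays at
    \<open>i\<close>.\<close>
  define \<phi> where "\<phi> i s = (\<lambda>(a, j). (a + p i * s, j + exp (2 * a) * mass (\<lambda>_. i) s))" for i s
  define u where "u t y i = expect F (t + s) (fst y) (snd y) i" for t y i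
  define v where "v t y i = expect (expect F s) t (fst y) (snd y) i" for t y i
  define g where "g t y i = ennreal (exp (- q i * t)) * expect F s (fst (\<phi> i t y)) (snd (\<phi> i t y))
      i" for t y i
  let ?k = "\<lambda>i s. ennreal (q i * exp (- q i * s))"
  have u: "u t y i = g t y i + (\<integral>\<^sup>+r. ?k i r * indicator {0..t} r * u (t - r) (\<phi> i r y) (- i)
      \<partial>lborel)"
    if t: "0 \<le> t" and i: "i \<in> {-1, 1}" for t y i
  proof -
    obtain a j where y: "y = (a, j)" by force
    let ?a = "\<lambda>r. a + p i * r" and ?j = "\<lambda>r. j + exp (2 * a) * mass (\<lambda>_. i) r"
    have flow: "?j t + exp (2 * ?a t) * mass (\<lambda>_. i) r = ?j (t + r)" if "0 \<le> r" for r
      unfolding mass_const_add[OF t that] by (simp add: distrib_left exp_add)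
    let ?f = "\<lambda>r. ?k i r * expect F (t + s - r) (?a r) (?j r) (- i)"
    have "u t y i = ennreal (exp (- q i * (t + s))) * F (?a (t + s)) (?j (t + s)) i +
       (\<integral>\<^sup>+r. ?k i r * indicator {0..t + s} r * expect F (t + s - r) (?a r) (?j r) (- i) \<partial>lborel)"
      unfolding u_def y by (subst expect_renewal) (use t s i F in auto)
    also have "(\<integral>\<^sup>+r. ?k i r * indicator {0..t + s} r * expect F (t +
        s - r) (?a r) (?j r) (- i) \<partial>lborel)
      = (\<integral>\<^sup>+r. ?f r * indicator {0..t} r + ?f r * indicator {t..t + s} r \<partial>lborel)"
      by (intro nn_integral_cong_AE, use AE_lborel_singleton[of t] in eventually_elim)
        (use t s in \<open>auto simp: indicator_def\<close>)
    also have "\<dots> = (\<integral>\<^sup>+r. ?f r * indicator {0..t} r \<partial>lborel) + (\<integral>\<^sup>+r. ?f r * indicator {t..t +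
        s} r \<partial>lborel)"
      by (rule nn_integral_add) measurable
    also have "(\<integral>\<^sup>+r. ?f r * indicator {0..t} r \<partial>lborel) =
        (\<integral>\<^sup>+r. ?k i r * indicator {0..t} r * u (t - r) (\<phi> i r y) (- i) \<partial>lborel)"
      by (intro nn_integral_cong) (simp add: u_def \<phi>_def y algebra_simps)
    \<comment> \<open>First jumps behind \<open>t\<close>: after a shift by \<open>t\<close> the
      factor \<open>exp (- q i * t)\<close> splits off, and together with the term without any jump
      the rest is the renewal equation of \<open>expect F s\<close> at the point reached at time
      \<open>t\<close>.\<close>
    also have "(\<integral>\<^sup>+r. ?f r * indicator {t..t + s} r \<partial>lborel) = (\<integral>\<^sup>+r. ?f (t + r) * indicator {t..t +
        s} (t + r) \<partial>lborel)"
      using nn_integral_real_affine[of "\<lambda>r. ?f r * indicator {t..t + s} r" 1 t] by simp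
    also have "\<dots> = (\<integral>\<^sup>+r. ennreal (exp (- q i * t)) * (?k i r * indicator {0..s} r *
        expect F (s - r) (?a t + p i * r) (?j t + exp (2 * ?a t) * mass (\<lambda>_. i) r) (- i)) \<partial>lborel)"
    proof (intro nn_integral_cong)
      fix r
      show "?f (t + r) * indicator {t..t + s} (t + r) = ennreal (exp (- q i * t)) * (?k i r *
          indicator {0..s} r *
        expect F (s - r) (?a t + p i * r) (?j t + exp (2 * ?a t) * mass (\<lambda>_. i) r) (- i))"
      proof (cases "r \<in> {0..s}")
        case True
        have "?k i (t + r) = ennreal (exp (- q i * t)) * ?k i r"
          using q_pos[of i] by (simp add: distrib_left exp_add[symmetric] algebra_simps flip:
              ennreal_mult)
        then show ?thesis using True t flow[of r] by (simp add: algebra_simps)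
      qed (auto simp: indicator_def)
    qed
    also have "\<dots> = ennreal (exp (- q i * t)) * (\<integral>\<^sup>+r. ?k i r * indicator {0..s} r *
        expect F (s - r) (?a t + p i * r) (?j t + exp (2 * ?a t) * mass (\<lambda>_. i) r) (- i) \<partial>lborel)"
      by (rule nn_integral_cmult) measurable
    also have "ennreal (exp (- q i * (t + s))) * F (?a (t + s)) (?j (t + s)) i =
        ennreal (exp (- q i * t)) * (ennreal (exp (- q i * s)) * F (?a t + p i * s) (?j t +
            exp (2 * ?a t) * mass (\<lambda>_. i) s) i)"
    proof -
      have "ennreal (exp (- q i * (t + s))) = ennreal (exp (- q i * t)) * ennreal (exp (- q i * s))"
        by (simp add: algebra_simps flip: ennreal_mult exp_add)
      moreover have "?a (t + s) = ?a t + p i * s" by (simp add: distrib_left)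
      ultimately show ?thesis unfolding flow[OF s] by (simp only: mult.assoc)
    qed
    finally have "u t y i = ennreal (exp (- q i * t)) * expect F s (?a t) (?j t) i +
        (\<integral>\<^sup>+r. ?k i r * indicator {0..t} r * u (t - r) (\<phi> i r y) (- i) \<partial>lborel)"
      by (subst expect_renewal[OF F s i]) (simp add: distrib_left add_ac)
    then show ?thesis by (simp add: g_def \<phi>_def y)
  qed
  have v: "v t y i = g t y i + (\<integral>\<^sup>+r. ?k i r * indicator {0..t} r * v (t - r) (\<phi> i r y) (- i)
      \<partial>lborel)"
    if t: "0 \<le> t" and i: "i \<in> {-1, 1}" for t y i
    unfolding v_def by (subst expect_renewal[OF obs_expect[OF F] t i]) (simp add: g_def \<phi>_def
        case_prod_beta)
  have \<phi>m: "(\<lambda>r. fst (\<phi> i r y)) \<in> borel_measurable borel" "(\<lambda>r. snd (\<phi> i r y)) \<in>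
      borel_measurable borel" for i y
    unfolding \<phi>_def case_prod_beta by simp_all
  note [measurable] = \<phi>m obs_expect[OF F]
  have "u t (a, j) i \<le> v t (a, j) i"
    by (rule renewal_le[where \<phi> = \<phi> and g = g and u = u and v = v, OF _ v])
      (use u t i in \<open>auto simp: u_def[abs_def] v_def intro!: expect_le_1 F1\<close>)
  moreover have "v t (a, j) i \<le> u t (a, j) i"
    by (rule renewal_le[where \<phi> = \<phi> and g = g and u = v and v = u, OF _ u])
      (use v t i in \<open>auto simp: u_def v_def[abs_def] intro!: expect_le_1 F1\<close>)
  ultimately show ?thesis by (simp add: u_def v_def)
qed

section \<open>The two-state chain and its stationary law\<close>

definition \<pi> :: "int \<Rightarrow> real" where
  "\<pi> = by_index (lp / (lp + lm)) (lm / (lp + lm))"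

lemma \<pi>_pos: "0 < \<pi> k" using lm lp by (simp add: \<pi>_def by_index_def)

lemma \<pi>_sum: "\<pi> (-1) + \<pi> 1 = 1"
  using lm lp by (simp add: \<pi>_def by_index_def flip: add_divide_distrib)

text \<open>The generator of the chain has the eigenvalues 0 and \<open>- (lm + lp)\<close>; this is
  the resulting transition function, which converges to the stationary law
  \<open>\<pi>\<close>.\<close>

definition trans :: "real \<Rightarrow> int \<Rightarrow> int \<Rightarrow> real" where
  "trans t i k = \<pi> k + (of_bool (i = k) - \<pi> k) * exp (- (lm + lp) * t)"

lemma trans_nonneg:
  assumes "0 \<le> t" shows "0 \<le> trans t i k"
proof -
  have "exp (- (lm + lp) * t) \<le> 1" using assms lm lp by (simp add: mult_nonpos_nonneg)
  then have "\<pi> k * exp (- (lm + lp) * t) \<le> \<pi> k * 1" using \<pi>_pos[of k] by (intro mult_left_mono) auto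
  moreover have "trans t i k = \<pi> k * 1 - \<pi> k * exp (- (lm + lp) * t) + of_bool (i = k) * exp (- (lm +
      lp) * t)"
    unfolding trans_def by (simp only: left_diff_distrib mult_1_right)
  moreover have "0 \<le> of_bool (i = k) * exp (- (lm + lp) * t)" by simp
  ultimately show ?thesis by linarith
qed

text \<open>The probability and the closed formula solve the same renewal equation, and two
  applications of \<open>renewal_le\<close> identify them.\<close>

lemma prob_index:
  assumes t: "0 \<le> t" and i: "i \<in> {-1, 1}" and k: "k \<in> {-1, 1}"
  shows "emeasure (H i) {\<tau>. index_path i \<tau> t = k} = ennreal (trans t i k)"
proof -
  let ?\<Lambda> = "lm + lp"
  have \<Lambda>: "0 < ?\<Lambda>" using lm lp by simp
  define F :: "real \<Rightarrow> real \<Rightarrow> int \<Rightarrow> ennreal" where "F a j l = indicator {k} l" for a j l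
  have "indicator {k} \<in> borel_measurable (count_space UNIV)" by simp
  have F1: "F a j l \<le> 1" for a j l by (simp add: F_def indicator_def)
  from measurable_compose[OF measurable_compose[OF measurable_snd measurable_snd] \<open>indicator {k} \<in>
      _\<close>]
  have F: "obs F" unfolding F_def case_prod_beta .
  note tr0 = trans_nonneg
  have tr1: "trans t i k \<le> 1" if "0 \<le> t" for t i
  proof -
    have e: "exp (- ?\<Lambda> * t) \<le> 1" using that \<Lambda> by (simp add: mult_nonpos_nonneg)
    have "\<pi> k \<le> 1" using \<pi>_pos[of 1] \<pi>_pos[of "-1"] \<pi>_sum k by auto
    then have "(of_bool (i = k) - \<pi> k) * exp (- ?\<Lambda> * t) \<le> (1 - \<pi> k) * 1"
      using e by (intro mult_mono) auto
    then show ?thesis by (simp add: trans_def)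
  qed
  define u where "u t y i = expect F t 0 0 i" for t and y :: unit and i
  define v where "v t y i = ennreal (trans t i k)" for t and y :: unit and i
  let ?k = "\<lambda>i s. ennreal (q i * exp (- q i * s))"
  let ?g = "\<lambda>t y i. ennreal (exp (- q i * t)) * indicator {k} i"
  have u: "u t y i = ?g t y i + (\<integral>\<^sup>+r. ?k i r * indicator {0..t} r * u (t - r) () (- i) \<partial>lborel)"
    if "0 \<le> t" "i \<in> {-1, 1}" for t y i
  proof -
    have c: "expect F r a j i = u r () i" for r a j i by (simp add: expect_def F_def u_def)
    have "u t y i = expect F t 0 0 i" by (simp add: u_def)
    then show ?thesis unfolding expect_renewal[OF F that] unfolding c by (simp add: F_def)
  qed
  have v: "v t y i = ?g t y i + (\<integral>\<^sup>+r. ?k i r * indicator {0..t} r * v (t - r) () (- i) \<partial>lborel)"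
    if t: "0 \<le> t" and i: "i \<in> {-1, 1}" for t y i
  proof -
    let ?b = "of_bool (- i = k) - \<pi> k"
    \<comment> \<open>An explicit antiderivative of the renewal integrand. The denominator
      \<open>?\<Lambda> - q i\<close> is the rate of the other state.\<close>
    define G where "G r = - \<pi> k * exp (- q i * r) + ?b * q i / (?\<Lambda> - q i) * exp (- ?\<Lambda> * t +
        (?\<Lambda> - q i) * r)" for r
    have ne: "?\<Lambda> - q i \<noteq> 0" using lm lp by (simp add: q_def by_index_def)
    have dG: "(G has_real_derivative q i * exp (- q i * r) * trans (t - r) (- i) k) (at r)" for r
    proof -
      have "(G has_real_derivative (\<pi> k * q i * exp (- q i * r) + ?b * q i * exp (- ?\<Lambda> * t +
          (?\<Lambda> - q i) * r))) (at r)"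
        unfolding G_def using ne by (auto intro!: derivative_eq_intros)
      moreover have "exp (- ?\<Lambda> * t + (?\<Lambda> - q i) * r) = exp (- q i * r) * exp (- ?\<Lambda> * (t - r))"
        by (simp add: algebra_simps flip: exp_add)
      ultimately show ?thesis by (simp add: trans_def algebra_simps)
    qed
    have f0: "0 \<le> q i * exp (- q i * r) * trans (t - r) (- i) k" if "r \<in> {0..t}" for r
      using q_pos[of i] that by (intro mult_nonneg_nonneg tr0) auto
    have "(\<integral>\<^sup>+r. ?k i r * indicator {0..t} r * v (t - r) () (- i) \<partial>lborel) =
        (\<integral>\<^sup>+r. ennreal (q i * exp (- q i * r) * trans (t - r) (- i) k) * indicator {0..t} r \<partial>lborel)"
      using q_pos[of i] by (intro nn_integral_cong) (auto simp: v_def indicator_def ennreal_mult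
          tr0)
    also have "\<dots> = ennreal (G t - G 0)"
    proof (rule nn_integral_FTC_Icc)
      show "(\<lambda>r. q i * exp (- q i * r) * trans (t - r) (- i) k) \<in> borel_measurable borel"
        unfolding trans_def by measurable
    qed (use t dG f0 in auto)
    finally have I: "(\<integral>\<^sup>+r. ?k i r * indicator {0..t} r * v (t - r) () (- i) \<partial>lborel) =
        ennreal (G t - G 0)" .
    have e: "exp (- ?\<Lambda> * t + (?\<Lambda> - q i) * t) = exp (- q i * t)" by (simp add: algebra_simps)
    have b: "?b * q i / (?\<Lambda> - q i) = \<pi> k - of_bool (i = k)"
    proof -
      \<comment> \<open>The flows between the two states balance under \<open>\<pi>\<close>; this
        makes the boundary values of \<open>G\<close> add up to the transition function.\<close>
      have bal: "(1 - \<pi> 1) * lm = \<pi> 1 * lp" and eq: "\<pi> (-1) = 1 - \<pi> 1"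
        using lm lp \<pi>_sum by (simp_all add: \<pi>_def by_index_def diff_divide_eq_iff)
      then show ?thesis using i k lm lp by (auto simp: eq q_def by_index_def divide_simps) (simp_all
          add: algebra_simps)?
    qed
    have "trans t i k = exp (- q i * t) * of_bool (i = k) + (G t - G 0)"
      unfolding G_def e b trans_def by (simp add: algebra_simps)
    moreover have "G 0 \<le> G t"
    proof -
      show ?thesis
        by (rule DERIV_nonneg_imp_nondecreasing[OF t]) (use dG f0 in force)
    qed
    ultimately have "ennreal (trans t i k) = ?g t y i + ennreal (G t - G 0)"
      by (auto simp: indicator_def simp flip: ennreal_plus)
    then show ?thesis unfolding I by (simp only: v_def)
  qed
  have "u t () i \<le> v t () i"
    by (rule renewal_le[where \<phi> = "\<lambda>_ _ _. ()" and g = ?g and u = u and v = v, OF _ v])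
      (use u t i in \<open>auto simp: u_def[abs_def] v_def trans_def intro!: expect_le_1 F1\<close>)
  moreover have "v t () i \<le> u t () i"
    by (rule renewal_le[where \<phi> = "\<lambda>_ _ _. ()" and g = ?g and u = v and v = u, OF _ u])
      (use v t i tr1 in \<open>auto simp: u_def v_def intro!: expect_measurable F\<close>)
  ultimately have "expect F t 0 0 i = ennreal (trans t i k)" by (simp add: u_def v_def)
  moreover have "expect F t 0 0 i = (\<integral>\<^sup>+\<tau>. indicator {\<tau>. index_path i \<tau> t = k} \<tau> \<partial>H i)"
    unfolding expect_def F_def by (intro nn_integral_cong) (auto simp: indicator_def)
  moreover have "{\<tau>. index_path i \<tau> t = k} \<in> sets (H i)"
  proof -
    have "{\<tau> \<in> space seqs. index_path i \<tau> t = k} \<in> sets seqs" by measurable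
    then show ?thesis by (simp add: space_PiM sets_holding_times)
  qed
  ultimately show ?thesis by simp
qed

subsection \<open>The dual semigroup on distribution functions\<close>

abbreviation dist_meas :: "(real \<Rightarrow> int \<Rightarrow> ennreal) \<Rightarrow> bool" where
  "dist_meas F \<equiv> (\<forall>i. (\<lambda>c. F c i) \<in> borel_measurable borel)"

text \<open>
  For a measure \<open>\<mu>\<close> let \<open>F c k\<close> be the mass of the points \<open>(x, k)\<close> with \<open>c * |x|\<^sup>2 \<ge> 1\<close>. Since
  \<open>c * |X t|\<^sup>2 \<ge> 1\<close> means \<open>(c * exp (2 * a) - 2 * j) * |X 0|\<^sup>2 \<ge> 1\<close> for the growth \<open>a\<close>
      and the mass \<open>j\<close>,
  the law at time \<open>t\<close> of the process with initial law \<open>\<mu>\<close> belongs to \<open>dual t F\<close>.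
\<close>

definition dual :: "real \<Rightarrow> (real \<Rightarrow> int \<Rightarrow> ennreal) \<Rightarrow> real \<Rightarrow> int \<Rightarrow> ennreal" where
  "dual t F c k = (\<Sum>i\<in>{-1, 1}. \<integral>\<^sup>+\<tau>. indicator {k} (index_path i \<tau> t) *
     F (c * exp (2 * gr i \<tau> t) - 2 * ms i \<tau> t) i \<partial>H i)"

lemma indicator_index_measurable [measurable (raw)]:
  assumes [measurable]: "f \<in> M \<rightarrow>\<^sub>M seqs" "g \<in> borel_measurable M"
  shows "(\<lambda>x. indicator {k} (index_path i (f x) (g x)) :: ennreal) \<in> borel_measurable M"
  by (rule measurable_compose[OF measurable_index_path'[OF assms]]) simp

lemma dist_meas_compose:
  "dist_meas F \<Longrightarrow> f \<in> borel_measurable M \<Longrightarrow> (\<lambda>x. F (f x) i) \<in> borel_measurable M"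
  by (rule measurable_compose[of f M borel "\<lambda>c. F c i"]) auto

lemma dual_mono: "(\<And>c i. i \<in> {-1, 1} \<Longrightarrow> F c i \<le> G c i) \<Longrightarrow> dual t F c k \<le> dual t G c k"
  unfolding dual_def by (intro sum_mono nn_integral_mono mult_left_mono) auto

lemma dual_cong: "(\<And>c i. i \<in> {-1, 1} \<Longrightarrow> F c i = G c i) \<Longrightarrow> dual t F c k = dual t G c k"
  unfolding dual_def by (intro sum.cong nn_integral_cong) auto

lemma dual_cmult:
  assumes [measurable]: "dist_meas F"
  shows "dual t (\<lambda>c i. \<alpha> * F c i) c k = \<alpha> * dual t F c k"
proof -
  have m: "(\<lambda>\<tau>. indicator {k} (index_path i \<tau> t) * F (c * exp (2 * gr i \<tau> t) - 2 * ms i \<tau> t) i) \<in>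
      borel_measurable (H i)" for i
    by (intro borel_measurable_times_ennreal dist_meas_compose[OF assms]) measurable
  show ?thesis unfolding dual_def sum_distrib_left
    by (intro sum.cong refl) (simp add: mult.left_commute[of _ \<alpha>] nn_integral_cmult[OF m])
qed

lemma dual_add:
  assumes "dist_meas F" "dist_meas G"
  shows "dual t (\<lambda>c i. F c i + G c i) c k = dual t F c k + dual t G c k"
proof -
  have m: "(\<lambda>\<tau>. indicator {k} (index_path i \<tau> t) * F (c * exp (2 * gr i \<tau> t) - 2 * ms i \<tau> t) i) \<in>
      borel_measurable (H i)"
    if "dist_meas F" for i F
    by (intro borel_measurable_times_ennreal dist_meas_compose[OF that]) measurable
  show ?thesis unfolding dual_def sum.distrib[symmetric] distrib_left
    by (intro sum.cong refl nn_integral_add m assms)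
qed

lemma dual_measurable:
  assumes F: "dist_meas F"
  shows "dist_meas (dual t F)"
proof
  fix k
  have "(\<lambda>(c, \<tau>). indicator {k} (index_path i \<tau> t) * F (c * exp (2 * gr i \<tau> t) - 2 * ms i \<tau> t) i)
    \<in> borel_measurable (borel \<Otimes>\<^sub>M H i)" for i
    unfolding case_prod_beta by (intro borel_measurable_times_ennreal dist_meas_compose[OF F])
        measurable
  then show "(\<lambda>c. dual t F c k) \<in> borel_measurable borel"
    unfolding dual_def by (intro borel_measurable_sum H.borel_measurable_nn_integral) auto
qed

lemma index_path_sum:
  assumes "i \<in> {-1, 1}"
  shows "(\<Sum>k\<in>{-1, 1}. indicator {k} (index_path i \<tau> t)) = (1 :: ennreal)"
  using index_path_cases[OF assms, of \<tau> t] by (auto simp: indicator_def)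

lemma nn_integral_indicator_index:
  assumes "0 \<le> t" "i \<in> {-1, 1}" "k \<in> {-1, 1}"
  shows "(\<integral>\<^sup>+\<tau>. indicator {k} (index_path i \<tau> t) \<partial>H i) = ennreal (trans t i k)"
proof -
  have "(\<integral>\<^sup>+\<tau>. indicator {k} (index_path i \<tau> t) \<partial>H i) = (\<integral>\<^sup>+\<tau>. indicator {\<tau>. index_path i \<tau> t =
      k} \<tau> \<partial>H i)"
    by (intro nn_integral_cong) (auto simp: indicator_def)
  also have "{\<tau>. index_path i \<tau> t = k} \<in> sets (H i)"
  proof -
    have "{\<tau> \<in> space seqs. index_path i \<tau> t = k} \<in> sets seqs" by measurable
    then show ?thesis by (simp add: space_PiM sets_holding_times)
  qed
  then have "(\<integral>\<^sup>+\<tau>. indicator {\<tau>. index_path i \<tau> t = k} \<tau> \<partial>H i) = ennreal (trans t i k)"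
    by (simp add: prob_index[OF assms])
  finally show ?thesis .
qed

text \<open>Without dependence on \<open>c\<close> only the index is left, and \<open>dual\<close>
  reduces to the transposed transition matrix. This governs the behaviour of fixed points as
  \<open>c\<close> tends to infinity.\<close>

lemma dual_const:
  assumes "0 \<le> t" "k \<in> {-1, 1}"
  shows "dual t (\<lambda>_ i. m i) c k = (\<Sum>i\<in>{-1, 1}. m i * ennreal (trans t i k))"
  unfolding dual_def using assms
  by (intro sum.cong refl, subst nn_integral_multc) (simp_all add: nn_integral_indicator_index
      mult.commute)

lemma \<pi>_trans:
  assumes "k \<in> {-1, 1}"
  shows "(\<Sum>i\<in>{-1, 1}. \<pi> i * trans t i k) = \<pi> k"
proof -
  have "(\<Sum>i\<in>{-1, 1}. \<pi> i * trans t i k) = (\<pi> (-1) + \<pi> 1) * (\<pi> k - \<pi> k * exp (- (lm + lp) * t)) +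
      \<pi> k * exp (- (lm + lp) * t)"
    using assms by (auto simp: trans_def algebra_simps)
  then show ?thesis by (simp add: \<pi>_sum)
qed

lemma dual_\<pi>:
  assumes "0 \<le> t" "k \<in> {-1, 1}"
  shows "dual t (\<lambda>_ i. ennreal (\<pi> i)) c k = ennreal (\<pi> k)"
proof -
  have "dual t (\<lambda>_ i. ennreal (\<pi> i)) c k = (\<Sum>i\<in>{-1, 1}. ennreal (\<pi> i * trans t i k))"
    unfolding dual_const[OF assms] using \<pi>_pos assms trans_nonneg
    by (intro sum.cong refl) (simp add: ennreal_mult less_imp_le)
  also have "\<dots> = ennreal (\<Sum>i\<in>{-1, 1}. \<pi> i * trans t i k)"
    using \<pi>_pos assms trans_nonneg by (intro sum_ennreal mult_nonneg_nonneg) (auto simp: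
        less_imp_le)
  finally show ?thesis using assms by (simp only: \<pi>_trans)
qed

text \<open>The Chapman-Kolmogorov equation is expanded over the index reached at time
  \<open>t\<close>, and the two integrals are exchanged. The outer operator belongs to the later
  stretch of time, as \<open>F\<close> describes the initial law and \<open>dual t F\<close> the law
  at time \<open>t\<close>.\<close>

lemma dual_semigroup:
  assumes F: "dist_meas F" and F1: "\<And>c i. F c i \<le> 1" and s: "0 \<le> s" and t: "0 \<le> t"
  shows "dual (t + s) F c k = dual s (dual t F) c k"
proof -
  define G where "G i a j l = indicator {k} l * F (c * exp (2 * a) - 2 * j) i" for i a j l
  have G: "obs (G i)" for i
    unfolding G_def case_prod_beta
    by (intro borel_measurable_times_ennreal dist_meas_compose[OF F] measurable_compose[OF _
        borel_measurable_indicator[of "{k}" "count_space UNIV"]]) measurable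
  have G1: "G i a j l \<le> 1" for i a j l
    using F1 by (auto simp: G_def indicator_def)
  \<comment> \<open>\<open>\<tau>'\<close> drives the first stretch, from \<open>i\<close> to
    \<open>l\<close> during \<open>t\<close>, and \<open>\<tau>\<close> the second one, from
    \<open>l\<close> to \<open>k\<close> during \<open>s\<close>.\<close>
  define K where "K l i \<tau> \<tau>' = indicator {k} (index_path l \<tau> s) * (indicator {l} (index_path i \<tau>' t)
      *
     F ((c * exp (2 * gr l \<tau> s) - 2 * ms l \<tau> s) * exp (2 * gr i \<tau>' t) - 2 * ms i \<tau>' t) i)" for l i \<tau>
         \<tau>'
  have K: "(\<lambda>(\<tau>', \<tau>). K l i \<tau> \<tau>') \<in> borel_measurable (H i \<Otimes>\<^sub>M H l)" for l i
    unfolding K_def case_prod_beta by (intro borel_measurable_times_ennreal dist_meas_compose[OF F])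
        measurable
  have "dual (t + s) F c k = (\<Sum>i\<in>{-1, 1}. expect (G i) (t + s) 0 0 i)"
    by (simp add: dual_def expect_def G_def)
  also have "\<dots> = (\<Sum>i\<in>{-1, 1}. expect (expect (G i) s) t 0 0 i)"
    by (intro sum.cong refl chapman_kolmogorov G G1 s t)
  also have "\<dots> = (\<Sum>i\<in>{-1, 1}. \<Sum>l\<in>{-1, 1}. \<integral>\<^sup>+\<tau>'. \<integral>\<^sup>+\<tau>. K l i \<tau> \<tau>' \<partial>H l \<partial>H i)"
  proof (intro sum.cong refl)
    fix i :: int assume i: "i \<in> {-1, 1}"
    have "expect (expect (G i) s) t 0 0 i = (\<integral>\<^sup>+\<tau>'. (\<Sum>l\<in>{-1, 1}. \<integral>\<^sup>+\<tau>. K l i \<tau> \<tau>' \<partial>H l) \<partial>H i)"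
      unfolding expect_def[of _ t]
    proof (intro nn_integral_cong)
      fix \<tau>'
      let ?l = "index_path i \<tau>' t"
      have "(\<Sum>l\<in>{-1, 1}. \<integral>\<^sup>+\<tau>. K l i \<tau> \<tau>' \<partial>H l) = (\<Sum>l\<in>{?l}. \<integral>\<^sup>+\<tau>. K l i \<tau> \<tau>' \<partial>H l)"
        using index_path_cases[OF i, of \<tau>' t] by (intro sum.mono_neutral_right) (auto simp: K_def
            indicator_def)
      also have "\<dots> = expect (G i) s (gr i \<tau>' t) (ms i \<tau>' t) ?l"
        unfolding expect_def G_def K_def by (auto intro!: nn_integral_cong simp: algebra_simps
            exp_add)
      finally show "expect (G i) s (0 + gr i \<tau>' t) (0 + exp (2 * 0) * ms i \<tau>' t) ?l =
          (\<Sum>l\<in>{-1, 1}. \<integral>\<^sup>+\<tau>. K l i \<tau> \<tau>' \<partial>H l)"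
        by simp
    qed
    also have "\<dots> = (\<Sum>l\<in>{-1, 1}. \<integral>\<^sup>+\<tau>'. \<integral>\<^sup>+\<tau>. K l i \<tau> \<tau>' \<partial>H l \<partial>H i)"
      using K by (intro nn_integral_sum H.borel_measurable_nn_integral) auto
    finally show "expect (expect (G i) s) t 0 0 i = (\<Sum>l\<in>{-1, 1}. \<integral>\<^sup>+\<tau>'. \<integral>\<^sup>+\<tau>. K l i \<tau> \<tau>' \<partial>H l \<partial>H i)" .
  qed
  also have "\<dots> = (\<Sum>i\<in>{-1, 1}. \<Sum>l\<in>{-1, 1}. \<integral>\<^sup>+\<tau>. \<integral>\<^sup>+\<tau>'. K l i \<tau> \<tau>' \<partial>H i \<partial>H l)"
  proof (intro sum.cong refl)
    fix i l
    interpret pair_sigma_finite "H i" "H l" ..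
    show "(\<integral>\<^sup>+\<tau>'. \<integral>\<^sup>+\<tau>. K l i \<tau> \<tau>' \<partial>H l \<partial>H i) = (\<integral>\<^sup>+\<tau>. \<integral>\<^sup>+\<tau>'. K l i \<tau> \<tau>' \<partial>H i \<partial>H l)"
      using Fubini'[OF K[of l i]] by simp
  qed
  also have "\<dots> = (\<Sum>l\<in>{-1, 1}. \<Sum>i\<in>{-1, 1}. \<integral>\<^sup>+\<tau>. \<integral>\<^sup>+\<tau>'. K l i \<tau> \<tau>' \<partial>H i \<partial>H l)"
    by (rule sum.swap)
  also have "\<dots> = (\<Sum>l\<in>{-1, 1}. \<integral>\<^sup>+\<tau>. (\<Sum>i\<in>{-1, 1}. \<integral>\<^sup>+\<tau>'. K l i \<tau> \<tau>' \<partial>H i) \<partial>H l)"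
  proof (intro sum.cong refl nn_integral_sum[symmetric] H.borel_measurable_nn_integral)
    show "(\<lambda>(\<tau>, \<tau>'). K l i \<tau> \<tau>') \<in> borel_measurable (H l \<Otimes>\<^sub>M H i)" for l i
      using measurable_pair_swap'[THEN measurable_compose, OF K[of l i]]
          by (simp add: case_prod_beta)
  qed
  also have "\<dots> = dual s (dual t F) c k"
    unfolding dual_def[of s]
  proof (intro sum.cong refl nn_integral_cong)
    fix l \<tau>
    have "(\<integral>\<^sup>+\<tau>'. K l i \<tau> \<tau>' \<partial>H i) = indicator {k} (index_path l \<tau> s) * (\<integral>\<^sup>+\<tau>'. (indicator {l}
        (index_path i \<tau>' t) *
     F ((c * exp (2 * gr l \<tau> s) - 2 * ms l \<tau> s) * exp (2 * gr i \<tau>' t) - 2 * ms i \<tau>' t) i) \<partial>H i)" for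
         i
      unfolding K_def
      by (intro nn_integral_cmult borel_measurable_times_ennreal dist_meas_compose[OF F]) measurable
    then show "(\<Sum>i\<in>{-1, 1}. \<integral>\<^sup>+\<tau>'. K l i \<tau> \<tau>' \<partial>H i) =
      indicator {k} (index_path l \<tau> s) * dual t F (c * exp (2 * gr l \<tau> s) - 2 * ms l \<tau> s) l"
      unfolding dual_def by (simp only: sum_distrib_left)
  qed
  finally show ?thesis .
qed

text \<open>Dominated convergence, with function and point both allowed to vary. It serves three
  purposes: decreasing functions at a fixed point, a fixed function at points that decrease to
  \<open>c\<close>, and a fixed function as \<open>c\<close> tends to infinity.\<close>

lemma dual_tendsto:
  assumes m: "\<And>n. dist_meas (F n)" and G: "dist_meas G" and F1: "\<And>n c i. F n c i \<le> 1"
    and lim: "\<And>a i x. i \<in> {-1, 1} \<Longrightarrow> 0 < a \<Longrightarrow> (\<lambda>n. F n (c n * a - x) i) \<longlonglongrightarrow> G (d * a - x) i"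
  shows "(\<lambda>n. dual t (F n) (c n) k) \<longlonglongrightarrow> dual t G d k"
  unfolding dual_def
proof (intro tendsto_sum nn_integral_dominated_convergence[where w = "\<lambda>_. 1"])
  fix i :: int assume i: "i \<in> {-1, 1}"
  show "(\<lambda>\<tau>. indicator {k} (index_path i \<tau> t) * F n (c n * exp (2 * gr i \<tau> t) - 2 * ms i \<tau> t) i) \<in>
      borel_measurable (H i)" for n
    by (intro borel_measurable_times_ennreal dist_meas_compose[OF m]) measurable
  show "(\<lambda>\<tau>. indicator {k} (index_path i \<tau> t) * G (d * exp (2 * gr i \<tau> t) - 2 * ms i \<tau> t) i) \<in>
      borel_measurable (H i)"
    by (intro borel_measurable_times_ennreal dist_meas_compose[OF G]) measurable
  show "AE \<tau> in H i. indicator {k} (index_path i \<tau> t) * F n (c n * exp (2 * gr i \<tau> t) - 2 * ms i \<tau>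
      t) i \<le> 1" for n
    using F1 by (auto simp: indicator_def)
  show "AE \<tau> in H i. (\<lambda>n. indicator {k} (index_path i \<tau> t) * F n (c n * exp (2 * gr i \<tau> t) - 2 * ms
      i \<tau> t) i)
      \<longlonglongrightarrow> indicator {k} (index_path i \<tau> t) * G (d * exp (2 * gr i \<tau> t) - 2 * ms i \<tau> t) i"
    using lim[OF i] by (intro AE_I2) (auto simp: indicator_def)
qed auto

section \<open>The largest fixed point\<close>

definition F0 :: "real \<Rightarrow> int \<Rightarrow> ennreal" where
  "F0 c k = ennreal (\<pi> k) * indicator {0..} c"

definition Flim :: "real \<Rightarrow> int \<Rightarrow> ennreal" where
  "Flim c k = (INF n. dual (real n) F0 c k)"

lemma \<pi>_le_1: "\<pi> k \<le> 1"
  using lm lp by (simp add: \<pi>_def by_index_def)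

lemma F0_measurable: "dist_meas F0"
  unfolding F0_def by measurable

lemma F0_le_1: "F0 c k \<le> 1"
  using \<pi>_le_1[of k] by (simp add: F0_def indicator_def)

lemma ms_nonneg: "0 \<le> t \<Longrightarrow> 0 \<le> ms i \<tau> t"
  by (simp add: mass_nonneg)

text \<open>\<open>F0\<close> describes a start at infinite radius: \<open>1 / |x|^2\<close> has an
  atom at 0 and the index has law \<open>\<pi>\<close>. For negative \<open>c\<close> the argument
  stays negative; otherwise the constant \<open>\<pi> k\<close> is an upper bound, and it is
  preserved by stationarity.\<close>

lemma dual_F0_le:
  assumes t: "0 \<le> t" and k: "k \<in> {-1, 1}"
  shows "dual t F0 c k \<le> F0 c k"
proof (cases "c < 0")
  case True
  have "c * exp (2 * gr i \<tau> t) - 2 * ms i \<tau> t < 0" for i \<tau>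
    using ms_nonneg[OF t, of i \<tau>] mult_neg_pos[OF True, of "exp (2 * gr i \<tau> t)"] by simp
  then have "F0 (c * exp (2 * gr i \<tau> t) - 2 * ms i \<tau> t) i = 0" for i \<tau>
    by (simp add: F0_def not_le)
  then show ?thesis by (simp add: dual_def)
next
  case False
  have "dual t F0 c k \<le> dual t (\<lambda>_ i. ennreal (\<pi> i)) c k"
    by (intro dual_mono) (auto simp: F0_def indicator_def)
  also have "\<dots> = ennreal (\<pi> k)" by (rule dual_\<pi>[OF t k])
  finally show ?thesis using False by (simp add: F0_def)
qed

lemma dual_F0_antimono:
  assumes "0 \<le> s" "s \<le> t" "k \<in> {-1, 1}"
  shows "dual t F0 c k \<le> dual s F0 c k"
proof -
  have "dual t F0 c k = dual s (dual (t - s) F0) c k"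
    using dual_semigroup[OF F0_measurable F0_le_1, of s "t - s"] assms by simp
  also have "\<dots> \<le> dual s F0 c k"
    using assms by (intro dual_mono dual_F0_le) auto
  finally show ?thesis .
qed

lemma dual_F0_le_1:
  assumes "0 \<le> t" shows "dual t F0 c k \<le> 1"
proof (cases "k \<in> {-1, 1}")
  case True
  show ?thesis by (rule order_trans[OF dual_F0_le[OF assms True] F0_le_1])
next
  case False
  then have "indicator {k} (index_path i \<tau> t) = (0 :: ennreal)" if "i \<in> {-1, 1}" for i \<tau>
    using index_path_cases[OF that, of \<tau> t] by (auto simp: indicator_def)
  then show ?thesis by (simp add: dual_def)
qed

lemma Flim_tendsto:
  assumes "k \<in> {-1, 1}"
  shows "(\<lambda>n. dual (real n) F0 c k) \<longlonglongrightarrow> Flim c k"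
  unfolding Flim_def using assms
  by (intro LIMSEQ_INF decseq_SucI dual_F0_antimono) auto

lemma Flim_lower: "Flim c k \<le> dual (real n) F0 c k"
  unfolding Flim_def by (rule INF_lower) simp

lemma Flim_measurable: "dist_meas Flim"
  unfolding Flim_def using dual_measurable[OF F0_measurable]
      by (intro allI borel_measurable_INF) auto

lemma Flim_le_F0: "k \<in> {-1, 1} \<Longrightarrow> Flim c k \<le> F0 c k"
  using Flim_lower[of c k 0] dual_F0_le[of 0 k c] by simp

lemma Flim_le_1: "Flim c k \<le> 1"
  using Flim_lower[of c k 0] dual_F0_le_1[of 0 c k] by simp

lemma dual_Flim:
  assumes s: "0 \<le> s" and k: "k \<in> {-1, 1}"
  shows "dual s Flim c k = Flim c k"
proof (rule LIMSEQ_unique)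
  show "(\<lambda>n. dual s (dual (real n) F0) c k) \<longlonglongrightarrow> dual s Flim c k"
    by (intro dual_tendsto dual_measurable F0_measurable Flim_measurable dual_F0_le_1 Flim_tendsto)
        auto
  have eq: "dual s (dual (real n) F0) c k = dual (real n + s) F0 c k" for n
    using dual_semigroup[OF F0_measurable F0_le_1, of s "real n"] s by simp
  \<comment> \<open>The infimum that defines \<open>Flim\<close> runs over integer times only. As
    the values decrease in time, those at \<open>real n + s\<close> are squeezed between
    \<open>Flim\<close> and those at \<open>n\<close>.\<close>
  show "(\<lambda>n. dual s (dual (real n) F0) c k) \<longlonglongrightarrow> Flim c k"
    unfolding eq
  proof (rule tendsto_sandwich[OF _ _ _ Flim_tendsto[OF k]])
    show "\<forall>\<^sub>F n in sequentially. dual (real n + s) F0 c k \<le> dual (real n) F0 c k"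
      using s k by (intro always_eventually allI dual_F0_antimono) auto
    show "\<forall>\<^sub>F n in sequentially. Flim c k \<le> dual (real n + s) F0 c k"
    proof (intro always_eventually allI)
      fix n
      have "dual (real (n + nat \<lceil>s\<rceil>)) F0 c k \<le> dual (real n + s) F0 c k"
        using s k by (intro dual_F0_antimono) (auto simp: real_nat_ceiling_ge)
      then show "Flim c k \<le> dual (real n + s) F0 c k"
        using Flim_lower order_trans by blast
    qed
  qed simp
qed

lemma F0_mono: "c \<le> d \<Longrightarrow> F0 c k \<le> F0 d k"
  by (auto simp: F0_def indicator_def)

lemma dual_mono_arg:
  assumes "\<And>c d i. i \<in> {-1, 1} \<Longrightarrow> c \<le> d \<Longrightarrow> F c i \<le> F d i" "c \<le> d"
  shows "dual t F c k \<le> dual t F d k"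
  unfolding dual_def using assms by (intro sum_mono nn_integral_mono mult_left_mono) auto

lemma Flim_mono: "c \<le> d \<Longrightarrow> Flim c k \<le> Flim d k"
  unfolding Flim_def by (intro INF_mono) (auto intro!: bexI dual_mono_arg F0_mono)

lemma F0_right_continuous: "0 < a \<Longrightarrow> (\<lambda>m. F0 ((c + 1 / real (Suc m)) * a - x) i) \<longlonglongrightarrow> F0 (c * a - x) i"
proof (cases "0 \<le> c * a - x")
  case True
  assume a: "0 < a"
  have "0 \<le> (c + 1 / real (Suc m)) * a - x" for m
    using True a by (simp add: distrib_right add_increasing2 algebra_simps)
  then show ?thesis using True by (simp add: F0_def)
next
  case False
  assume a: "0 < a"
  have "(\<lambda>m. (c + 1 / real (Suc m)) * a - x) \<longlonglongrightarrow> (c + 0) * a - x"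
    by (intro tendsto_intros LIMSEQ_inverse_real_of_nat[unfolded inverse_eq_divide])
  then have "\<forall>\<^sub>F m in sequentially. (c + 1 / real (Suc m)) * a - x < 0"
    using False by (intro order_tendstoD) auto
  then have "\<forall>\<^sub>F m in sequentially. F0 ((c + 1 / real (Suc m)) * a - x) i = F0 (c * a - x) i"
    by eventually_elim (use False in \<open>simp add: F0_def not_le\<close>)
  then show ?thesis by (rule tendsto_eventually)
qed

text \<open>Each \<open>dual (real n) F0\<close> is monotone and right-continuous, so its value at
  \<open>c\<close> is the infimum over the points \<open>c + 1 / real (Suc m)\<close>, and infima
  commute.\<close>

lemma Flim_right_continuous: "(\<lambda>m. Flim (c + 1 / real (Suc m)) k) \<longlonglongrightarrow> Flim c k"
proof -
  have dec: "decseq (\<lambda>m. c + 1 / real (Suc m))"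
    by (intro decseq_SucI) (auto simp: field_simps)
  have 1: "(INF m. dual (real n) F0 (c + 1 / real (Suc m)) k) = dual (real n) F0 c k" for n
  proof (rule LIMSEQ_unique)
    show "(\<lambda>m. dual (real n) F0 (c + 1 / real (Suc m)) k) \<longlonglongrightarrow> (INF m. dual (real n) F0 (c +
        1 / real (Suc m)) k)"
      using dec by (intro LIMSEQ_INF) (auto simp: decseq_def intro!: dual_mono_arg F0_mono)
    show "(\<lambda>m. dual (real n) F0 (c + 1 / real (Suc m)) k) \<longlonglongrightarrow> dual (real n) F0 c k"
      by (intro dual_tendsto F0_measurable F0_le_1 F0_right_continuous)
  qed
  have "(\<lambda>m. Flim (c + 1 / real (Suc m)) k) \<longlonglongrightarrow> (INF m. Flim (c + 1 / real (Suc m)) k)"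
    using dec by (intro LIMSEQ_INF) (auto simp: decseq_def intro!: Flim_mono)
  also have "(INF m. Flim (c + 1 / real (Suc m)) k) = (INF n. INF m. dual (real n) F0 (c +
      1 / real (Suc m)) k)"
    unfolding Flim_def by (rule INF_commute)
  also have "\<dots> = Flim c k" unfolding 1 Flim_def ..
  finally show ?thesis .
qed

text \<open>The monotone operator at multiples of \<open>T\<close> leaves \<open>F\<close> in place
  while it pushes the bound \<open>\<alpha> * F0\<close> down to \<open>\<alpha> * Flim\<close>. A
  single time \<open>T\<close> is assumed because in the plane the parts over sets of directions are
  fixed at full turns only.\<close>

lemma fixed_le_Flim:
  assumes T: "0 < T" and F: "dist_meas F" and \<alpha>: "\<alpha> < \<top>"
    and le: "\<And>c k. k \<in> {-1, 1} \<Longrightarrow> F c k \<le> \<alpha> * F0 c k" and F1: "\<And>c k. F c k \<le> 1"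
    and fixed: "\<And>c k. k \<in> {-1, 1} \<Longrightarrow> dual T F c k = F c k" and k: "k \<in> {-1, 1}"
  shows "F c k \<le> \<alpha> * Flim c k"
proof (rule LIMSEQ_le_const)
  show "(\<lambda>n. \<alpha> * dual (real n) F0 c k) \<longlonglongrightarrow> \<alpha> * Flim c k"
    using \<alpha> by (intro ennreal_tendsto_cmult Flim_tendsto k)
  have it: "dual (real (Suc m) * T) F c k = F c k" if "k \<in> {-1, 1}" for m c k
    using that
  proof (induction m arbitrary: c k)
    case 0 then show ?case by (simp add: fixed)
  next
    case (Suc m)
    have "dual (real (Suc (Suc m)) * T) F c k = dual (real (Suc m) * T + T) F c k"
      by (simp add: algebra_simps)
    also have "\<dots> = dual T (dual (real (Suc m) * T) F) c k"
      using T by (intro dual_semigroup F F1) auto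
    also have "\<dots> = dual T F c k" by (rule dual_cong) (rule Suc.IH)
    finally show ?case using fixed[OF Suc.prems] by simp
  qed
  have "F c k \<le> \<alpha> * dual (real n) F0 c k" for n
  proof -
    obtain m where m: "real n < real m * T" using reals_Archimedean3[OF T] by blast
    then have m0: "m \<noteq> 0" by (metis mult_zero_left not_less of_nat_0 of_nat_0_le_iff)
    then obtain m' where m': "m = Suc m'" by (cases m) auto
    have "F c k = dual (real m * T) F c k" using it[OF k, of m' c] m' by simp
    also have "\<dots> \<le> dual (real m * T) (\<lambda>c k. \<alpha> * F0 c k) c k" by (intro dual_mono le)
    also have "\<dots> = \<alpha> * dual (real m * T) F0 c k" by (rule dual_cmult[OF F0_measurable])
    also have "\<dots> \<le> \<alpha> * dual (real n) F0 c k"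
      using m k by (intro mult_left_mono dual_F0_antimono) auto
    finally show ?thesis .
  qed
  then show "\<exists>N. \<forall>n\<ge>N. F c k \<le> \<alpha> * dual (real n) F0 c k" by blast
qed

end

subsection \<open>Fixed points of the dual semigroup\<close>

lemma integrable_on_div_shift:
  fixes f :: "real \<Rightarrow> real"
  assumes [measurable]: "f \<in> borel_measurable borel" and f: "\<And>y. \<bar>f y\<bar> \<le> 1" and "0 < s" "0 \<le> x"
  shows "(\<lambda>y. f y / (y + x)) integrable_on {s..t}"
proof (rule integrable_on_bounded_borel[where B = "1 / s"])
  fix y assume "y \<in> {s..t}"
  then have "\<bar>f y\<bar> / (y + x) \<le> 1 / s" using assms f[of y] by (intro frac_le) auto
  then show "norm (f y / (y + x)) \<le> 1 / s" using \<open>y \<in> _\<close> assms by simp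
qed measurable

lemma integral_div_shift:
  fixes s t x :: real
  assumes "0 < s" "s \<le> t" "0 \<le> x"
  shows "((\<lambda>y. 1 / (y + x)) has_integral (ln (t + x) - ln (s + x))) {s..t}"
  using assms
  by (intro fundamental_theorem_of_calculus[where f = "\<lambda>y. ln (y + x)"])
    (auto intro!: derivative_eq_intros simp:
        has_real_derivative_iff_has_vector_derivative[symmetric])

text \<open>Beyond \<open>M\<close> the integrand differs from \<open>m / (y + x)\<close> by at most
  \<open>\<epsilon> / (y + x)\<close>, and both integrate to multiples of a difference of
  logarithms.\<close>

lemma log_integral_close_le:
  fixes f :: "real \<Rightarrow> real"
  assumes f: "f \<in> borel_measurable borel" "\<And>y. \<bar>f y\<bar> \<le> 1" and w: "0 < w" "0 \<le> x"
    and MN: "w \<le> M" "M \<le> N" and close: "\<And>y. M \<le> y \<Longrightarrow> \<bar>f y - m\<bar> \<le> \<epsilon>"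
  shows "\<bar>integral {w..N} (\<lambda>y. f y / (y + x)) - integral {w..M} (\<lambda>y. f y / (y + x)) -
    m * (ln (N + x) - ln (M + x))\<bar> \<le> \<epsilon> * (ln (N + x) - ln (M + x))"
proof -
  let ?g = "\<lambda>y. f y / (y + x)" and ?L = "ln (N + x) - ln (M + x)"
  have I: "?g integrable_on {s..t}" if "0 < s" for s t
    using integrable_on_div_shift[OF f that w(2)] .
  have one: "((\<lambda>y. 1 / (y + x)) has_integral ?L) {M..N}"
    using assms by (intro integral_div_shift) auto
  have diff: "integral {w..N} ?g - integral {w..M} ?g = integral {M..N} ?g"
    using Henstock_Kurzweil_Integration.integral_combine[where a = w and c = M and b = N
        and f = ?g] I[OF w(1)] MN by auto
  have "(?g has_integral integral {M..N} ?g) {M..N}"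
    using I[of M N] w MN by (simp add: integrable_integral)
  from has_integral_diff[OF this has_integral_mult_right[OF one, of m]]
  have d: "((\<lambda>y. f y / (y + x) - m * (1 / (y + x))) has_integral (integral {M..N} ?g - m * ?L))
      {M..N}" .
  have "norm (integral {M..N} (\<lambda>y. f y / (y + x) - m * (1 / (y + x)))) \<le>
      integral {M..N} (\<lambda>y. \<epsilon> * (1 / (y + x)))"
  proof (rule integral_norm_bound_integral)
    show "(\<lambda>y. f y / (y + x) - m * (1 / (y + x))) integrable_on {M..N}" using d by auto
    show "(\<lambda>y. \<epsilon> * (1 / (y + x))) integrable_on {M..N}" using has_integral_mult_right[OF one, of \<epsilon>]
        by auto
    fix y assume y: "y \<in> {M..N}"
    have "\<bar>f y - m\<bar> / (y + x) \<le> \<epsilon> / (y + x)" using close[of y] y w MN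
        by (intro divide_right_mono) auto
    then show "norm (f y / (y + x) - m * (1 / (y + x))) \<le> \<epsilon> * (1 / (y + x))"
      using y w MN by (simp flip: diff_divide_distrib)
  qed
  moreover have "integral {M..N} (\<lambda>y. \<epsilon> * (1 / (y + x))) = \<epsilon> * ?L"
    using has_integral_mult_right[OF one, of \<epsilon>] by (rule integral_unique)
  ultimately have "\<bar>integral {M..N} ?g - m * ?L\<bar> \<le> \<epsilon> * ?L"
    unfolding integral_unique[OF d] by (simp only: real_norm_def)
  then show ?thesis unfolding diff by simp
qed

text \<open>Growth may be negative, so the moved endpoint \<open>N\<close> may lie on either side of
  \<open>M\<close>.\<close>

lemma log_integral_close:
  fixes f :: "real \<Rightarrow> real"
  assumes f: "f \<in> borel_measurable borel" "\<And>y. \<bar>f y\<bar> \<le> 1" and w: "0 < w" "0 \<le> x"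
    and MN: "w \<le> M" "w \<le> N" and close: "\<And>y. min M N \<le> y \<Longrightarrow> \<bar>f y - m\<bar> \<le> \<epsilon>"
  shows "integral {w..N} (\<lambda>y. f y / (y + x)) \<le> integral {w..M} (\<lambda>y. f y / (y + x)) +
    m * (ln (N + x) - ln (M + x)) + \<epsilon> * \<bar>ln (N + x) - ln (M + x)\<bar>"
proof (cases "M \<le> N")
  case True
  then have "ln (M + x) \<le> ln (N + x)" using w MN by simp
  then show ?thesis
    using log_integral_close_le[OF f w MN(1) True, of m \<epsilon>] close True by (simp add: min_def)
next
  case False
  then have "ln (N + x) \<le> ln (M + x)" using w MN by simp
  moreover have "\<bar>integral {w..M} (\<lambda>y. f y / (y + x)) - integral {w..N} (\<lambda>y. f y / (y + x)) -
    m * (ln (M + x) - ln (N + x))\<bar> \<le> \<epsilon> * (ln (M + x) - ln (N + x))"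
    using log_integral_close_le[OF f w MN(2), of M m \<epsilon>] close False by (simp add: min_def)
  ultimately show ?thesis by (simp add: algebra_simps abs_le_iff)
qed

context switching begin

lemma gr_integrable: "0 \<le> t \<Longrightarrow> integrable (H i) (\<lambda>\<tau>. gr i \<tau> t)"
  by (rule H.integrable_const_bound[where B = "C * t"]) (auto simp: growth_bound)

context
  fixes T :: real
  assumes T: "0 < T"
begin

definition mass_lower :: real where "mass_lower = T * exp (- 2 * C * T)"
definition mass_upper :: real where "mass_upper = T * exp (2 * C * T)"
text \<open>The cubic damping brings every starting point, even infinity, into
  \<open>|x|^2 < 1 / support_lower\<close> within time \<open>T\<close>. A fixed point therefore
  vanishes up to this value, which keeps the integrals of \<open>dc / c\<close> away from 0.\<close>

definition support_lower :: real where "support_lower = 2 * mass_lower * exp (- 2 * C * T)"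

lemma mass_lower_pos: "0 < mass_lower" and support_lower_pos: "0 < support_lower"
  using T by (auto simp: mass_lower_def support_lower_def)

lemma ms_bounds: "mass_lower \<le> ms i \<tau> T" "ms i \<tau> T \<le> mass_upper"
  using mass_bounds[of "index_path i \<tau>" T] T by (auto simp: mass_lower_def mass_upper_def)

lemma gr_bounds: "\<bar>gr i \<tau> T\<bar> \<le> C * T"
  using growth_bound[of "index_path i \<tau>" T] T by auto

lemma exp_gr_bounds: "exp (- 2 * C * T) \<le> exp (2 * gr i \<tau> T)" "exp (2 * gr i \<tau> T) \<le> exp (2 * C * T)"
  using gr_bounds[of i \<tau>] by (auto simp: abs_le_iff algebra_simps)

lemma dual_support:
  assumes F: "\<And>c i. c \<le> 0 \<Longrightarrow> F c i = 0" and c: "c \<le> support_lower"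
  shows "dual T F c k = 0"
proof -
  have "c * exp (2 * gr i \<tau> T) - 2 * ms i \<tau> T \<le> 0" for i \<tau>
  proof -
    have "c * exp (2 * gr i \<tau> T) \<le> support_lower * exp (2 * C * T)"
      using c exp_gr_bounds(2)[of i \<tau>] support_lower_pos by (intro mult_mono) auto
    also have "\<dots> = 2 * mass_lower" by (simp add: support_lower_def flip: exp_add)
    finally show ?thesis using ms_bounds(1)[of i \<tau>] by simp
  qed
  then show ?thesis by (simp add: dual_def F)
qed

text \<open>The substitution \<open>y = c * exp (2 * a) - 2 * j\<close> turns \<open>dc / c\<close>
  into \<open>dy / (y + 2 * j)\<close> and the bound \<open>c \<le> M\<close> into
  \<open>y \<le> M * exp (2 * a) - 2 * j\<close>. Summing over \<open>k\<close> removes the final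
  index.\<close>

lemma dual_log_identity:
  assumes F: "dist_meas F" and zero: "\<And>c i. c \<le> support_lower \<Longrightarrow> F c i = 0" and M: "0 < M"
  shows "(\<Sum>k\<in>{-1, 1}. \<integral>\<^sup>+c. ennreal (1 / c) * indicator {0<..M} c * dual T F c k \<partial>lborel) =
    (\<Sum>i\<in>{-1, 1}. \<integral>\<^sup>+\<tau>. \<integral>\<^sup>+y. ennreal (1 / (y + 2 * ms i \<tau> T)) *
      indicator {support_lower..M * exp (2 * gr i \<tau> T) - 2 * ms i \<tau> T} y * F y i \<partial>lborel \<partial>H i)"
proof -
  let ?W = "\<lambda>c. ennreal (1 / c) * indicator {0<..M} c"
  let ?F = "\<lambda>i \<tau> c. F (c * exp (2 * gr i \<tau> T) - 2 * ms i \<tau> T) i"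
  have m1: "(\<lambda>(c, \<tau>). ?W c * (indicator {k} (index_path i \<tau> T) * ?F i \<tau> c)) \<in>
      borel_measurable (lborel \<Otimes>\<^sub>M H i)" for i k
    unfolding case_prod_beta by (intro borel_measurable_times_ennreal dist_meas_compose[OF F])
        measurable
  have m2: "(\<lambda>\<tau>. ?W c * (indicator {k} (index_path i \<tau> T) * ?F i \<tau> c)) \<in> borel_measurable (H i)"
      for i k c
    by (intro borel_measurable_times_ennreal dist_meas_compose[OF F]) measurable
  have m2': "(\<lambda>\<tau>. indicator {k} (index_path i \<tau> T) * ?F i \<tau> c) \<in> borel_measurable (H i)" for i k c
    by (intro borel_measurable_times_ennreal dist_meas_compose[OF F]) measurable
  have m3: "(\<lambda>c. ?W c * (indicator {k} (index_path i \<tau> T) * ?F i \<tau> c)) \<in> borel_measurable lborel"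
      for i k \<tau>
    by (intro borel_measurable_times_ennreal dist_meas_compose[OF F]) measurable
  have m4: "(\<lambda>(\<tau>, c). ?W c * (indicator {k} (index_path i \<tau> T) * ?F i \<tau> c)) \<in>
      borel_measurable (H i \<Otimes>\<^sub>M lborel)" for i k
    unfolding case_prod_beta by (intro borel_measurable_times_ennreal dist_meas_compose[OF F])
        measurable
  have "(\<Sum>k\<in>{-1, 1}. \<integral>\<^sup>+c. ?W c * dual T F c k \<partial>lborel) =
     (\<Sum>k\<in>{-1, 1}. \<integral>\<^sup>+c. (\<Sum>i\<in>{-1, 1}. \<integral>\<^sup>+\<tau>. ?W c * (indicator {k} (index_path i \<tau> T) * ?F i \<tau> c) \<partial>H i)
         \<partial>lborel)"
    unfolding dual_def sum_distrib_left
    by (intro sum.cong refl nn_integral_cong nn_integral_cmult[symmetric] m2')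
  also have "\<dots> = (\<Sum>k\<in>{-1, 1}. \<Sum>i\<in>{-1, 1}. \<integral>\<^sup>+c. \<integral>\<^sup>+\<tau>. ?W c * (indicator {k} (index_path i \<tau> T) * ?F i
      \<tau> c) \<partial>H i \<partial>lborel)"
    by (intro sum.cong refl nn_integral_sum H.borel_measurable_nn_integral m1)
  also have "\<dots> = (\<Sum>k\<in>{-1, 1}. \<Sum>i\<in>{-1, 1}. \<integral>\<^sup>+\<tau>. \<integral>\<^sup>+c. ?W c * (indicator {k} (index_path i \<tau> T) * ?F i
      \<tau> c) \<partial>lborel \<partial>H i)"
  proof (intro sum.cong refl)
    fix i k
    interpret pair_sigma_finite lborel "H i" ..
    show "(\<integral>\<^sup>+c. \<integral>\<^sup>+\<tau>. ?W c * (indicator {k} (index_path i \<tau> T) * ?F i \<tau> c) \<partial>H i \<partial>lborel) =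
        (\<integral>\<^sup>+\<tau>. \<integral>\<^sup>+c. ?W c * (indicator {k} (index_path i \<tau> T) * ?F i \<tau> c) \<partial>lborel \<partial>H i)"
      using Fubini'[OF m1[of k i]] by simp
  qed
  also have "\<dots> = (\<Sum>i\<in>{-1, 1}. \<Sum>k\<in>{-1, 1}. \<integral>\<^sup>+\<tau>. \<integral>\<^sup>+c. ?W c * (indicator {k} (index_path i \<tau> T) * ?F i
      \<tau> c) \<partial>lborel \<partial>H i)"
    by (rule sum.swap)
  also have "\<dots> = (\<Sum>i\<in>{-1, 1}. \<integral>\<^sup>+\<tau>. \<integral>\<^sup>+c. (\<Sum>k\<in>{-1, 1}. ?W c * (indicator {k} (index_path i \<tau> T) * ?F i
      \<tau> c)) \<partial>lborel \<partial>H i)"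
    by (intro sum.cong refl, subst nn_integral_sum, rule m3, subst nn_integral_sum)
      (auto intro!: lborel.borel_measurable_nn_integral m4)
  also have "\<dots> = (\<Sum>i\<in>{-1, 1}. \<integral>\<^sup>+\<tau>. \<integral>\<^sup>+y. ennreal (1 / (y + 2 * ms i \<tau> T)) *
      indicator {support_lower..M * exp (2 * gr i \<tau> T) - 2 * ms i \<tau> T} y * F y i \<partial>lborel \<partial>H i)"
  proof (rule sum.cong[OF refl], rule nn_integral_cong)
    fix i :: int and \<tau> assume i: "i \<in> {-1, 1}"
    let ?a = "exp (2 * gr i \<tau> T)" and ?x = "2 * ms i \<tau> T"
    have x: "0 < ?x" using ms_bounds(1)[of i \<tau>] mass_lower_pos by simp
    have "(\<Sum>k\<in>{-1, 1}. ?W c * (indicator {k} (index_path i \<tau> T) * ?F i \<tau> c)) =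
        ?W c * F (c * ?a - ?x) i" for c
      using index_path_sum[OF i, of \<tau> T] by (simp only: sum_distrib_left[symmetric]
          sum_distrib_right[symmetric]) simp
    then have "(\<integral>\<^sup>+c. (\<Sum>k\<in>{-1, 1}. ?W c * (indicator {k} (index_path i \<tau> T) * ?F i \<tau> c)) \<partial>lborel) =
        (\<integral>\<^sup>+c. ?W c * F (c * ?a - ?x) i \<partial>lborel)" by simp
    also have "\<dots> = ennreal \<bar>1 / ?a\<bar> * (\<integral>\<^sup>+y. ?W (?x / ?a + 1 / ?a * y) * F ((?x / ?a +
        1 / ?a * y) * ?a - ?x) i \<partial>lborel)"
      by (rule nn_integral_real_affine) (auto intro!: borel_measurable_times_ennreal
          dist_meas_compose[OF F])
    also have "\<dots> = (\<integral>\<^sup>+y. ennreal \<bar>1 / ?a\<bar> * (?W (?x / ?a + 1 / ?a * y) * F ((?x / ?a +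
        1 / ?a * y) * ?a - ?x) i) \<partial>lborel)"
      by (intro nn_integral_cmult[symmetric] borel_measurable_times_ennreal dist_meas_compose[OF F])
          measurable
    also have "\<dots> = (\<integral>\<^sup>+y. ennreal (1 / (y + ?x)) * indicator {support_lower..M * ?a - ?x} y * F y i
        \<partial>lborel)"
    proof (intro nn_integral_cong)
      fix y
      have Fy: "(?x / ?a + 1 / ?a * y) * ?a - ?x = y" by (simp add: field_simps)
      show "ennreal \<bar>1 / ?a\<bar> * (?W (?x / ?a + 1 / ?a * y) * F ((?x / ?a +
          1 / ?a * y) * ?a - ?x) i) =
          ennreal (1 / (y + ?x)) * indicator {support_lower..M * ?a - ?x} y * F y i"
      \<comment> \<open>\<open>F\<close> vanishes up to \<open>support_lower\<close>, which permits
        the closed interval with this lower end on the right-hand side.\<close>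
      proof (cases "y \<le> support_lower")
        case True
        then show ?thesis unfolding Fy by (simp add: zero)
      next
        case False
        then have y: "support_lower < y" "0 < y" using support_lower_pos by auto
        have c: "?x / ?a + 1 / ?a * y = (y + ?x) / ?a" by (simp add: add_divide_distrib)
        have "ennreal \<bar>1 / ?a\<bar> * ennreal (1 / ((y + ?x) / ?a)) = ennreal (1 / (y + ?x))"
          using x y by (simp add: divide_simps flip: ennreal_mult)
        moreover have "indicator {0<..M} ((y + ?x) / ?a) = (indicator {support_lower..M * ?a - ?x} y
            :: ennreal)"
          using x y by (auto simp: indicator_def field_simps)
        ultimately show ?thesis unfolding Fy c by (simp add: mult.assoc[symmetric])
      qed
    qed
    finally show "(\<integral>\<^sup>+c. (\<Sum>k\<in>{-1, 1}. ?W c * (indicator {k} (index_path i \<tau> T) * ?F i \<tau> c)) \<partial>lborel)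
        =
      (\<integral>\<^sup>+y. ennreal (1 / (y + ?x)) * indicator {support_lower..M * ?a - ?x} y * F y i \<partial>lborel)" .
  qed
  finally show ?thesis .
qed

lemma nn_integral_log_weight:
  assumes F: "dist_meas F" and F1: "\<And>c i. F c i \<le> 1" and x: "0 \<le> x"
  shows "(\<integral>\<^sup>+y. ennreal (1 / (y + x)) * indicator {support_lower..N} y * F y i \<partial>lborel) =
    ennreal (integral {support_lower..N} (\<lambda>y. enn2real (F y i) / (y + x)))"
proof -
  have fin: "F y i < \<top>" for y using F1[of y i] by (rule le_less_trans) simp
  have F': "F y i = ennreal (enn2real (F y i))" for y using fin[of y] by simp
  have f1: "\<bar>enn2real (F y i)\<bar> \<le> 1" for y using F1[of y i] by (simp add: enn2real_leI)
  have [measurable]: "(\<lambda>y. F y i) \<in> borel_measurable borel" using F by simp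
  have fm: "(\<lambda>y. enn2real (F y i)) \<in> borel_measurable borel" by measurable
  have "((\<lambda>y. enn2real (F y i) / (y + x)) has_integral integral {support_lower..N} (\<lambda>y. enn2real (F
      y i) / (y + x))) {support_lower..N}"
    using integrable_on_div_shift[OF fm f1 support_lower_pos x] by (rule integrable_integral)
  then have "(\<integral>\<^sup>+y. ennreal (indicator {support_lower..N} y * (enn2real (F y i) / (y + x))) \<partial>lborel) =
      ennreal (integral {support_lower..N} (\<lambda>y. enn2real (F y i) / (y + x)))"
    using support_lower_pos x by (intro nn_integral_has_integral_lebesgue) auto
  moreover have "ennreal (indicator {support_lower..N} y * (enn2real (F y i) / (y + x))) =
      ennreal (1 / (y + x)) * indicator {support_lower..N} y * F y i" for y
  proof (cases "y \<in> {support_lower..N}")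
    case True
    then have "0 < y + x" using support_lower_pos x by auto
    then show ?thesis using True by (subst (2) F') (simp flip: ennreal_mult)
  qed auto
  ultimately show ?thesis by simp
qed

text \<open>
  Integrating \<open>dual T F = F\<close> against \<open>dc / c\<close> over \<open>c \<le> M\<close>, the two sides differ by a term
  that grows with \<open>F\<close> and by a boundary term near \<open>M\<close> that converges to the mean growth.
\<close>
lemma fixed_vanish:
  assumes F: "dist_meas F" and F1: "\<And>c i. F c i \<le> 1" and zero: "\<And>c i. c \<le> support_lower \<Longrightarrow> F c i = 0"
    and fixed: "\<And>c k. k \<in> {-1, 1} \<Longrightarrow> dual T F c k = F c k"
    and lim: "\<And>i. i \<in> {-1, 1} \<Longrightarrow> ((\<lambda>c. enn2real (F c i)) \<longlongrightarrow> m i) at_top"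
    and drift: "(\<Sum>i\<in>{-1, 1}. m i * (\<integral>\<tau>. gr i \<tau> T \<partial>H i)) \<le> 0"
    and i: "i \<in> {-1, 1}"
  shows "AE c in lborel. F c i = 0"
proof -
  define f where "f i y = enn2real (F y i)" for i y
  have fin: "F y i < \<top>" for y i using F1[of y i] by (rule le_less_trans) simp
  have Ff: "F y i = ennreal (f i y)" for y i using fin[of y i] by (simp add: f_def)
  have f0: "0 \<le> f i y" for i y by (simp add: f_def)
  have f1: "\<bar>f i y\<bar> \<le> 1" for i y using F1[of y i] by (simp add: f_def enn2real_leI)
  have fm [measurable]: "f i \<in> borel_measurable borel" for i
  proof -
    have [measurable]: "(\<lambda>y. F y i) \<in> borel_measurable borel" using F by simp
    show ?thesis unfolding f_def[abs_def] by measurable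
  qed
  define l where "l i N x = integral {support_lower..N} (\<lambda>y. f i y / (y + x))" for i N x
  have int: "(\<lambda>y. f i y / (y + x)) integrable_on {s..N}" if "0 \<le> x" "0 < s" for i x N s
    using integrable_on_div_shift[OF fm f1 that(2) that(1)] .
  have l0: "0 \<le> l i N x" if "0 \<le> x" for i N x
    unfolding l_def using support_lower_pos that f0 by (intro integral_nonneg int) auto
  have m0: "0 \<le> m i" if "i \<in> {-1, 1}" for i
    by (rule tendsto_lowerbound[OF lim[OF that]]) auto
  \<comment> \<open>A bound, uniform over all paths, for the logarithmic displacement
    \<open>?d\<close> of the upper endpoint: \<open>2 * C * T\<close> for the growth and
    \<open>2 * mass_upper\<close> for the shift.\<close>
  define B where "B = 2 * C * T + 2 * mass_upper"
  have B: "0 \<le> B" using C_pos T by (simp add: B_def mass_upper_def)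
  \<comment> \<open>A lower bound of the shift \<open>2 * ms i \<tau> T\<close> over all paths. With
    it the gap \<open>1 / y - 1 / (y + X)\<close> between the two weights becomes deterministic, and
    it is strictly positive.\<close>
  define X where "X = 2 * mass_lower"
  have X: "0 < X" using mass_lower_pos by (simp add: X_def)
  define g where "g i y = f i y / y - f i y / (y + X)" for i y
  have g0: "0 \<le> g i y" if "0 < y" for i y
  proof -
    have "f i y / (y + X) \<le> f i y / y" using that X f0[of i y] by (intro divide_left_mono) auto
    then show ?thesis by (simp add: g_def)
  qed
  have gint: "g i integrable_on {s..N}" if "0 < s" for i s N
    unfolding g_def[abs_def] using int[of 0 s i N] int[of X s i N] X that
        by (intro integrable_diff) auto
  have D: "l i N 0 - l i N X = integral {support_lower..N} (g i)" for i N
    unfolding l_def g_def[abs_def] using int[of 0 support_lower i N] int[of X support_lower i N] X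
        support_lower_pos
    by (subst Henstock_Kurzweil_Integration.integral_diff) auto
  have main: "(\<Sum>i\<in>{-1, 1}. l i M0 0 - l i M0 X) \<le> 2 * \<epsilon> * B" if \<epsilon>: "0 < \<epsilon>" for \<epsilon> M0
  proof -
    have "\<forall>\<^sub>F c in at_top. \<forall>i\<in>{-1, 1}. \<bar>f i c - m i\<bar> < \<epsilon>"
      by (intro eventually_ball_finite ballI) (use lim[THEN tendstoD, OF _ \<epsilon>] in \<open>auto simp: f_def
          dist_real_def\<close>)
    then obtain K where K: "\<And>c i. K \<le> c \<Longrightarrow> i \<in> {-1, 1} \<Longrightarrow> \<bar>f i c - m i\<bar> < \<epsilon>"
      by (auto simp: eventually_at_top_linorder)
    define L where "L = max K support_lower"
    \<comment> \<open>The entry 1 makes \<open>ln (1 + ?x / M) \<le> ?x\<close>, the entry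
      \<open>M0\<close> lets the gap integrals be compared, and the last entry keeps
      \<open>M * exp (2 * a) - 2 * j\<close> above \<open>L\<close> for every path, where
      \<open>f\<close> is within \<open>\<epsilon>\<close> of its limit.\<close>
    define M where "M = max (max 1 M0) (max L ((L + 2 * mass_upper) * exp (2 * C * T)))"
    have M: "1 \<le> M" "M0 \<le> M" "L \<le> M" "(L + 2 * mass_upper) * exp (2 * C * T) \<le> M"
        by (auto simp: M_def)
    have step: "l i (M * exp (2 * gr i \<tau> T) - 2 * ms i \<tau> T) (2 * ms i \<tau> T) \<le> l i M X +
        m i * (2 * gr i \<tau> T) + \<epsilon> * B"
      if i: "i \<in> {-1, 1}" for i \<tau>
    proof -
      let ?x = "2 * ms i \<tau> T" and ?a = "gr i \<tau> T"
      let ?N = "M * exp (2 * ?a) - ?x"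
      have x: "X \<le> ?x" "0 < ?x" using ms_bounds(1)[of i \<tau>] X by (auto simp: X_def)
      have "L + 2 * mass_upper = (L + 2 * mass_upper) * exp (2 * C * T) * exp (- 2 * C * T)"
          by (simp add: mult.assoc flip: exp_add)
      also have "\<dots> \<le> M * exp (2 * ?a)" using M exp_gr_bounds(1)[of i \<tau>] by (intro mult_mono) auto
      finally have N: "L \<le> ?N" using ms_bounds(2)[of i \<tau>] by simp
      \<comment> \<open>As \<open>?N + ?x = M * exp (2 * ?a)\<close>, the displacement is
        \<open>2 * ?a\<close> minus the nonnegative \<open>ln (1 + ?x / M)\<close>. That correction
        has a favourable sign and is dropped.\<close>
      let ?d = "ln (?N + ?x) - ln (M + ?x)"
      have "ln (M + ?x) = ln M + ln (1 + ?x / M)"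
        using M x by (subst ln_mult_pos[symmetric]) (auto simp: field_simps add_pos_pos)
      moreover have "ln (?N + ?x) = ln M + 2 * ?a" using M by (simp add: ln_mult_pos)
      ultimately have d: "?d = 2 * ?a - ln (1 + ?x / M)" by simp
      have q: "0 \<le> ln (1 + ?x / M)" using M x by simp
      have "ln (1 + ?x / M) \<le> ?x / M" using M x by (intro ln_add_one_self_le_self) auto
      also have "\<dots> \<le> ?x" using M x by (simp add: divide_le_eq mult_le_cancel_left1)
      also have "\<dots> \<le> 2 * mass_upper" using ms_bounds(2)[of i \<tau>] by simp
      finally have dB: "\<bar>?d\<bar> \<le> B" unfolding d B_def using gr_bounds[of i \<tau>] q by linarith
      have "l i ?N ?x \<le> l i M ?x + m i * ?d + \<epsilon> * \<bar>?d\<bar>"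
        unfolding l_def
      proof (rule log_integral_close[OF fm f1 support_lower_pos])
        fix y assume "min M ?N \<le> y"
        then have "L \<le> y" using M N by linarith
        then show "\<bar>f i y - m i\<bar> \<le> \<epsilon>" using K[of y i] i by (simp add: L_def less_imp_le)
      qed (use x M N in \<open>auto simp: L_def\<close>)
      also have "l i M ?x \<le> l i M X"
        unfolding l_def
        by (intro integral_le int divide_left_mono f0) (use x X support_lower_pos in \<open>auto intro!:
            mult_pos_pos add_pos_pos\<close>)
      also have "m i * ?d \<le> m i * (2 * ?a)"
        using q m0[OF i] unfolding d by (intro mult_left_mono) auto
      also have "\<epsilon> * \<bar>?d\<bar> \<le> \<epsilon> * B" using dB \<epsilon> by (intro mult_left_mono) auto
      finally show ?thesis by simp
    qed
    \<comment> \<open>Upper bounds for the averaged right-hand sides. They contain \<open>l\<close>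
      with the weight \<open>1 / (y + X)\<close>, the left-hand side contains it with
      \<open>1 / y\<close>, and the growth terms have a nonpositive sum by the assumption on the
      drift. What remains is a bound for the integral of \<open>g\<close>.\<close>
    define Z where "Z i = l i M X + m i * (2 * (\<integral>\<tau>. gr i \<tau> T \<partial>H i)) + \<epsilon> * B" for i
    have nn: "0 \<le> l i M X + m i * (2 * gr i \<tau> T) + \<epsilon> * B" if "i \<in> {-1, 1}" for i \<tau>
      using l0[of "2 * ms i \<tau> T" i "M * exp (2 * gr i \<tau> T) - 2 * ms i \<tau> T"] step[OF that, of \<tau>]
          ms_bounds(1)[of i \<tau>] mass_lower_pos
      by linarith
    have I: "integrable (H i) (\<lambda>\<tau>. gr i \<tau> T)" for i using T by (intro gr_integrable) auto
    have EZ: "(\<integral>\<tau>. l i M X + m i * (2 * gr i \<tau> T) + \<epsilon> * B \<partial>H i) = Z i" for i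
      using I[of i] H.prob_space[of i] by (simp add: Z_def)
    have Z0: "0 \<le> Z i" if "i \<in> {-1, 1}" for i
      unfolding EZ[symmetric] using nn[OF that] by (rule integral_nonneg_AE[OF AE_I2])
    have "(\<Sum>k\<in>{-1, 1}. ennreal (l k M 0)) = (\<Sum>k\<in>{-1, 1}. \<integral>\<^sup>+c. ennreal (1 / c) * indicator {0<..M} c
        * dual T F c k \<partial>lborel)"
    proof (rule sum.cong[OF refl])
      fix k :: int assume k: "k \<in> {-1, 1}"
      have "ennreal (l k M 0) = (\<integral>\<^sup>+y. ennreal (1 / (y + 0)) * indicator {support_lower..M} y * F y k
          \<partial>lborel)"
        unfolding l_def f_def by (rule nn_integral_log_weight[OF F F1, symmetric]) simp
      also have "\<dots> = (\<integral>\<^sup>+c. ennreal (1 / c) * indicator {0<..M} c * dual T F c k \<partial>lborel)"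
      proof (rule nn_integral_cong)
        fix c
        show "ennreal (1 / (c + 0)) * indicator {support_lower..M} c * F c k =
            ennreal (1 / c) * indicator {0<..M} c * dual T F c k"
          using support_lower_pos zero[of c k] fixed[OF k, of c]
              by (cases "c \<le> support_lower") (auto simp: indicator_def)
      qed
      finally show "ennreal (l k M 0) = (\<integral>\<^sup>+c. ennreal (1 / c) * indicator {0<..M} c * dual T F c k
          \<partial>lborel)" .
    qed
    also have "\<dots> = (\<Sum>i\<in>{-1, 1}. \<integral>\<^sup>+\<tau>. ennreal (l i (M * exp (2 * gr i \<tau> T) - 2 * ms i \<tau> T) (2 * ms i
        \<tau> T)) \<partial>H i)"
    proof -
      have "0 \<le> 2 * ms i \<tau> T" for i \<tau> using ms_bounds(1)[of i \<tau>] mass_lower_pos by simp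
      then show ?thesis
        using M(1) by (subst dual_log_identity[OF F zero]) (auto simp: nn_integral_log_weight[OF F
            F1] l_def f_def)
    qed
    also have "\<dots> \<le> (\<Sum>i\<in>{-1, 1}. \<integral>\<^sup>+\<tau>. ennreal (l i M X + m i * (2 * gr i \<tau> T) + \<epsilon> * B) \<partial>H i)"
      by (intro sum_mono nn_integral_mono ennreal_leI step)
    also have "\<dots> = (\<Sum>i\<in>{-1, 1}. ennreal (Z i))"
    proof (rule sum.cong[OF refl])
      fix i :: int assume i: "i \<in> {-1, 1}"
      have "(\<integral>\<^sup>+\<tau>. ennreal (l i M X + m i * (2 * gr i \<tau> T) + \<epsilon> * B) \<partial>H i) =
          ennreal (\<integral>\<tau>. l i M X + m i * (2 * gr i \<tau> T) + \<epsilon> * B \<partial>H i)"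
        using nn[OF i] I by (intro nn_integral_eq_integral) auto
      also note EZ
      finally show "(\<integral>\<^sup>+\<tau>. ennreal (l i M X + m i * (2 * gr i \<tau> T) + \<epsilon> * B) \<partial>H i) = ennreal (Z i)"
        by (simp add: Z_def)
    qed
    finally have "ennreal (\<Sum>k\<in>{-1, 1}. l k M 0) \<le> (\<Sum>i\<in>{-1, 1}. ennreal (Z i))"
      using l0 by (subst sum_ennreal[symmetric]) (auto simp: Z_def)
    also have "\<dots> = ennreal (\<Sum>i\<in>{-1, 1}. Z i)"
      using Z0 by (intro sum_ennreal) auto
    finally have "(\<Sum>k\<in>{-1, 1}. l k M 0) \<le> (\<Sum>i\<in>{-1, 1}. Z i)"
      using Z0 by (subst (asm) ennreal_le_iff) (auto intro!: sum_nonneg)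
    moreover have "(\<Sum>i\<in>{-1, 1}. Z i) = (\<Sum>i\<in>{-1, 1}. l i M X) + 2 * (\<Sum>i\<in>{-1, 1}. m i * (\<integral>\<tau>. gr i \<tau> T
        \<partial>H i)) + 2 * \<epsilon> * B"
      by (simp add: Z_def algebra_simps)
    ultimately have "(\<Sum>i\<in>{-1, 1}. l i M 0 - l i M X) \<le> 2 * \<epsilon> * B"
      using drift unfolding sum_subtractf by linarith
    moreover have "l i M0 0 - l i M0 X \<le> l i M 0 - l i M X" for i
      unfolding D using M(2) support_lower_pos g0 by (intro integral_subset_le gint) auto
    then have "(\<Sum>i\<in>{-1, 1}. l i M0 0 - l i M0 X) \<le> (\<Sum>i\<in>{-1, 1}. l i M 0 - l i M X)"
      by (rule sum_mono)
    ultimately show ?thesis by simp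
  qed
  \<comment> \<open>The bound \<open>2 * \<epsilon> * B\<close> holds for every positive
    \<open>\<epsilon>\<close> at the same \<open>M0\<close>, so the nonnegative gap integrals are
    0.\<close>
  have D0: "integral {support_lower..M0} (g i) = 0" for M0
  proof -
    have nn: "0 \<le> integral {support_lower..M0} (g k)" for k
      using g0 support_lower_pos by (intro integral_nonneg gint) auto
    have "(\<Sum>i\<in>{-1, 1}. integral {support_lower..M0} (g i)) \<le> 0"
    proof (rule field_le_epsilon)
      fix e :: real assume "0 < e"
      then have "0 < e / (2 * (B + 1))" using B by simp
      have eq: "2 * (e / (2 * (B + 1))) * B = e * (B / (B + 1))" using B by (simp add: divide_simps)
      from main[OF \<open>0 < e / (2 * (B + 1))\<close>, of M0] have "(\<Sum>i\<in>{-1, 1}. integral {support_lower..M0}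
          (g i)) \<le> e * (B / (B + 1))"
        unfolding D eq .
      also have "\<dots> \<le> e * 1" using \<open>0 < e\<close> B by (intro mult_left_mono) auto
      finally show "(\<Sum>i\<in>{-1, 1}. integral {support_lower..M0} (g i)) \<le> 0 + e" by simp
    qed
    then show ?thesis using nn[of "-1"] nn[of 1] i by auto
  qed
  have "AE y in lborel. \<forall>n::nat. ennreal (indicator {support_lower..real n} y * g i y) = 0"
  proof (subst AE_all_countable, rule allI)
    fix n :: nat
    have "(g i has_integral integral {support_lower..real n} (g i)) {support_lower..real n}"
      using support_lower_pos by (intro integrable_integral gint)
    then have "(\<integral>\<^sup>+y. ennreal (indicator {support_lower..real n} y * g i y) \<partial>lborel) =
        ennreal (integral {support_lower..real n} (g i))"
      using g0 support_lower_pos by (intro nn_integral_has_integral_lebesgue) auto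
    then show "AE y in lborel. ennreal (indicator {support_lower..real n} y * g i y) = 0"
      unfolding D0 by (subst (asm) ennreal_0, subst (asm) nn_integral_0_iff_AE) (auto simp: g_def)
  qed
  then show ?thesis
  proof eventually_elim
    case (elim y)
    show ?case
    proof (cases "y \<le> support_lower")
      case False
      then have y: "0 < y" using support_lower_pos by simp
      have "ennreal (indicator {support_lower..real (nat \<lceil>y\<rceil>)} y * g i y) = 0" using elim by blast
      moreover have "y \<le> real (nat \<lceil>y\<rceil>)" by (rule real_nat_ceiling_ge)
      ultimately have "g i y \<le> 0" using False by (simp add: ennreal_eq_0_iff)
      moreover have "g i y = f i y * (1 / y - 1 / (y + X))" by (simp add: g_def right_diff_distrib)
      moreover have "1 / (y + X) < 1 / y" using y X
          by (intro divide_strict_left_mono mult_pos_pos) auto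
      ultimately have "f i y \<le> 0" by (simp add: mult_le_0_iff)
      then show ?thesis using f0[of i y] by (simp add: Ff)
    qed (simp add: zero)
  qed
qed

end

subsection \<open>The mean growth rate\<close>

text \<open>The stationary mean of the growth rate, which is the Lyapunov exponent of the switched
  system linearized at the origin. Its sign is what the two cases of the theorem
  distinguish.\<close>

definition drift :: real where "drift = \<pi> (-1) * pm + \<pi> 1 * pp"

lemma expectation_p:
  assumes s: "0 \<le> s" and i: "i \<in> {-1, 1}"
  shows "(\<integral>\<tau>. p (index_path i \<tau> s) \<partial>H i) = (\<Sum>k\<in>{-1, 1}. p k * trans s i k)"
proof -
  have sets: "{\<tau>. index_path i \<tau> s = k} \<in> sets (H i)" for k
  proof -
    have "{\<tau> \<in> space seqs. index_path i \<tau> s = k} \<in> sets seqs" by measurable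
    then show ?thesis by (simp add: space_PiM sets_holding_times)
  qed
  have eq: "p (index_path i \<tau> s) = (\<Sum>k\<in>{-1, 1}. p k * indicator {\<tau>. index_path i \<tau> s = k} \<tau>)" for \<tau>
    using index_path_cases[OF i, of \<tau> s] by (auto simp: indicator_def)
  have "integrable (H i) (\<lambda>\<tau>. p k * indicator {\<tau>. index_path i \<tau> s = k} \<tau>)" for k
    using sets by (intro integrable_mult_right) (simp add: integrable_indicator_iff
        H.emeasure_eq_measure)
  then have "(\<integral>\<tau>. p (index_path i \<tau> s) \<partial>H i) = (\<Sum>k\<in>{-1, 1}. \<integral>\<tau>. p k * indicator {\<tau>. index_path i \<tau> s =
      k} \<tau> \<partial>H i)"
    unfolding eq by (intro Bochner_Integration.integral_sum)
  also have "\<dots> = (\<Sum>k\<in>{-1, 1}. p k * trans s i k)"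
    using sets prob_index[OF s i] trans_nonneg[OF s]
    by (intro sum.cong refl) (simp add: measure_def)
  finally show ?thesis .
qed

text \<open>An index started from \<open>\<pi>\<close> has law \<open>\<pi>\<close> at every time,
  so by Fubini the mean growth has the constant rate \<open>drift\<close>.\<close>

lemma mean_growth:
  assumes t: "0 \<le> t"
  shows "(\<Sum>i\<in>{-1, 1}. \<pi> i * (\<integral>\<tau>. gr i \<tau> t \<partial>H i)) = drift * t"
proof -
  have E: "(\<integral>\<tau>. gr i \<tau> t \<partial>H i) = (LINT u:{0..t}|lborel. (\<Sum>k\<in>{-1, 1}. p k * trans u i k))"
      if i: "i \<in> {-1, 1}" for i
  proof -
    interpret pair_sigma_finite lborel "H i" ..
    have m: "(\<lambda>(u, \<tau>). indicator {0..t} u *\<^sub>R p (index_path i \<tau> u)) \<in>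
        borel_measurable (lborel \<Otimes>\<^sub>M H i)"
      unfolding case_prod_beta by measurable
    have "integrable (lborel \<Otimes>\<^sub>M H i) (\<lambda>(u, \<tau>). indicator {0..t} u *\<^sub>R p (index_path i \<tau> u))"
    proof (rule integrableI_bounded_set[where A = "{0..t} \<times> UNIV" and B = C])
      have "UNIV \<in> sets (H i)" using sets.top[of "H i"] by simp
      then show "{0..t} \<times> UNIV \<in> sets (lborel \<Otimes>\<^sub>M H i)" by (intro pair_measureI) auto
      show "emeasure (lborel \<Otimes>\<^sub>M H i) ({0..t} \<times> UNIV) < \<infinity>"
        using \<open>UNIV \<in> sets (H i)\<close> by (subst H.emeasure_pair_measure_Times) (auto simp:
            emeasure_lborel_Icc_eq)
    qed (use m p_bound in \<open>auto simp: indicator_def case_prod_beta\<close>)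
    from Fubini_integral[OF this]
    have "(\<integral>\<tau>. gr i \<tau> t \<partial>H i) = (\<integral>u. \<integral>\<tau>. indicator {0..t} u *\<^sub>R p (index_path i \<tau> u) \<partial>H i \<partial>lborel)"
      unfolding growth_def set_lebesgue_integral_def by simp
    also have "\<dots> = (\<integral>u. indicator {0..t} u *\<^sub>R (\<Sum>k\<in>{-1, 1}. p k * trans u i k) \<partial>lborel)"
      using expectation_p[OF _ i] by (intro Bochner_Integration.integral_cong refl) (auto simp:
          indicator_def)
    finally show ?thesis by (simp add: set_lebesgue_integral_def)
  qed
  have I: "set_integrable lborel {0..t} (\<lambda>u. \<Sum>k\<in>{-1, 1}. p k * trans u i k)" for i
    unfolding trans_def by (intro borel_integrable_atLeastAtMost' continuous_intros)
  have "(\<Sum>i\<in>{-1, 1}. \<pi> i * (\<integral>\<tau>. gr i \<tau> t \<partial>H i)) =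
      (\<Sum>i\<in>{-1, 1}. LINT u:{0..t}|lborel. \<pi> i * (\<Sum>k\<in>{-1, 1}. p k * trans u i k))"
    by (intro sum.cong refl) (simp only: E set_integral_mult_right)
  also have "\<dots> = (LINT u:{0..t}|lborel. (\<Sum>i\<in>{-1, 1}. \<pi> i * (\<Sum>k\<in>{-1, 1}. p k * trans u i k)))"
    using I[of "-1"] I[of 1] by (simp add: set_integral_add)
  also have "(\<lambda>u. \<Sum>i\<in>{-1, 1}. \<pi> i * (\<Sum>k\<in>{-1, 1}. p k * trans u i k)) = (\<lambda>u. drift)"
  proof
    fix u
    have "(\<Sum>i\<in>{-1, 1}. \<pi> i * (\<Sum>k\<in>{-1, 1}. p k * trans u i k)) =
        (\<Sum>k\<in>{-1, 1}. p k * (\<Sum>i\<in>{-1, 1}. \<pi> i * trans u i k))"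
      by (simp add: algebra_simps)
    also have "\<dots> = (\<Sum>k\<in>{-1, 1}. p k * \<pi> k)" by (intro sum.cong refl) (simp only: \<pi>_trans)
    finally show "(\<Sum>i\<in>{-1, 1}. \<pi> i * (\<Sum>k\<in>{-1, 1}. p k * trans u i k)) = drift"
      by (simp add: drift_def p_def by_index_def)
  qed
  also have "(LINT u:{0..t}|lborel. drift) = drift * t"
    using t set_borel_integral_eq_integral(2)[OF borel_integrable_atLeastAtMost'[OF
        continuous_on_const], of 0 t drift]
    by simp
  finally show ?thesis .
qed

subsection \<open>Positivity of the largest fixed point\<close>

text \<open>Within the last unit of time the growth differs from its final value by at most
  \<open>C\<close>, so that unit alone contributes this much to the mass.\<close>

lemma ms_lower: "exp (2 * gr i \<tau> (real (Suc n)) - 2 * C) \<le> ms i \<tau> (real (Suc n))"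
proof -
  let ?e = "index_path i \<tau>"
  have "exp (2 * growth ?e (real (Suc n)) - 2 * C) = integral {real n..real (Suc n)} (\<lambda>u. exp (2 *
      growth ?e (real (Suc n)) - 2 * C))"
    by simp
  also have "\<dots> \<le> integral {real n..real (Suc n)} (\<lambda>u. exp (2 * growth ?e u))"
  proof (intro integral_le exp_growth_integrable_on)
    fix u assume u: "u \<in> {real n..real (Suc n)}"
    then have "\<bar>growth ?e (real (Suc n)) - growth ?e u\<bar> \<le> C * (real (Suc n) - u)"
      by (intro growth_lipschitz) auto
    also have "\<dots> \<le> C * 1" using u C_pos by (intro mult_left_mono) auto
    finally show "exp (2 * growth ?e (real (Suc n)) - 2 * C) \<le> exp (2 * growth ?e u)"
      by simp
  qed auto
  also have "\<dots> \<le> ms i \<tau> (real (Suc n))"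
    using mass_diff[of ?e "real n" "real (Suc n)"] mass_nonneg[of ?e "real n"] by simp
  finally show ?thesis .
qed

lemma ms_step: "ms i \<tau> (real (Suc n)) \<le> ms i \<tau> (real n) + exp (2 * gr i \<tau> (real n)) * exp (2 * C)"
proof -
  let ?e = "index_path i \<tau>"
  have "mass (\<lambda>u. ?e (real n + u)) 1 \<le> 1 * exp (2 * C * 1)"
    by (intro mass_bounds(2) index_meas_shift) auto
  then show ?thesis using mass_add[of ?e "real n" 1] by (simp add: add.commute)
qed

text \<open>By \<open>ms_lower\<close> the mean of \<open>ln j\<close> grows at least at the rate
  \<open>2 * drift\<close>. Its increments are bounded by a multiple of the mean of
  \<open>exp (2 * a) / j\<close>, which is \<open>2 * |x|^2\<close> for the process started at
  infinity. If \<open>Flim\<close> were 0, that process would tend to the origin in probability and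
  the increments would tend to 0.\<close>

lemma Flim_not_zero:
  assumes drift: "0 < drift"
  shows "\<exists>c. \<exists>k\<in>{-1, 1}. Flim c k \<noteq> 0"
proof (rule ccontr)
  assume "\<not> ?thesis"
  then have Fl0: "Flim c k = 0" if "k \<in> {-1, 1}" for c k using that by auto
  \<comment> \<open>Expectation with the initial index distributed according to
    \<open>\<pi>\<close>.\<close>
  define E where "E X = (\<Sum>i\<in>{-1, 1}. \<pi> i * (\<integral>\<tau>. X i \<tau> \<partial>H i))" for X
  have E_mono: "E X \<le> E Y" if "\<And>i \<tau>. X i \<tau> \<le> Y i \<tau>" "\<And>i. integrable (H i) (X i)" "\<And>i. integrable (H
      i) (Y i)" for X Y
    unfolding E_def using \<pi>_pos that by (intro sum_mono mult_left_mono integral_mono) (auto simp: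
        less_imp_le)
  have E_add: "E (\<lambda>i \<tau>. X i \<tau> + Y i \<tau>) = E X + E Y"
      if "\<And>i. integrable (H i) (X i)" "\<And>i. integrable (H i) (Y i)" for X Y
    unfolding E_def using that by (simp add: distrib_left)
  have E_cmult: "E (\<lambda>i \<tau>. a * X i \<tau>) = a * E X" for a X
    unfolding E_def by (simp add: algebra_simps)
  have E_const: "E (\<lambda>_ _. a) = a" for a
    using \<pi>_sum H.prob_space by (simp add: E_def distrib_right[symmetric])
  \<comment> \<open>The squared radius at time \<open>n\<close> for a start at infinite radius;
    \<open>ms_lower\<close> bounds it by \<open>R\<close> from time 1 on.\<close>
  define ratio where "ratio n i \<tau> = exp (2 * gr i \<tau> (real n)) / (2 * ms i \<tau> (real n))" for n i \<tau>
  have ms_pos: "0 < ms i \<tau> (real (Suc n))" for i \<tau> n using ms_lower[of i \<tau> n]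
      by (meson exp_gt_zero less_le_trans)
  define R where "R = exp (2 * C) / 2"
  have ratio0: "0 \<le> ratio (Suc n) i \<tau>" for n i \<tau>
    using ms_pos[of i \<tau> n] by (simp add: ratio_def)
  have ratioR: "ratio (Suc n) i \<tau> \<le> R" for n i \<tau>
  proof -
    have "exp (2 * gr i \<tau> (real (Suc n))) \<le> ms i \<tau> (real (Suc n)) * exp (2 * C)"
      using ms_lower[of i \<tau> n] by (simp add: exp_diff field_simps)
    then show ?thesis using ms_pos[of i \<tau> n] by (simp add: ratio_def R_def divide_simps
        mult.commute)
  qed
  have ratio_m [measurable]: "ratio n i \<in> borel_measurable (H i)" for n i
    unfolding ratio_def[abs_def] by measurable
  have ratio_int: "integrable (H i) (ratio (Suc n) i)" for n i
    using ratio0 ratioR by (intro H.integrable_const_bound[where B = R]) auto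
  define U where "U c n i = {\<tau>. 0 \<le> c * exp (2 * gr i \<tau> (real n)) - 2 * ms i \<tau> (real n)}" for c n i
  have U: "U c n i \<in> sets (H i)" for c n i
  proof -
    have "{\<tau> \<in> space (H i). 0 \<le> c * exp (2 * gr i \<tau> (real n)) - 2 * ms i \<tau> (real n)} \<in> sets (H i)"
        by measurable
    then show ?thesis by (simp add: U_def)
  qed
  \<comment> \<open>\<open>U c n i\<close> is the event that this squared radius is at least
    \<open>1 / c\<close>, for positive \<open>c\<close>. Its probability is the total mass of
    \<open>dual (real n) F0\<close> at \<open>c\<close>, and that tends to the sum of the values of
    \<open>Flim\<close>.\<close>
  have U_lim: "(\<lambda>n. E (\<lambda>i. indicator (U c n i))) \<longlonglongrightarrow> 0" for c
  proof -
    have "ennreal (E (\<lambda>i. indicator (U c n i))) = (\<Sum>k\<in>{-1, 1}. dual (real n) F0 c k)" for n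
    proof -
      have "ennreal (E (\<lambda>i. indicator (U c n i))) = (\<Sum>i\<in>{-1, 1}. ennreal (\<pi> i) * emeasure (H i) (U c
          n i))"
        using U \<pi>_pos by (simp add: E_def H.emeasure_eq_measure ennreal_mult[symmetric] less_imp_le
            flip: ennreal_plus)
      also have "\<dots> = (\<Sum>i\<in>{-1, 1}. \<integral>\<^sup>+\<tau>. F0 (c * exp (2 * gr i \<tau> (real n)) - 2 * ms i \<tau> (real n)) i \<partial>H
          i)"
      proof (rule sum.cong[OF refl])
        fix i
        have "F0 (c * exp (2 * gr i \<tau> (real n)) - 2 * ms i \<tau> (real n)) i =
            ennreal (\<pi> i) * indicator (U c n i) \<tau>" for \<tau>
          by (simp add: F0_def U_def indicator_def)
        then show "ennreal (\<pi> i) * emeasure (H i) (U c n i) = (\<integral>\<^sup>+\<tau>. F0 (c * exp (2 * gr i \<tau> (real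
            n)) - 2 * ms i \<tau> (real n)) i \<partial>H i)"
          using U by (simp add: nn_integral_cmult_indicator)
      qed
      also have "\<dots> = (\<Sum>i\<in>{-1, 1}. \<Sum>k\<in>{-1, 1}. \<integral>\<^sup>+\<tau>. indicator {k} (index_path i \<tau> (real n)) *
          F0 (c * exp (2 * gr i \<tau> (real n)) - 2 * ms i \<tau> (real n)) i \<partial>H i)"
      proof (intro sum.cong refl)
        fix i :: int assume i: "i \<in> {-1, 1}"
        let ?F = "\<lambda>\<tau>. F0 (c * exp (2 * gr i \<tau> (real n)) - 2 * ms i \<tau> (real n)) i"
        have "(\<Sum>k\<in>{-1, 1}. \<integral>\<^sup>+\<tau>. indicator {k} (index_path i \<tau> (real n)) * ?F \<tau> \<partial>H i) =
            (\<integral>\<^sup>+\<tau>. (\<Sum>k\<in>{-1, 1}. indicator {k} (index_path i \<tau> (real n)) * ?F \<tau>) \<partial>H i)"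
          by (intro nn_integral_sum[symmetric] borel_measurable_times_ennreal dist_meas_compose[OF
              F0_measurable]) measurable
        also have "\<dots> = (\<integral>\<^sup>+\<tau>. ?F \<tau> \<partial>H i)"
          using index_path_sum[OF i] by (simp only: sum_distrib_right[symmetric]) simp
        finally show "(\<integral>\<^sup>+\<tau>. ?F \<tau> \<partial>H i) = (\<Sum>k\<in>{-1, 1}. \<integral>\<^sup>+\<tau>. indicator {k} (index_path i \<tau> (real n)) *
            ?F \<tau> \<partial>H i)" by simp
      qed
      also have "\<dots> = (\<Sum>k\<in>{-1, 1}. dual (real n) F0 c k)"
        unfolding dual_def by (rule sum.swap)
      finally show ?thesis .
    qed
    moreover have "(\<lambda>n. \<Sum>k\<in>{-1, 1}. dual (real n) F0 c k) \<longlonglongrightarrow> (\<Sum>k\<in>{-1, 1}. Flim c k)"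
      by (intro tendsto_sum Flim_tendsto)
    ultimately have "(\<lambda>n. ennreal (E (\<lambda>i. indicator (U c n i)))) \<longlonglongrightarrow> ennreal 0"
      using Fl0 by simp
    moreover have "0 \<le> E (\<lambda>i. indicator (U c n i))" for n
      using \<pi>_pos by (simp add: E_def less_imp_le)
    ultimately show ?thesis by (subst (asm) tendsto_ennreal_iff) auto
  qed
  have ratio_lim: "(\<lambda>n. E (ratio (Suc n))) \<longlonglongrightarrow> 0"
  proof (rule LIMSEQ_I)
    fix r :: real assume r: "0 < r"
    \<comment> \<open>Off \<open>U\<close> the ratio is at most \<open>1 / c = r / 2\<close>; on
      \<open>U\<close> it is at most \<open>R\<close>, and the probability of \<open>U\<close> is
      eventually below \<open>r / (2 * R)\<close>.\<close>
    define c where "c = 2 / r"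
    have c: "0 < c" using r by (simp add: c_def)
    have R: "0 < R" by (simp add: R_def)
    have "(\<lambda>n. E (\<lambda>i. indicator (U c (Suc n) i))) \<longlonglongrightarrow> 0" by (rule LIMSEQ_Suc[OF U_lim])
    then have "\<forall>\<^sub>F n in sequentially. E (\<lambda>i. indicator (U c (Suc n) i)) < r / (2 * R)"
      using r R by (intro order_tendstoD) auto
    then obtain N where N: "\<And>n. N \<le> n \<Longrightarrow> E (\<lambda>i. indicator (U c (Suc n) i)) < r / (2 * R)"
      by (auto simp: eventually_sequentially)
    have "norm (E (ratio (Suc n)) - 0) < r" if "N \<le> n" for n
    proof -
      have "ratio (Suc n) i \<tau> \<le> 1 / c + R * indicator (U c (Suc n) i) \<tau>" for i \<tau>
      proof (cases "\<tau> \<in> U c (Suc n) i")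
        case True
        then show ?thesis using ratioR[of n i \<tau>] c by (simp add: add_increasing)
      next
        case False
        then have "c * exp (2 * gr i \<tau> (real (Suc n))) \<le> 2 * ms i \<tau> (real (Suc n))"
            by (simp add: U_def)
        then show ?thesis using False c ms_pos[of i \<tau> n] by (simp add: ratio_def field_simps)
      qed
      moreover have UI: "integrable (H i) (\<lambda>\<tau>. R * indicator (U c (Suc n) i) \<tau>)" for i
        using U by (intro integrable_mult_right) (simp add: integrable_indicator_iff
            H.emeasure_eq_measure)
      ultimately have "E (ratio (Suc n)) \<le> E (\<lambda>i \<tau>. 1 / c + R * indicator (U c (Suc n) i) \<tau>)"
        by (intro E_mono ratio_int) auto
      also have "\<dots> = 1 / c + R * E (\<lambda>i. indicator (U c (Suc n) i))"
        using UI by (subst E_add) (simp_all add: E_const E_cmult)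
      also have "\<dots> < r / 2 + R * (r / (2 * R))"
        using N[OF that] R r by (intro add_le_less_mono mult_strict_left_mono) (auto simp: c_def)
      also have "\<dots> = r" using R by simp
      finally have "E (ratio (Suc n)) < r" .
      moreover have "0 \<le> E (ratio (Suc n))"
        unfolding E_def using \<pi>_pos ratio0 by (intro sum_nonneg mult_nonneg_nonneg
            integral_nonneg_AE) (auto simp: less_imp_le)
      ultimately show ?thesis by simp
    qed
    then show "\<exists>N. \<forall>n\<ge>N. norm (E (ratio (Suc n)) - 0) < r" by blast
  qed
  define b where "b n = E (\<lambda>i \<tau>. ln (ms i \<tau> (real (Suc n))))" for n
  have b_int: "integrable (H i) (\<lambda>\<tau>. ln (ms i \<tau> (real (Suc n))))" for i n
  proof (rule H.integrable_const_bound)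
    let ?t = "real (Suc n)"
    have "ln (?t * exp (- 2 * C * ?t)) \<le> ln (ms i \<tau> ?t)" "ln (ms i \<tau> ?t) \<le>
        ln (?t * exp (2 * C * ?t))" for \<tau>
      using mass_bounds[of "index_path i \<tau>" ?t] ms_pos[of i \<tau> n] by (auto intro!: ln_mono)
    then show "AE \<tau> in H i. norm (ln (ms i \<tau> ?t)) \<le> \<bar>ln (?t * exp (- 2 * C * ?t))\<bar> +
        \<bar>ln (?t * exp (2 * C * ?t))\<bar>"
      by (intro AE_I2) (smt (verit) real_norm_def)
  qed measurable
  have b_lower: "2 * drift * real (Suc n) - 2 * C \<le> b n" for n
  proof -
    have I: "integrable (H i) (\<lambda>\<tau>. gr i \<tau> (real (Suc n)))" for i by (rule gr_integrable) simp
    have "2 * drift * real (Suc n) + (- 2 * C) = 2 * E (\<lambda>i \<tau>. gr i \<tau> (real (Suc n))) +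
        E (\<lambda>_ _. - 2 * C)"
    proof -
      have "E (\<lambda>i \<tau>. gr i \<tau> (real (Suc n))) = drift * real (Suc n)"
        unfolding E_def by (rule mean_growth) simp
      then show ?thesis unfolding E_const by simp
    qed
    also have "\<dots> = E (\<lambda>i \<tau>. 2 * gr i \<tau> (real (Suc n)) + (- 2 * C))"
      unfolding E_cmult[symmetric] using I by (intro E_add[symmetric]) auto
    also have "\<dots> \<le> b n" unfolding b_def
    proof (rule E_mono[OF _ _ b_int])
      fix i \<tau>
      show "2 * gr i \<tau> (real (Suc n)) + (- 2 * C) \<le> ln (ms i \<tau> (real (Suc n)))"
        using ms_lower[of i \<tau> n] ms_pos[of i \<tau> n] by (subst ln_ge_iff) auto
    qed (use I in auto)
    finally show ?thesis by simp
  qed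
  have b_step: "b (Suc n) \<le> b n + 2 * exp (2 * C) * E (ratio (Suc n))" for n
  proof -
    have "b (Suc n) \<le> E (\<lambda>i \<tau>. ln (ms i \<tau> (real (Suc n))) + 2 * exp (2 * C) * ratio (Suc n) i \<tau>)"
      unfolding b_def
    proof (rule E_mono[OF _ b_int])
      fix i \<tau>
      let ?J = "ms i \<tau> (real (Suc n))" and ?x = "exp (2 * gr i \<tau> (real (Suc n))) * exp (2 * C)"
      have "ln (ms i \<tau> (real (Suc (Suc n)))) \<le> ln (?J + ?x)"
        using ms_step[of i \<tau> "Suc n"] ms_pos[of i \<tau> "Suc n"] by (intro ln_mono) (simp_all only:)
      also have "?J + ?x = ?J * (1 + ?x / ?J)" using ms_pos[of i \<tau> n] by (simp add: field_simps)
      also have "ln \<dots> = ln ?J + ln (1 + ?x / ?J)"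
        using ms_pos[of i \<tau> n] by (intro ln_mult_pos) (auto intro!: add_pos_pos divide_pos_pos)
      also have "ln (1 + ?x / ?J) \<le> ?x / ?J" using ms_pos[of i \<tau> n]
          by (intro ln_add_one_self_le_self) auto
      also have "?x / ?J = 2 * exp (2 * C) * ratio (Suc n) i \<tau>" by (simp add: ratio_def)
      finally show "ln (ms i \<tau> (real (Suc (Suc n)))) \<le> ln ?J + 2 * exp (2 * C) * ratio (Suc n) i \<tau>"
          by simp
    qed (intro Bochner_Integration.integrable_add b_int integrable_mult_right ratio_int)
    also have "\<dots> = b n + 2 * exp (2 * C) * E (ratio (Suc n))"
      unfolding b_def E_cmult[symmetric] by (intro E_add b_int integrable_mult_right ratio_int)
    finally show ?thesis .
  qed
  \<comment> \<open>With this threshold each further step adds at most \<open>drift\<close> to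
    \<open>b\<close>, half of what the lower bound demands.\<close>
  have "\<forall>\<^sub>F n in sequentially. E (ratio (Suc n)) < drift / (2 * exp (2 * C))"
    using drift by (intro order_tendstoD[OF ratio_lim]) auto
  then obtain N where N: "\<And>n. N \<le> n \<Longrightarrow> E (ratio (Suc n)) < drift / (2 * exp (2 * C))"
    by (auto simp: eventually_sequentially)
  have up: "b (N + k) \<le> b N + drift * real k" for k
  proof (induction k)
    case (Suc k)
    have "2 * exp (2 * C) * E (ratio (Suc (N + k))) \<le> 2 * exp (2 * C) * (drift / (2 * exp (2 * C)))"
      using N[of "N + k"] by (intro mult_left_mono) auto
    then have "b (N + Suc k) \<le> b (N + k) + drift" using b_step[of "N + k"] by simp
    then show ?case using Suc.IH by (simp add: algebra_simps)
  qed simp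
  have "drift * real k \<le> b N + 2 * C" for k
  proof -
    have "2 * drift * real (Suc (N + k)) \<ge> 2 * drift * real k" using drift
        by (intro mult_left_mono) auto
    then show ?thesis using b_lower[of "N + k"] up[of k] by simp
  qed
  moreover obtain k where "b N + 2 * C < real k * drift" using reals_Archimedean3[OF drift] by blast
  ultimately show False by (metis mult.commute not_less)
qed

end

subsection \<open>Classification of the fixed points\<close>

lemma mono_tendsto_SUP:
  fixes f :: "real \<Rightarrow> ennreal"
  assumes "\<And>c d. c \<le> d \<Longrightarrow> f c \<le> f d"
  shows "(f \<longlongrightarrow> (SUP c. f c)) at_top"
proof (rule order_tendstoI)
  fix a assume "a < (SUP c. f c)"
  then obtain c where "a < f c" by (auto simp: less_SUP_iff)
  then have "\<And>d. c \<le> d \<Longrightarrow> a < f d" using assms by (meson less_le_trans)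
  then show "\<forall>\<^sub>F d in at_top. a < f d" by (auto simp: eventually_at_top_linorder)
next
  fix a assume "(SUP c. f c) < a"
  then have "f d < a" for d by (meson SUP_upper UNIV_I le_less_trans)
  then show "\<forall>\<^sub>F d in at_top. f d < a" by simp
qed

context switching begin

text \<open>The properties that \<open>law\<close> will have. The total mass is not normalised,
  because the origin and the directions outside a given set do not contribute.\<close>

definition distribution :: "(real \<Rightarrow> int \<Rightarrow> ennreal) \<Rightarrow> bool" where
  "distribution F \<longleftrightarrow> dist_meas F \<and> (\<forall>c k. F c k \<le> 1) \<and> (\<forall>c k. c \<le> 0 \<longrightarrow> F c k = 0) \<and>
    (\<forall>k c d. c \<le> d \<longrightarrow> F c k \<le> F d k) \<and> (\<forall>c k. (\<lambda>m. F (c + 1 / real (Suc m)) k) \<longlonglongrightarrow> F c k) \<and>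
    (\<forall>c k. k \<notin> {-1, 1} \<longrightarrow> F c k = 0)"

lemma distributionD:
  assumes "distribution F"
  shows "dist_meas F" "F c k \<le> 1" "c \<le> 0 \<Longrightarrow> F c k = 0" "c \<le> d \<Longrightarrow> F c k \<le> F d k"
    "(\<lambda>m. F (c + 1 / real (Suc m)) k) \<longlonglongrightarrow> F c k" "k \<notin> {-1, 1} \<Longrightarrow> F c k = 0"
  using assms unfolding distribution_def by blast+

lemma dual_outside: "k \<notin> {-1, 1} \<Longrightarrow> dual t F c k = 0"
proof -
  assume "k \<notin> {-1, 1}"
  then have "indicator {k} (index_path i \<tau> t) = (0 :: ennreal)" if "i \<in> {-1, 1}" for i \<tau>
    using index_path_cases[OF that, of \<tau> t] by (auto simp: indicator_def)
  then show ?thesis by (simp add: dual_def)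
qed

lemma Flim_nonpos: "c \<le> 0 \<Longrightarrow> Flim c k = 0"
proof -
  assume c: "c \<le> 0"
  have "dual 1 F0 c k = 0"
  proof -
    have "c * exp (2 * gr i \<tau> 1) - 2 * ms i \<tau> 1 < 0" for i \<tau>
    proof -
      have "0 < ms i \<tau> 1" using ms_bounds(1)[of 1 i \<tau>] mass_lower_pos[of 1] by linarith
      moreover have "c * exp (2 * gr i \<tau> 1) \<le> 0" using c by (simp add: mult_nonpos_nonneg)
      ultimately show ?thesis by linarith
    qed
    then have "F0 (c * exp (2 * gr i \<tau> 1) - 2 * ms i \<tau> 1) i = 0" for i \<tau>
        by (simp add: F0_def not_le)
    then show ?thesis by (simp add: dual_def)
  qed
  then show ?thesis using Flim_lower[of c k 1] by simp
qed

lemma distribution_Flim: "distribution Flim"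
proof -
  have "Flim c k = 0" if "k \<notin> {-1, 1}" for c k
    using Flim_lower[of c k 0] dual_outside[OF that] by simp
  then show ?thesis
    unfolding distribution_def
    using Flim_measurable Flim_le_1 Flim_nonpos Flim_mono Flim_right_continuous by blast
qed

text \<open>The index component of a fixed point is stationary for the index chain.\<close>
lemma fixed_limit:
  assumes T: "0 < T" and F: "distribution F" and fixed: "\<And>c k. k \<in> {-1, 1} \<Longrightarrow> dual T F c k = F c k"
  obtains \<beta> where "0 \<le> \<beta>" "\<And>k. k \<in> {-1, 1} \<Longrightarrow> \<beta> * \<pi> k \<le> 1" "\<And>k. k \<in> {-1, 1} \<Longrightarrow>
      ((\<lambda>c. F c k) \<longlongrightarrow> ennreal (\<beta> * \<pi> k)) at_top"
    "\<And>c k. k \<in> {-1, 1} \<Longrightarrow> F c k \<le> ennreal (\<beta> * \<pi> k)"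
proof -
  note FD = distributionD[OF F]
  define M where "M k = (SUP c. F c k)" for k
  have M1: "M k \<le> 1" for k unfolding M_def by (intro SUP_least FD(2))
  define m where "m k = enn2real (M k)" for k
  have Mm: "M k = ennreal (m k)" for k
    using le_less_trans[OF M1[of k]] by (simp add: m_def)
  have m0: "0 \<le> m k" for k by (simp add: m_def)
  have lim: "((\<lambda>c. F c k) \<longlongrightarrow> ennreal (m k)) at_top" for k
    unfolding Mm[symmetric] M_def by (rule mono_tendsto_SUP) (rule FD(4))
  have eq: "m k = (\<Sum>i\<in>{-1, 1}. m i * trans T i k)" if k: "k \<in> {-1, 1}" for k
  proof -
    \<comment> \<open>Along \<open>c = n\<close> the arguments \<open>n * a - x\<close> with
      \<open>a > 0\<close> tend to infinity, so \<open>F\<close> may be replaced by its limits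
      \<open>m i\<close>.\<close>
    have "(\<lambda>n. dual T F (real n) k) \<longlonglongrightarrow> dual T (\<lambda>_ i. ennreal (m i)) 0 k"
    proof (rule dual_tendsto)
      fix a x :: real and i :: int assume a: "0 < a"
      have "filterlim (\<lambda>n. - x + a * real n) at_top sequentially"
        using a by (intro filterlim_tendsto_add_at_top[OF tendsto_const]
            filterlim_tendsto_pos_mult_at_top[OF tendsto_const] filterlim_real_sequentially)
      then have "filterlim (\<lambda>n. real n * a - x) at_top sequentially" by (simp add: mult.commute)
      then show "(\<lambda>n. F (real n * a - x) i) \<longlonglongrightarrow> ennreal (m i)"
        by (rule filterlim_compose[OF lim])
    qed (use FD in auto)
    moreover have "(\<lambda>n. dual T F (real n) k) \<longlonglongrightarrow> ennreal (m k)"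
      unfolding fixed[OF k] by (rule filterlim_compose[OF lim filterlim_real_sequentially])
    ultimately have "ennreal (m k) = dual T (\<lambda>_ i. ennreal (m i)) 0 k" using LIMSEQ_unique by blast
    also have "\<dots> = (\<Sum>i\<in>{-1, 1}. ennreal (m i * trans T i k))"
      using T k m0 trans_nonneg by (subst dual_const) (auto simp: ennreal_mult)
    also have "\<dots> = ennreal (\<Sum>i\<in>{-1, 1}. m i * trans T i k)"
      using T m0 trans_nonneg by (intro sum_ennreal mult_nonneg_nonneg) auto
    finally show ?thesis
      using m0 T trans_nonneg by (subst (asm) ennreal_inj) (auto intro!: sum_nonneg
          mult_nonneg_nonneg)
  qed
  define \<beta> where "\<beta> = m (-1) + m 1"
  \<comment> \<open>The transposed transition matrix multiplies the deviation
    \<open>m k - \<beta> * \<pi> k\<close> by \<open>?e < 1\<close>, so a fixed vector has deviation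
    0.\<close>
  have m\<pi>: "m k = \<beta> * \<pi> k" if k: "k \<in> {-1, 1}" for k
  proof -
    let ?e = "exp (- (lm + lp) * T)"
    have "m k = \<beta> * (\<pi> k - \<pi> k * ?e) + m k * ?e"
      using eq[OF k] k by (auto simp: trans_def \<beta>_def algebra_simps)
    then have "(m k - \<beta> * \<pi> k) * (1 - ?e) = 0" by (simp add: algebra_simps)
    moreover have "?e < 1" using T lm lp by (simp add: mult_neg_pos)
    then have "1 - ?e \<noteq> 0" by linarith
    ultimately have "m k - \<beta> * \<pi> k = 0" by (metis mult_eq_0_iff)
    then show ?thesis by simp
  qed
  have \<beta>0: "0 \<le> \<beta>" using m0 by (simp add: \<beta>_def)
  have "F c k \<le> ennreal (\<beta> * \<pi> k)" if "k \<in> {-1, 1}" for c k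
    unfolding m\<pi>[OF that, symmetric] Mm[symmetric] M_def by (rule SUP_upper) simp
  moreover have "((\<lambda>c. F c k) \<longlongrightarrow> ennreal (\<beta> * \<pi> k)) at_top" if "k \<in> {-1, 1}" for k
    using lim[of k] m\<pi>[OF that] by simp
  moreover have "\<beta> * \<pi> k \<le> 1" if "k \<in> {-1, 1}" for k
    using M1[of k] m0[of k] m\<pi>[OF that] by (simp add: Mm)
  ultimately show thesis using \<beta>0 that by blast
qed

lemma dist_le_F0:
  assumes F: "distribution F" and le: "F c k \<le> ennreal (\<beta> * \<pi> k)" and \<beta>: "0 \<le> \<beta>"
  shows "F c k \<le> ennreal \<beta> * F0 c k"
  using le distributionD(3)[OF F, of c k] \<beta> \<pi>_pos[of k]
  by (cases "c \<le> 0") (auto simp: F0_def ennreal_mult less_imp_le)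

lemma drift_eq:
  "(\<Sum>i\<in>{-1, 1}. \<beta> * \<pi> i * (\<integral>\<tau>. gr i \<tau> T \<partial>H i)) = \<beta> * (drift * T)" if "0 \<le> T"
  unfolding mean_growth[OF that, symmetric] by (simp add: algebra_simps)

text \<open>Points where both sides agree exist in each of the intervals between
  \<open>c + 1 / (m + 2)\<close> and \<open>c + 1 / (m + 1)\<close>; monotonicity and right
  continuity carry the equality to \<open>c\<close>.\<close>

lemma AE_eq_right_continuous:
  assumes F: "distribution F" and G: "distribution G" and ae: "AE c in lborel. F c k = a * G c k"
    and a: "a < \<top>"
  shows "F c k = a * G c k"
proof -
  have "\<exists>d. c + 1 / real (Suc (Suc m)) < d \<and> d < c + 1 / real (Suc m) \<and> F d k = a * G d k" for m
  proof (rule ccontr)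
    assume *: "\<not> ?thesis"
    have "AE d in lborel. d \<notin> {c + 1 / real (Suc (Suc m))<..<c + 1 / real (Suc m)}"
      using ae by eventually_elim (use * in auto)
    then have "{c + 1 / real (Suc (Suc m))<..<c + 1 / real (Suc m)} \<in> null_sets lborel"
      by (subst (asm) AE_iff_null_sets[symmetric]) auto
    then have "emeasure lborel {c + 1 / real (Suc (Suc m))<..<c + 1 / real (Suc m)} = 0" by auto
    moreover have "1 / real (Suc (Suc m)) < 1 / real (Suc m)" by (simp add: frac_less2)
    ultimately show False by simp
  qed
  then obtain d where d: "\<And>m. c + 1 / real (Suc (Suc m)) < d m" "\<And>m. d m < c + 1 / real (Suc m)"
      "\<And>m. F (d m) k = a * G (d m) k" by metis
  have lim: "(\<lambda>m. K (d m) k) \<longlonglongrightarrow> K c k" if "distribution K" for K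
  proof (rule tendsto_sandwich)
    note K = distributionD[OF that]
    show "\<forall>\<^sub>F m in sequentially. K (c + 1 / real (Suc (Suc m))) k \<le> K (d m) k"
      using K(4) less_imp_le[OF d(1)] by (intro always_eventually allI) blast
    show "\<forall>\<^sub>F m in sequentially. K (d m) k \<le> K (c + 1 / real (Suc m)) k"
      using K(4) less_imp_le[OF d(2)] by (intro always_eventually allI) blast
    show "(\<lambda>m. K (c + 1 / real (Suc (Suc m))) k) \<longlonglongrightarrow> K c k" by (rule LIMSEQ_Suc[OF K(5)])
    show "(\<lambda>m. K (c + 1 / real (Suc m)) k) \<longlonglongrightarrow> K c k" by (rule K(5))
  qed
  have "(\<lambda>m. a * G (d m) k) \<longlonglongrightarrow> a * G c k" using a by (intro ennreal_tendsto_cmult lim G)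
  then show ?thesis using LIMSEQ_unique[OF lim[OF F]] d(3) by simp
qed

text \<open>By \<open>fixed_limit\<close> the limits at infinity are
  \<open>\<beta> * \<pi> i\<close>, so the drift condition of \<open>fixed_vanish\<close> reads
  \<open>\<beta> * (drift * T) \<le> 0\<close>.\<close>

lemma fixed_zero:
  assumes T: "0 < T" and F: "distribution F" and fixed: "\<And>c k. k \<in> {-1, 1} \<Longrightarrow> dual T F c k = F c k"
    and drift: "drift \<le> 0" and k: "k \<in> {-1, 1}"
  shows "F c k = 0"
proof -
  note FD = distributionD[OF F]
  obtain \<beta> where \<beta>: "0 \<le> \<beta>" and lim: "\<And>k. k \<in> {-1, 1} \<Longrightarrow> ((\<lambda>c. F c k) \<longlongrightarrow> ennreal (\<beta> * \<pi> k)) at_top"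
    using fixed_limit[OF T F fixed] by metis
  have "AE c in lborel. F c k = 0"
  proof (rule fixed_vanish[OF T FD(1,2) _ fixed _ _ k])
    show "F c i = 0" if "c \<le> support_lower T" for c i
    proof (cases "i \<in> {-1, 1}")
      case True
      have "dual T F c i = 0" by (rule dual_support[OF T _ that]) (rule FD(3))
      then show ?thesis using fixed[OF True] by simp
    qed (rule FD(6))
    show "((\<lambda>c. enn2real (F c i)) \<longlongrightarrow> \<beta> * \<pi> i) at_top" if "i \<in> {-1, 1}" for i
      using tendsto_enn2real[OF lim[OF that]] \<beta> \<pi>_pos[of i] by (simp add: less_imp_le)
    show "(\<Sum>i\<in>{-1, 1}. \<beta> * \<pi> i * (\<integral>\<tau>. gr i \<tau> T \<partial>H i)) \<le> 0"
      using T mult_nonneg_nonpos[OF \<beta> mult_nonpos_nonneg[OF drift, of T]] by (subst drift_eq) auto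
  qed
  then have "F c k = 0 * F c k" by (intro AE_eq_right_continuous[OF F F]) auto
  then show ?thesis by simp
qed

text \<open>The limit is \<open>\<beta> * \<pi> k\<close> with \<open>0 < \<beta> \<le> 1\<close>.
  Rescaled by \<open>1 / \<beta>\<close>, \<open>Flim\<close> would be a fixed point still below
  \<open>F0\<close>, and maximality excludes \<open>\<beta> < 1\<close>.\<close>

lemma Flim_limit:
  assumes drift: "0 < drift" and k: "k \<in> {-1, 1}"
  shows "((\<lambda>c. Flim c k) \<longlongrightarrow> ennreal (\<pi> k)) at_top"
proof -
  have fixed: "\<And>c k. k \<in> {-1, 1} \<Longrightarrow> dual 1 Flim c k = Flim c k" by (rule dual_Flim) auto
  obtain \<beta> where \<beta>: "0 \<le> \<beta>" and lim: "\<And>k. k \<in> {-1, 1} \<Longrightarrow> ((\<lambda>c. Flim c k) \<longlongrightarrow> ennreal (\<beta> * \<pi> k)) at_top"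
    and le: "\<And>c k. k \<in> {-1, 1} \<Longrightarrow> Flim c k \<le> ennreal (\<beta> * \<pi> k)"
    using fixed_limit[OF _ distribution_Flim fixed] by (metis zero_less_one)
  have "\<beta> \<noteq> 0" using Flim_not_zero[OF drift] le by fastforce
  then have \<beta>0: "0 < \<beta>" using \<beta> by simp
  define G where "G c k = ennreal (1 / \<beta>) * Flim c k" for c k
  have G1: "G c k \<le> F0 c k" if "k \<in> {-1, 1}" for c k
  proof -
    have "G c k \<le> ennreal (1 / \<beta>) * (ennreal \<beta> * F0 c k)"
      unfolding G_def by (intro mult_left_mono dist_le_F0 distribution_Flim le that \<beta>) auto
    also have "\<dots> = F0 c k" using \<beta>0 by (simp add: mult.assoc[symmetric] ennreal_mult[symmetric])
    finally show ?thesis .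
  qed
  have "G c k \<le> 1 * Flim c k" for c
  proof (rule fixed_le_Flim[of 1, OF _ _ _ _ _ _ k])
    show "dist_meas G" unfolding G_def
      by (intro allI borel_measurable_times_ennreal spec[OF Flim_measurable]) simp
    show "G c k \<le> 1" for c k
    proof (cases "k \<in> {-1, 1}")
      case True
      show ?thesis by (rule order_trans[OF G1[OF True] F0_le_1])
    next
      case False
      then show ?thesis using distributionD(6)[OF distribution_Flim False] by (simp add: G_def)
    qed
    show "dual 1 G c k = G c k" if "k \<in> {-1, 1}" for c k
      unfolding G_def[abs_def] dual_cmult[OF Flim_measurable] fixed[OF that] ..
  qed (use G1 in auto)
  then have "G c k \<le> Flim c k" for c by simp
  moreover have "((\<lambda>c. G c k) \<longlongrightarrow> ennreal (1 / \<beta>) * ennreal (\<beta> * \<pi> k)) at_top"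
    unfolding G_def by (intro ennreal_tendsto_cmult lim k) simp
  ultimately have "ennreal (1 / \<beta>) * ennreal (\<beta> * \<pi> k) \<le> ennreal (\<beta> * \<pi> k)"
    by (intro tendsto_le[OF _ lim[OF k]] always_eventually) auto
  then have "\<pi> k \<le> \<beta> * \<pi> k" using \<beta>0 \<pi>_pos[of k] by (simp add: ennreal_mult[symmetric] less_imp_le)
  moreover have "ennreal (\<beta> * \<pi> k) \<le> ennreal (\<pi> k)"
  proof (rule tendsto_upperbound[OF lim[OF k]])
    have "Flim c k \<le> ennreal (\<pi> k)" for c
      using Flim_le_F0[OF k, of c] by (rule order_trans) (simp add: F0_def indicator_def)
    then show "\<forall>\<^sub>F c in at_top. Flim c k \<le> ennreal (\<pi> k)" by simp
  qed simp
  then have "\<beta> * \<pi> k \<le> \<pi> k" using \<pi>_pos[of k] by (simp add: less_imp_le)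
  ultimately have "\<beta> * \<pi> k = \<pi> k" by simp
  then show ?thesis using lim[OF k] by (simp only:)
qed

text \<open>With \<open>\<beta>\<close> read off at infinity, \<open>\<beta> * Flim - F\<close> is a
  nonnegative fixed point with limits 0, so the drift term in \<open>fixed_vanish\<close> is 0
  although \<open>drift\<close> is positive. This difference need not be monotone, so
  \<open>fixed_vanish\<close> works with limits, and right continuity removes its exceptional null
  set.\<close>

lemma fixed_unique:
  assumes T: "0 < T" and F: "distribution F" and fixed: "\<And>c k. k \<in> {-1, 1} \<Longrightarrow> dual T F c k = F c k"
    and drift: "0 < drift"
  obtains \<beta> where "0 \<le> \<beta>" "\<And>c k. k \<in> {-1, 1} \<Longrightarrow> F c k = ennreal \<beta> * Flim c k"
proof -
  note FD = distributionD[OF F]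
  obtain \<beta> where \<beta>: "0 \<le> \<beta>" and \<beta>1: "\<And>k. k \<in> {-1, 1} \<Longrightarrow> \<beta> * \<pi> k \<le> 1"
    and lim: "\<And>k. k \<in> {-1, 1} \<Longrightarrow> ((\<lambda>c. F c k) \<longlongrightarrow> ennreal (\<beta> * \<pi> k)) at_top"
    and le: "\<And>c k. k \<in> {-1, 1} \<Longrightarrow> F c k \<le> ennreal (\<beta> * \<pi> k)"
    using fixed_limit[OF T F fixed] by metis
  have leF: "F c k \<le> ennreal \<beta> * Flim c k" if "k \<in> {-1, 1}" for c k
    using that by (intro fixed_le_Flim[OF T FD(1) _ _ FD(2) fixed] dist_le_F0[OF F] le \<beta>) auto
  define D where "D c k = ennreal \<beta> * Flim c k - F c k" for c k
  have sum: "ennreal \<beta> * Flim c k = D c k + F c k" if "k \<in> {-1, 1}" for c k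
    unfolding D_def using leF[OF that, of c] by (simp add: diff_add_cancel_ennreal)
  have Dm: "dist_meas D" unfolding D_def
    by (intro allI borel_measurable_minus_ennreal borel_measurable_times_ennreal spec[OF
        Flim_measurable] spec[OF FD(1)]) simp
  have D\<pi>: "ennreal \<beta> * Flim c k \<le> ennreal (\<beta> * \<pi> k)" if "k \<in> {-1, 1}" for c k
  proof -
    have "Flim c k \<le> ennreal (\<pi> k)"
      using Flim_le_F0[OF that, of c] by (rule order_trans) (simp add: F0_def indicator_def)
    then have "ennreal \<beta> * Flim c k \<le> ennreal \<beta> * ennreal (\<pi> k)" by (intro mult_left_mono) auto
    then show ?thesis using \<beta> \<pi>_pos[of k] by (simp add: ennreal_mult less_imp_le)
  qed
  have D1: "D c k \<le> 1" for c k
  proof (cases "k \<in> {-1, 1}")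
    case True
    have "D c k \<le> ennreal \<beta> * Flim c k" unfolding D_def by (rule diff_le_self_ennreal)
    also have "\<dots> \<le> ennreal (\<beta> * \<pi> k)" by (rule D\<pi>[OF True])
    also have "\<dots> \<le> 1" using \<beta>1[OF True] by simp
    finally show ?thesis .
  next
    case False
    then show ?thesis using distributionD(6)[OF distribution_Flim False] by (simp add: D_def)
  qed
  have Dfix: "dual T D c k = D c k" if k: "k \<in> {-1, 1}" for c k
  proof -
    have "dual T D c k + F c k = dual T (\<lambda>c i. D c i + F c i) c k"
      unfolding dual_add[OF Dm FD(1)] fixed[OF k] ..
    also have "\<dots> = dual T (\<lambda>c i. ennreal \<beta> * Flim c i) c k" by (rule dual_cong) (simp add: sum)
    also have "\<dots> = ennreal \<beta> * Flim c k"
      using T k by (simp add: dual_cmult[OF Flim_measurable] dual_Flim)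
    finally have "dual T D c k + F c k = D c k + F c k" using sum[OF k] by simp
    moreover have "F c k \<noteq> \<top>" using FD(2)[of c k] by (auto simp: top_unique)
    ultimately show ?thesis using ennreal_add_left_cancel[of "F c k" "dual T D c k" "D c k"]
        by (simp add: add.commute)
  qed
  have D0: "AE c in lborel. D c k = 0" if k: "k \<in> {-1, 1}" for k
  proof (rule fixed_vanish[OF T Dm D1 _ Dfix _ _ k])
    show "D c i = 0" if "c \<le> support_lower T" for c i
    proof -
      have "dual T Flim c i = 0" by (rule dual_support[OF T Flim_nonpos that])
      then have "Flim c i = 0"
        using dual_Flim[of T i c] T distributionD(6)[OF distribution_Flim, of i c]
            by (cases "i \<in> {-1, 1}") auto
      then show ?thesis by (simp add: D_def)
    qed
    show "((\<lambda>c. enn2real (D c i)) \<longlongrightarrow> 0) at_top" if i: "i \<in> {-1, 1}" for i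
    proof -
      have "((\<lambda>c. ennreal \<beta> * Flim c i - F c i) \<longlongrightarrow> ennreal \<beta> * ennreal (\<pi> i) - ennreal (\<beta> * \<pi> i))
          at_top"
        by (intro tendsto_diff_ennreal ennreal_tendsto_cmult Flim_limit lim drift i) (auto simp:
            ennreal_mult_eq_top_iff)
      moreover have "ennreal \<beta> * ennreal (\<pi> i) - ennreal (\<beta> * \<pi> i) = ennreal 0"
        using \<beta> \<pi>_pos[of i] by (simp add: ennreal_minus less_imp_le flip: ennreal_mult)
      ultimately have "((\<lambda>c. D c i) \<longlongrightarrow> ennreal 0) at_top"
        unfolding D_def by (simp only:)
      from tendsto_enn2real[OF this] show ?thesis by simp
    qed
  qed auto
  then have "AE c in lborel. F c k = ennreal \<beta> * Flim c k" if k: "k \<in> {-1, 1}" for k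
  proof -
    show ?thesis using D0[OF k] by eventually_elim (simp add: sum[OF k])
  qed
  then have "F c k = ennreal \<beta> * Flim c k" if "k \<in> {-1, 1}" for c k
    using that by (intro AE_eq_right_continuous[OF F distribution_Flim]) auto
  then show thesis using \<beta> that by blast
qed

end

subsection \<open>Measures on the state space\<close>

lemma space_state_space: "space (state_space S) = S \<times> {-1, 1}"
  by (simp add: state_space_def space_pair_measure space_restrict_space)

lemma sets_state_space_UNIV: "sets (state_space UNIV) = sets (borel \<Otimes>\<^sub>M count_space {-1, 1})"
  unfolding state_space_def by (rule sets_pair_measure_cong) (auto simp: sets_restrict_space)

lemma state_space_measurable_fst:
  "(\<lambda>z. fst z) \<in> state_space S \<rightarrow>\<^sub>M borel"
  unfolding state_space_def
  by (rule measurable_compose[OF measurable_fst]) (simp add: measurable_restrict_space1)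

lemma state_space_measurable_snd: "(\<lambda>z. snd z) \<in> state_space S \<rightarrow>\<^sub>M count_space {-1, 1}"
  unfolding state_space_def by simp

text \<open>The function \<open>F\<close> of the overview, restricted to directions in
  \<open>B\<close>. The origin never counts, even if \<open>sgn 0 = 0\<close> lies in
  \<open>B\<close>, because \<open>1 \<le> c * 0\<close> fails.\<close>

definition law :: "('a::real_normed_vector \<times> int) measure \<Rightarrow> 'a set \<Rightarrow> real \<Rightarrow> int \<Rightarrow> ennreal" where
  "law \<mu> B c k = emeasure \<mu> {z \<in> space \<mu>. sgn (fst z) \<in> B \<and> 1 \<le> c * (norm (fst z))\<^sup>2 \<and> snd z = k}"

lemma law_sets:
  fixes S :: "'a::euclidean_space set"
  assumes \<mu>: "sets \<mu> = sets (state_space S)" and [measurable]: "B \<in> sets borel"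
  shows "{z \<in> space \<mu>. sgn (fst z) \<in> B \<and> 1 \<le> c * (norm (fst z))\<^sup>2 \<and> snd z = k} \<in> sets \<mu>"
proof -
  have [measurable]: "(\<lambda>z. fst z) \<in> \<mu> \<rightarrow>\<^sub>M borel" "(\<lambda>z. snd z) \<in> \<mu> \<rightarrow>\<^sub>M count_space {-1, 1}"
    using state_space_measurable_fst[of S] state_space_measurable_snd[of S] measurable_cong_sets[OF
        \<mu> refl] by blast+
  have [measurable]: "(sgn :: 'a \<Rightarrow> 'a) \<in> borel_measurable borel"
    unfolding sgn_div_norm[abs_def] by measurable
  show ?thesis by measurable
qed

text \<open>The boxes generate the product sigma-algebra and are stable under intersection; boxes
  with different \<open>k\<close> meet in the box with \<open>B = {}\<close>.\<close>

lemma distribution_generator: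
  fixes \<rho>1 \<rho>2 :: "('a::euclidean_space \<times> real \<times> int) measure"
  assumes s1: "sets \<rho>1 = sets (borel \<Otimes>\<^sub>M borel \<Otimes>\<^sub>M count_space {-1, 1})"
    and s2: "sets \<rho>2 = sets (borel \<Otimes>\<^sub>M borel \<Otimes>\<^sub>M count_space {-1, 1})"
    and fin: "finite_measure \<rho>1"
    and eq: "\<And>B c k. B \<in> sets borel \<Longrightarrow> k \<in> {-1, 1} \<Longrightarrow> emeasure \<rho>1 (B \<times> {..c} \<times> {k}) =
        emeasure \<rho>2 (B \<times> {..c} \<times> {k})"
  shows "\<rho>1 = \<rho>2"
proof -
  interpret finite_measure \<rho>1 by fact
  let ?I = "{-1, 1} :: int set"
  let ?Eb = "{a \<times> b | a b. a \<in> range atMost \<and> b \<in> {{-1}, {1}}} :: (real \<times> int) set set"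
  let ?E = "{a \<times> b | a b. a \<in> sets (borel :: 'a measure) \<and> b \<in> ?Eb}"
  let ?\<Omega> = "UNIV \<times> UNIV \<times> ?I :: ('a \<times> real \<times> int) set"
  have un: "(\<Union>n. {..real n}) = (UNIV :: real set)"
    by (auto intro: real_arch_simple)
  have inner: "sets (borel \<Otimes>\<^sub>M count_space ?I) = sets (sigma (space (borel :: real measure) \<times> space
      (count_space ?I)) ?Eb)"
  proof (rule sets_pair_eq)
    show "sets (borel :: real measure) = sigma_sets (space borel) (range atMost)"
      by (subst borel_eq_atMost) (simp add: sets_measure_of_conv)
    show "sets (count_space ?I) = sigma_sets (space (count_space ?I)) {{-1}, {1}}"
    proof
      show "sets (count_space ?I) \<subseteq> sigma_sets (space (count_space ?I)) {{-1}, {1}}"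
      proof
        fix A assume "A \<in> sets (count_space ?I)"
        then have "A \<subseteq> ?I" by simp
        then have "A = {} \<or> A = {-1} \<or> A = {1} \<or> A = ?I" by blast
        moreover have "?I \<in> sigma_sets (space (count_space ?I)) {{-1}, {1}}"
          using sigma_sets_top[of "space (count_space ?I)"] by simp
        moreover have "{-1} \<in> sigma_sets (space (count_space ?I)) {{-1}, {1}}" "{1} \<in>
            sigma_sets (space (count_space ?I)) {{-1}, {1}}"
          "{} \<in> sigma_sets (space (count_space ?I)) {{-1}, {1}}"
          by (auto intro: sigma_sets.Empty sigma_sets.Basic)
        ultimately show "A \<in> sigma_sets (space (count_space ?I)) {{-1}, {1}}"
          by (elim disjE) (simp_all only:)
      qed
      show "sigma_sets (space (count_space ?I)) {{-1}, {1}} \<subseteq> sets (count_space ?I)"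
        by (intro sets.sigma_sets_subset') auto
    qed
    show "countable (range (\<lambda>n::nat. {..real n}))" "range (\<lambda>n::nat. {..real n}) \<subseteq> range atMost"
      "\<Union> (range (\<lambda>n::nat. {..real n})) = space borel"
      using un by auto
    show "countable {{-1}, {1::int}}" "{{-1}, {1::int}} \<subseteq> {{-1}, {1}}" "\<Union> {{-1}, {1::int}} =
        space (count_space ?I)"
      by auto
  qed auto
  have Ebs: "?Eb \<subseteq> Pow (space (borel \<Otimes>\<^sub>M count_space ?I))" by (auto simp: space_pair_measure)
  have outer: "sets (borel \<Otimes>\<^sub>M borel \<Otimes>\<^sub>M count_space ?I) =
      sets (sigma (space (borel :: 'a measure) \<times> space (borel \<Otimes>\<^sub>M count_space ?I)) ?E)"
  proof (rule sets_pair_eq)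
    show "sets (borel :: 'a measure) = sigma_sets (space borel) (sets borel)"
        by (rule sets.sigma_sets_eq[symmetric])
    show "?Eb \<subseteq> Pow (space (borel \<Otimes>\<^sub>M count_space ?I))" by (rule Ebs)
    show "sets (borel \<Otimes>\<^sub>M count_space ?I) = sigma_sets (space (borel \<Otimes>\<^sub>M count_space ?I)) ?Eb"
      using Ebs unfolding inner by (simp add: space_pair_measure)
    let ?C = "(\<lambda>(n::nat, k::int). {..real n} \<times> {k}) ` (UNIV \<times> ?I)"
    show "countable ?C" by (intro countable_image) auto
    show "?C \<subseteq> ?Eb" by auto
    show "\<Union> ?C = space (borel \<Otimes>\<^sub>M count_space ?I)"
      by (auto simp: space_pair_measure intro: real_arch_simple)
    show "countable {UNIV :: 'a set}" "{UNIV} \<subseteq> sets (borel :: 'a measure)" "\<Union> {UNIV} =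
        space (borel :: 'a measure)"
      by auto
  qed auto
  let ?A = "\<lambda>n::nat. UNIV \<times> {..real n} \<times> {-1 :: int}"
  have \<Omega>: "space (borel :: 'a measure) \<times> space (borel \<Otimes>\<^sub>M count_space ?I) = ?\<Omega>"
      by (simp add: space_pair_measure)
  have E\<Omega>: "?E \<subseteq> Pow ?\<Omega>" by auto
  have gen: "sets \<rho>1 = sigma_sets ?\<Omega> ?E" "sets \<rho>2 = sigma_sets ?\<Omega> ?E"
    using E\<Omega> unfolding s1 s2 outer \<Omega> by (simp_all add: sets_measure_of_conv)
  let ?C = "(\<lambda>(n::nat, k::int). UNIV \<times> {..real n} \<times> {k}) ` (UNIV \<times> ?I) :: ('a \<times> real \<times> int) set set"
  have E: "B \<times> {..c} \<times> {k} \<in> ?E" if "B \<in> sets borel" "k \<in> ?I" for B :: "'a set" and c k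
  proof -
    have "{..c} \<times> {k} \<in> ?Eb"
      using that(2) by (intro CollectI exI[of _ "{..c}"] exI[of _ "{k}"]) auto
    with that(1) show ?thesis by blast
  qed
  show ?thesis
  proof (rule measure_eqI_generator_eq_countable[where E = ?E and \<Omega> = ?\<Omega> and A = ?C])
    show "Int_stable ?E"
    proof (rule Int_stableI)
      fix X Y assume "X \<in> ?E" "Y \<in> ?E"
      obtain B c k where X: "X = B \<times> {..c} \<times> {k}" "B \<in> sets borel" "k \<in> ?I"
        using \<open>X \<in> ?E\<close> by auto
      obtain B' c' k' where Y: "Y = B' \<times> {..c'} \<times> {k'}" "B' \<in> sets borel" "k' \<in> ?I"
        using \<open>Y \<in> ?E\<close> by auto
      show "X \<inter> Y \<in> ?E"
      proof (cases "k = k'")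
        case True
        have "X \<inter> Y = (B \<inter> B') \<times> {..min c c'} \<times> {k}" using X Y True by auto
        then show ?thesis using E[of "B \<inter> B'" k "min c c'"] X(2,3) Y(2) by (simp only: sets.Int)
      next
        case False
        have "X \<inter> Y = {} \<times> {..c} \<times> {k}" using X Y False by auto
        then show ?thesis using E[of "{}" k c] X(3) by (simp only: sets.empty_sets)
      qed
    qed
    show "emeasure \<rho>1 X = emeasure \<rho>2 X" if "X \<in> ?E" for X using that eq by auto
    show "countable ?C" by (intro countable_image) auto
    show "?C \<subseteq> ?E"
    proof
      fix X assume "X \<in> ?C"
      then obtain n k where "X = UNIV \<times> {..real n} \<times> {k}" "k \<in> ?I" by auto
      then show "X \<in> ?E" using E[of UNIV k "real n"] by (simp only: sets.top space_borel[symmetric])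
    qed
    show "\<Union> ?C = ?\<Omega>" by (auto intro: real_arch_simple)
  qed (use gen E\<Omega> in auto)
qed

text \<open>Off the origin a state can be recovered measurably from its direction,
  \<open>1 / |x|^2\<close> and its index. In these coordinates the box
  \<open>B \<times> {..c} \<times> {k}\<close> has mass \<open>law \<mu> B c k\<close>, and mass 0
  if \<open>c \<le> 0\<close>.\<close>

lemma law_determines:
  fixes S :: "'a::euclidean_space set"
  assumes S: "S \<in> sets borel" "s0 \<in> S"
    and s1: "sets \<mu>1 = sets (state_space S)" and s2: "sets \<mu>2 = sets (state_space S)"
    and fin: "finite_measure \<mu>1"
    and z1: "AE z in \<mu>1. fst z \<noteq> 0" and z2: "AE z in \<mu>2. fst z \<noteq> 0"
    and eq: "\<And>B c k. B \<in> sets borel \<Longrightarrow> k \<in> {-1, 1} \<Longrightarrow> 0 < c \<Longrightarrow> law \<mu>1 B c k = law \<mu>2 B c k"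
  shows "\<mu>1 = \<mu>2"
proof -
  define g :: "'a \<times> int \<Rightarrow> 'a \<times> real \<times> int" where "g z = (sgn (fst z), 1 / (norm (fst z))\<^sup>2, snd z)"
      for z
  define f :: "'a \<times> real \<times> int \<Rightarrow> 'a" where "f y = (1 / sqrt (fst (snd y))) *\<^sub>R fst y" for y
  \<comment> \<open>The left inverse of \<open>g\<close> off the origin; the default
    \<open>s0\<close> only ensures that all values lie in \<open>S\<close>.\<close>
  define h :: "'a \<times> real \<times> int \<Rightarrow> 'a \<times> int" where "h y = (if f y \<in> S then f y else s0, snd (snd y))"
      for y
  let ?N = "borel \<Otimes>\<^sub>M borel \<Otimes>\<^sub>M count_space {-1, 1} :: ('a \<times> real \<times> int) measure"
  have [measurable]: "(sgn :: 'a \<Rightarrow> 'a) \<in> borel_measurable borel"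
    unfolding sgn_div_norm[abs_def] by measurable
  have g: "g \<in> \<mu> \<rightarrow>\<^sub>M ?N" if "sets \<mu> = sets (state_space S)" for \<mu>
  proof -
    have [measurable]: "(\<lambda>z. fst z) \<in> \<mu> \<rightarrow>\<^sub>M borel" "(\<lambda>z. snd z) \<in> \<mu> \<rightarrow>\<^sub>M count_space {-1, 1}"
      using state_space_measurable_fst[of S] state_space_measurable_snd[of S]
          measurable_cong_sets[OF that refl] by blast+
    show ?thesis unfolding g_def by measurable
  qed
  have hg: "h (g z) = z" if "fst z \<noteq> 0" "fst z \<in> S" for z
    using that by (cases z) (simp add: h_def f_def g_def real_sqrt_divide sgn_div_norm)
  have h: "h \<in> ?N \<rightarrow>\<^sub>M state_space S"
  proof -
    have [measurable]: "f \<in> ?N \<rightarrow>\<^sub>M borel" unfolding f_def[abs_def] by measurable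
    note [measurable] = S(1)
    have "(\<lambda>y. if f y \<in> S then f y else s0) \<in> ?N \<rightarrow>\<^sub>M restrict_space borel S"
      using S(2) by (intro measurable_restrict_space2) auto
    then show ?thesis unfolding state_space_def h_def[abs_def] by measurable
  qed
  have rho: "emeasure (distr \<mu> ?N g) (B \<times> {..c} \<times> {k}) = (if 0 < c then law \<mu> B c k else 0)"
    if s: "sets \<mu> = sets (state_space S)" and z: "AE z in \<mu>. fst z \<noteq> 0" and B: "B \<in> sets borel"
        and k: "k \<in> {-1, 1}" for \<mu> B c k
  proof -
    let ?L = "{z \<in> space \<mu>. sgn (fst z) \<in> B \<and> 1 \<le> c * (norm (fst z))\<^sup>2 \<and> snd z = k}"
    have X: "B \<times> {..c} \<times> {k} \<in> sets ?N" using B k by (intro pair_measureI) auto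
    have "emeasure (distr \<mu> ?N g) (B \<times> {..c} \<times> {k}) = emeasure \<mu> (g -` (B \<times> {..c} \<times> {k}) \<inter> space \<mu>)"
      by (rule emeasure_distr[OF g[OF s] X])
    also have "\<dots> = emeasure \<mu> ?L"
    proof (rule emeasure_eq_AE)
      show "AE z in \<mu>. (z \<in> g -` (B \<times> {..c} \<times> {k}) \<inter> space \<mu>) = (z \<in> ?L)"
        using z by eventually_elim (auto simp: g_def divide_le_eq mult.commute)
      show "g -` (B \<times> {..c} \<times> {k}) \<inter> space \<mu> \<in> sets \<mu>" using g[OF s] X by (rule measurable_sets)
      show "?L \<in> sets \<mu>" by (rule law_sets[OF s B])
    qed
    also have "\<dots> = (if 0 < c then law \<mu> B c k else 0)"
    proof (cases "0 < c")
      case False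
      then have "\<not> 1 \<le> c * (norm x)\<^sup>2" for x :: 'a
        by (metis mult_nonpos_nonneg not_less not_one_le_zero order_trans zero_le_power2)
      then show ?thesis using False by simp
    qed (simp add: law_def)
    finally show ?thesis .
  qed
  have "distr \<mu>1 ?N g = distr \<mu>2 ?N g"
  proof (rule distribution_generator)
    show "finite_measure (distr \<mu>1 ?N g)" by (intro finite_measure.finite_measure_distr fin g s1)
    fix B :: "'a set" and c and k :: int assume "B \<in> sets borel" "k \<in> {-1, 1}"
    then show "emeasure (distr \<mu>1 ?N g) (B \<times> {..c} \<times> {k}) = emeasure (distr \<mu>2 ?N g) (B \<times> {..c} \<times>
        {k})"
      using eq rho[OF s1 z1] rho[OF s2 z2] by simp
  qed auto
  moreover have "emeasure \<mu> A = emeasure (distr \<mu> ?N g) (h -` A \<inter> space ?N)"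
    if s: "sets \<mu> = sets (state_space S)" and z: "AE z in \<mu>. fst z \<noteq> 0" and A: "A \<in> sets \<mu>" for \<mu> A
  proof -
    have X: "h -` A \<inter> space ?N \<in> sets ?N" using h A s by (auto intro: measurable_sets)
    have "emeasure (distr \<mu> ?N g) (h -` A \<inter> space ?N) = emeasure \<mu> (g -` (h -` A \<inter> space ?N) \<inter> space
        \<mu>)"
      by (rule emeasure_distr[OF g[OF s] X])
    also have "\<dots> = emeasure \<mu> A"
    proof (rule emeasure_eq_AE)
      have "AE z in \<mu>. z \<in> space \<mu>" by simp
      then show "AE z in \<mu>. (z \<in> g -` (h -` A \<inter> space ?N) \<inter> space \<mu>) = (z \<in> A)"
        using z
      proof eventually_elim
        case (elim z)
        then have "fst z \<in> S" "g z \<in> space ?N"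
          using sets_eq_imp_space_eq[OF s] measurable_space[OF g[OF s]]
              by (auto simp: space_state_space)
        then show ?case using elim hg[of z] by auto
      qed
      show "g -` (h -` A \<inter> space ?N) \<inter> space \<mu> \<in> sets \<mu>" using g[OF s] X by (rule measurable_sets)
    qed (rule A)
    finally show ?thesis ..
  qed
  ultimately show ?thesis
    using s1 s2 z1 z2 by (intro measure_eqI) auto
qed

context switching begin

subsection \<open>The transition kernels\<close>

text \<open>A common frame for the half-line without angular motion and the plane with
  \<open>rot\<close>. Homogeneity and preservation of the norm let the angular motion commute with
  \<open>sgn\<close> and with the radial factor.\<close>

definition admissible :: "'a::euclidean_space set \<Rightarrow> (real \<Rightarrow> 'a \<Rightarrow> 'a) \<Rightarrow> bool" where
  "admissible S R \<longleftrightarrow> S \<in> sets borel \<and> S \<noteq> {} \<and> (\<forall>t. R t \<in> borel_measurable borel) \<and>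
    (\<forall>t x. norm (R t x) = norm x) \<and> (\<forall>t x c. R t (c *\<^sub>R x) = c *\<^sub>R R t x) \<and>
    (\<forall>t x c. x \<in> S \<longrightarrow> 0 < c \<longrightarrow> c *\<^sub>R R t x \<in> S)"

definition evolve :: "(real \<Rightarrow> 'a \<Rightarrow> 'a) \<Rightarrow> real \<Rightarrow> int \<Rightarrow> 'a::euclidean_space \<Rightarrow> (nat \<Rightarrow> real) \<Rightarrow> 'a \<times> int"
    where
  "evolve R t i x \<tau> = (gain (gr i \<tau> t) (ms i \<tau> t) ((norm x)\<^sup>2) *\<^sub>R R t x, index_path i \<tau> t)"

definition kernel :: "'a::euclidean_space set \<Rightarrow> (real \<Rightarrow> 'a \<Rightarrow> 'a) \<Rightarrow> real \<Rightarrow> 'a \<times> int \<Rightarrow> ('a \<times> int)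
    measure" where
  "kernel S R t = (\<lambda>(x, i). distr (H i) (state_space S) (evolve R t i x))"

lemma admissible_radial: "admissible {0<..} (\<lambda>_ x :: real. x)"
  by (simp add: admissible_def)

lemma admissible_planar: "admissible UNIV rot"
proof -
  have "rot t \<in> borel_measurable borel" for t
  proof (rule borel_measurable_continuous_onI)
    show "continuous_on UNIV (rot t)"
      unfolding rot_def case_prod_beta by (intro continuous_intros)
  qed
  then show ?thesis by (simp add: admissible_def rot_scaleR)
qed

lemma radial_pdmp_eq_kernel:
  assumes t: "0 \<le> t" and z: "z \<in> space (state_space {0<..})"
  shows "radial_pdmp pm pp lm lp t z = kernel {0<..} (\<lambda>_ x. x) t z"
proof -
  obtain x i where zx: "z = (x, i)" "0 < x" using z by (cases z) (auto simp: space_state_space)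
  have "position {0<..} (by_index (radial_field pm) (radial_field pp)) (index_path i \<tau>) x t
      = gain (gr i \<tau> t) (ms i \<tau> t) (x\<^sup>2) * x" for \<tau>
    using t zx by (intro position_radial almost_step_index_path) auto
  then show ?thesis
    by (simp add: zx radial_pdmp_def pdmp_def kernel_def evolve_def[abs_def] flip: q_def)
qed

text \<open>The formula for \<open>position\<close> holds for every sequence of holding times, so
  the two image measures come from the same map.\<close>

lemma planar_pdmp_eq_kernel:
  assumes t: "0 \<le> t"
  shows "planar_pdmp pm pp lm lp t z = kernel UNIV rot t z"
proof -
  obtain x i where zx: "z = (x, i)" by (cases z)
  have "position UNIV (by_index (planar_field pm) (planar_field pp)) (index_path i \<tau>) x t
      = gain (gr i \<tau> t) (ms i \<tau> t) ((norm x)\<^sup>2) *\<^sub>R rot t x" for \<tau>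
    using t by (intro position_planar almost_step_index_path) auto
  then show ?thesis
    by (simp add: zx planar_pdmp_def pdmp_def kernel_def evolve_def[abs_def] flip: q_def)
qed

context
  fixes S :: "'a::euclidean_space set" and R :: "real \<Rightarrow> 'a \<Rightarrow> 'a"
  assumes adm: "admissible S R"
begin

lemma S_borel [measurable]: "S \<in> sets borel" and S_nonempty: "S \<noteq> {}"
  and R_measurable [measurable]: "R t \<in> borel_measurable borel"
      and norm_R [simp]: "norm (R t x) = norm x"
  and R_scaleR: "R t (c *\<^sub>R x) = c *\<^sub>R R t x"
  and R_closed: "x \<in> S \<Longrightarrow> 0 < c \<Longrightarrow> c *\<^sub>R R t x \<in> S"
  using adm by (auto simp: admissible_def)

lemma gain_pos': "0 \<le> t \<Longrightarrow> 0 < gain (gr i \<tau> t) (ms i \<tau> t) ((norm x)\<^sup>2)"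
  by (intro gain_pos ms_nonneg) auto

lemma evolve_measurable:
  assumes t: "0 \<le> t" and i: "i \<in> {-1, 1}"
  shows "(\<lambda>(x, \<tau>). evolve R t i x \<tau>) \<in> restrict_space borel S \<Otimes>\<^sub>M H i \<rightarrow>\<^sub>M state_space S"
proof -
  let ?N = "restrict_space borel S \<Otimes>\<^sub>M H i"
  have [measurable]: "(\<lambda>z. fst z) \<in> ?N \<rightarrow>\<^sub>M borel"
    by (rule measurable_compose[OF measurable_fst]) (simp add: measurable_restrict_space1)
  have sp: "fst z \<in> S" if "z \<in> space ?N" for z
    using that by (auto simp: space_pair_measure space_restrict_space)
  have "(\<lambda>z. gain (gr i (snd z) t) (ms i (snd z) t) ((norm (fst z))\<^sup>2) *\<^sub>R R t (fst z)) \<in>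
      ?N \<rightarrow>\<^sub>M restrict_space borel S"
    by (intro measurable_restrict_space2 Pi_I R_closed[OF sp gain_pos'[OF t]]) measurable
  moreover have "(\<lambda>z. index_path i (snd z) t) \<in> ?N \<rightarrow>\<^sub>M count_space {-1, 1}"
  proof -
    have "(\<lambda>z. index_path i (snd z) t) \<in> ?N \<rightarrow>\<^sub>M restrict_space (count_space UNIV) {-1, 1}"
      using index_path_cases[OF i] by (intro measurable_restrict_space2) auto
    then show ?thesis by (simp add: restrict_count_space)
  qed
  ultimately show ?thesis unfolding state_space_def evolve_def case_prod_beta by measurable
qed

lemma evolve_measurable':
  assumes t: "0 \<le> t" and z: "(x, i) \<in> space (state_space S)"
  shows "evolve R t i x \<in> H i \<rightarrow>\<^sub>M state_space S"
proof -
  have "(\<lambda>\<tau>. (x, \<tau>)) \<in> H i \<rightarrow>\<^sub>M restrict_space borel S \<Otimes>\<^sub>M H i"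
    using z by (intro measurable_Pair) (auto simp: space_state_space space_restrict_space)
  from measurable_compose[OF this evolve_measurable[OF t]] show ?thesis
    using z by (simp add: space_state_space)
qed

lemma kernel_measurable:
  assumes t: "0 \<le> t"
  shows "kernel S R t \<in> state_space S \<rightarrow>\<^sub>M subprob_algebra (state_space S)"
proof -
  have f: "(\<lambda>x. distr (H i) (state_space S) (evolve R t i x)) \<in>
      restrict_space borel S \<rightarrow>\<^sub>M subprob_algebra (state_space S)"
    if "i \<in> {-1, 1}" for i
  proof (rule measurable_distr2[OF evolve_measurable[OF t that]])
    have "H i \<in> space (subprob_algebra (H i))"
      by (auto simp: space_subprob_algebra intro: H.subprob_space_axioms)
    then show "(\<lambda>x. H i) \<in> restrict_space borel S \<rightarrow>\<^sub>M subprob_algebra (H i)"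
        by (rule measurable_const)
  qed
  have "(\<lambda>z. distr (H (snd z)) (state_space S) (evolve R t (snd z) (fst z))) \<in>
      state_space S \<rightarrow>\<^sub>M subprob_algebra (state_space S)"
  proof (rule measurable_compose_countable'[where f = "\<lambda>i z. distr (H i) (state_space S) (evolve R t
      i (fst z))" and I = "{-1, 1}"])
    show "(\<lambda>z. distr (H i) (state_space S) (evolve R t i (fst z))) \<in>
        state_space S \<rightarrow>\<^sub>M subprob_algebra (state_space S)"
      if "i \<in> {-1, 1}" for i
      by (rule measurable_compose[OF _ f[OF that]]) (simp add: state_space_def)
  qed (auto simp: state_space_measurable_snd)
  then show ?thesis by (simp add: kernel_def case_prod_beta)
qed

lemma kernel_prob_space:
  assumes t: "0 \<le> t" and z: "z \<in> space (state_space S)"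
  shows "prob_space (kernel S R t z)"
  using evolve_measurable'[OF t, of "fst z" "snd z"] z
  by (cases z) (simp add: kernel_def H.prob_space_distr)

lemma sets_kernel [simp]: "sets (kernel S R t z) = sets (state_space S)"
  by (cases z) (simp add: kernel_def)

lemma emeasure_kernel:
  assumes t: "0 \<le> t" and z: "z \<in> space (state_space S)" and X: "X \<in> sets (state_space S)"
  shows "emeasure (kernel S R t z) X = (\<integral>\<^sup>+\<tau>. indicator X (evolve R t (snd z) (fst z) \<tau>) \<partial>H (snd z))"
proof -
  have m: "evolve R t (snd z) (fst z) \<in> H (snd z) \<rightarrow>\<^sub>M state_space S"
    using evolve_measurable'[OF t] z by simp
  have "emeasure (kernel S R t z) X = (\<integral>\<^sup>+y. indicator X y \<partial>kernel S R t z)" using X by simp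
  also have "\<dots> = (\<integral>\<^sup>+\<tau>. indicator X (evolve R t (snd z) (fst z) \<tau>) \<partial>H (snd z))"
    unfolding kernel_def case_prod_beta using X by (intro nn_integral_distr m) auto
  finally show ?thesis .
qed

context
  fixes \<mu> :: "('a \<times> int) measure"
  assumes \<mu>: "prob_space \<mu>" and sets_\<mu>: "sets \<mu> = sets (state_space S)"
begin

lemma space_\<mu>: "space \<mu> = S \<times> {-1, 1}"
  using sets_eq_imp_space_eq[OF sets_\<mu>] by (simp add: space_state_space)

lemma fst_measurable_\<mu> [measurable]: "(\<lambda>z. fst z) \<in> \<mu> \<rightarrow>\<^sub>M borel"
  and snd_measurable_\<mu> [measurable]: "(\<lambda>z. snd z) \<in> \<mu> \<rightarrow>\<^sub>M count_space {-1, 1}"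
  using state_space_measurable_fst[of S] state_space_measurable_snd[of S] measurable_cong_sets[OF
      sets_\<mu> refl] by blast+

lemma sgn_measurable: "(sgn :: 'a \<Rightarrow> 'a) \<in> borel_measurable borel"
  unfolding sgn_div_norm[abs_def] by measurable

lemma kernel_measurable_\<mu>: "0 \<le> t \<Longrightarrow> kernel S R t \<in> \<mu> \<rightarrow>\<^sub>M subprob_algebra (state_space S)"
  using kernel_measurable measurable_cong_sets[OF sets_\<mu> refl] by blast

lemma emeasure_bind_kernel:
  assumes t: "0 \<le> t" and X: "X \<in> sets (state_space S)"
  shows "emeasure (\<mu> \<bind> kernel S R t) X = (\<integral>\<^sup>+z. emeasure (kernel S R t z) X \<partial>\<mu>)"
  using S_nonempty space_\<mu> by (intro emeasure_bind[OF _ kernel_measurable_\<mu>[OF t] X]) auto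

lemma sets_bind_kernel: "0 \<le> t \<Longrightarrow> sets (\<mu> \<bind> kernel S R t) = sets (state_space S)"
  using S_nonempty space_\<mu> by (intro sets_bind) auto

lemma prob_space_bind_kernel: "0 \<le> t \<Longrightarrow> prob_space (\<mu> \<bind> kernel S R t)"
  using kernel_prob_space space_\<mu>
  by (intro prob_space.prob_space_bind[OF \<mu> AE_I2 kernel_measurable_\<mu>]) (auto simp:
      space_state_space)

lemma distribution_law:
  assumes B: "B \<in> sets borel"
  shows "distribution (law \<mu> B)"
proof -
  interpret prob_space \<mu> by (rule \<mu>)
  let ?L = "\<lambda>c k. {z \<in> space \<mu>. sgn (fst z) \<in> B \<and> 1 \<le> c * (norm (fst z))\<^sup>2 \<and> snd z = k}"
  have s: "?L c k \<in> sets \<mu>" for c k by (rule law_sets[OF sets_\<mu> B])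
  have mono: "law \<mu> B c k \<le> law \<mu> B d k" if "c \<le> d" for c d k
  proof -
    have "c * (norm x)\<^sup>2 \<le> d * (norm x)\<^sup>2" for x :: 'a using that by (intro mult_right_mono) auto
    then have "?L c k \<subseteq> ?L d k" using order_trans by blast
    then show ?thesis unfolding law_def by (intro emeasure_mono s)
  qed
  have "(\<lambda>m. law \<mu> B (c + 1 / real (Suc m)) k) \<longlonglongrightarrow> law \<mu> B c k" for c k
  proof -
    have "(\<Inter>m. ?L (c + 1 / real (Suc m)) k) = ?L c k"
    proof (intro set_eqI iffI)
      fix z assume z: "z \<in> (\<Inter>m. ?L (c + 1 / real (Suc m)) k)"
      have "(\<lambda>m. (c + 1 / real (Suc m)) * (norm (fst z))\<^sup>2) \<longlonglongrightarrow> (c + 0) * (norm (fst z))\<^sup>2"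
        by (intro tendsto_intros LIMSEQ_inverse_real_of_nat[unfolded inverse_eq_divide])
      then have "1 \<le> (c + 0) * (norm (fst z))\<^sup>2"
        by (rule LIMSEQ_le_const) (use z in auto)
      then show "z \<in> ?L c k" using z by auto
    next
      fix z assume z: "z \<in> ?L c k"
      have "c * (norm (fst z))\<^sup>2 \<le> (c + 1 / real (Suc m)) * (norm (fst z))\<^sup>2" for m
        by (intro mult_right_mono) auto
      then show "z \<in> (\<Inter>m. ?L (c + 1 / real (Suc m)) k)" using z by (auto intro: order_trans)
    qed
    moreover have "decseq (\<lambda>m. ?L (c + 1 / real (Suc m)) k)"
    proof (intro decseq_SucI subsetI)
      fix m z assume z: "z \<in> ?L (c + 1 / real (Suc (Suc m))) k"
      have "1 / real (Suc (Suc m)) \<le> 1 / real (Suc m)" by (simp add: field_simps)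
      then have "(c + 1 / real (Suc (Suc m))) * (norm (fst z))\<^sup>2 \<le> (c +
          1 / real (Suc m)) * (norm (fst z))\<^sup>2"
        by (intro mult_right_mono) auto
      then show "z \<in> ?L (c + 1 / real (Suc m)) k" using z by (auto intro: order_trans)
    qed
    ultimately show ?thesis
      using Lim_emeasure_decseq[of "\<lambda>m. ?L (c + 1 / real (Suc m)) k" \<mu>] s by (auto simp: law_def)
  qed
  moreover have "law \<mu> B c k = 0" if "c \<le> 0" for c k
  proof -
    have "\<not> 1 \<le> c * (norm x)\<^sup>2" for x :: 'a
      using mult_nonpos_nonneg[OF that, of "(norm x)\<^sup>2"] by simp
    then show ?thesis by (simp add: law_def)
  qed
  moreover have "law \<mu> B c k = 0" if "k \<notin> {-1, 1}" for c k
  proof -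
    have "?L c k = {}" using that by (auto simp: space_\<mu>)
    then show ?thesis unfolding law_def by (simp only: emeasure_empty)
  qed
  moreover have "law \<mu> B c k \<le> 1" for c k unfolding law_def by (rule emeasure_le_1)
  moreover have "(\<lambda>c. law \<mu> B c k) \<in> borel_measurable borel" for k
  proof -
    have eq: "law \<mu> B c k = ennreal (measure \<mu> (?L c k))" for c
        by (simp add: law_def emeasure_eq_measure)
    have "mono (\<lambda>c. measure \<mu> (?L c k))"
      using mono[of _ _ k] unfolding eq by (intro monoI) simp
    then have "(\<lambda>c. measure \<mu> (?L c k)) \<in> borel_measurable borel" by (rule borel_measurable_mono)
    then show ?thesis unfolding eq by simp
  qed
  ultimately show ?thesis unfolding distribution_def using mono by blast
qed

text \<open>\<open>c * |X t|^2 \<ge> 1\<close> is equivalent to \<open>c' * |x|^2 \<ge> 1\<close>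
  with the transformed argument \<open>c'\<close>, and the direction moves by \<open>R t\<close>
  alone. Exchanging the integrals over state and path then produces \<open>dual\<close>, with the
  preimage of \<open>B\<close>.\<close>

lemma law_bind:
  assumes t: "0 \<le> t" and B: "B \<in> sets borel" and k: "k \<in> {-1, 1}"
  shows "law (\<mu> \<bind> kernel S R t) B c k = dual t (law \<mu> (R t -` B)) c k"
proof -
  interpret prob_space \<mu> by (rule \<mu>)
  let ?B = "R t -` B"
  have B': "?B \<in> sets borel" using measurable_sets[OF R_measurable B, of t] by simp
  note [measurable] = B' sgn_measurable
  define c' where "c' i \<tau> = c * exp (2 * gr i \<tau> t) - 2 * ms i \<tau> t" for i \<tau>
  have c'_m [measurable]: "c' i \<in> borel_measurable (H i)" for i unfolding c'_def[abs_def]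
      by measurable
  \<comment> \<open>The condition \<open>snd z = i\<close> is built in so that the path measure
    \<open>H i\<close> no longer depends on the state \<open>z\<close>, as the exchange of integrals
    requires.\<close>
  define K :: "int \<Rightarrow> 'a \<times> int \<Rightarrow> (nat \<Rightarrow> real) \<Rightarrow> ennreal" where
    "K i z \<tau> = indicator {k} (index_path i \<tau> t) * of_bool (sgn (fst z) \<in> ?B \<and> 1 \<le>
        c' i \<tau> * (norm (fst z))\<^sup>2 \<and> snd z = i)" for i z \<tau>
  have Km: "(\<lambda>(z, \<tau>). K i z \<tau>) \<in> borel_measurable (\<mu> \<Otimes>\<^sub>M H i)" for i
    unfolding K_def case_prod_beta of_bool_def by measurable
  let ?X = "{z \<in> space (state_space S). sgn (fst z) \<in> B \<and> 1 \<le> c * (norm (fst z))\<^sup>2 \<and> snd z = k}"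
  have X: "?X \<in> sets (state_space S)" by (rule law_sets[OF refl B])
  have "law (\<mu> \<bind> kernel S R t) B c k = (\<integral>\<^sup>+z. emeasure (kernel S R t z) ?X \<partial>\<mu>)"
    unfolding law_def sets_eq_imp_space_eq[OF sets_bind_kernel[OF t]]
        by (rule emeasure_bind_kernel[OF t X])
  also have "\<dots> = (\<integral>\<^sup>+z. (\<Sum>i\<in>{-1, 1}. \<integral>\<^sup>+\<tau>. K i z \<tau> \<partial>H i) \<partial>\<mu>)"
  proof (rule nn_integral_cong)
    fix z assume z: "z \<in> space \<mu>"
    then obtain x i where zx: "z = (x, i)" "x \<in> S" "i \<in> {-1, 1}" by (auto simp: space_\<mu>)
    have "emeasure (kernel S R t z) ?X = (\<integral>\<^sup>+\<tau>. indicator ?X (evolve R t i x \<tau>) \<partial>H i)"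
      using z by (subst emeasure_kernel[OF t _ X]) (auto simp: zx space_\<mu> space_state_space)
    also have "\<dots> = (\<integral>\<^sup>+\<tau>. K i z \<tau> \<partial>H i)"
    proof (rule nn_integral_cong)
      fix \<tau>
      let ?g = "gain (gr i \<tau> t) (ms i \<tau> t) ((norm x)\<^sup>2)"
      have g: "0 < ?g" by (rule gain_pos'[OF t])
      have D: "0 < 1 + 2 * (norm x)\<^sup>2 * ms i \<tau> t" using ms_nonneg[OF t, of i \<tau>]
          by (simp add: add_pos_nonneg)
      have "?g\<^sup>2 = exp (2 * gr i \<tau> t) / (1 + 2 * (norm x)\<^sup>2 * ms i \<tau> t)"
        using D by (simp add: gain_def power_divide exp_double)
      then have "c * (?g\<^sup>2 * (norm x)\<^sup>2) = c * exp (2 * gr i \<tau> t) * (norm x)\<^sup>2 / (1 +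
          2 * (norm x)\<^sup>2 * ms i \<tau> t)"
        by simp
      then have "1 \<le> c * (?g\<^sup>2 * (norm x)\<^sup>2) \<longleftrightarrow> 1 \<le> c' i \<tau> * (norm x)\<^sup>2"
        by (simp only: pos_le_divide_eq[OF D]) (simp add: c'_def algebra_simps)
      moreover have "sgn (?g *\<^sub>R R t x) = R t (sgn x)"
        using g by (simp add: sgn_scaleR sgn_div_norm R_scaleR)
      moreover have "evolve R t i x \<tau> \<in> space (state_space S)"
        using R_closed[OF zx(2) g] index_path_cases[OF zx(3)]
            by (auto simp: evolve_def space_state_space)
      ultimately show "indicator ?X (evolve R t i x \<tau>) = K i z \<tau>"
        using g by (auto simp: evolve_def K_def zx indicator_def power_mult_distrib)
    qed
    also have "\<dots> = (\<Sum>i\<in>{-1, 1}. \<integral>\<^sup>+\<tau>. K i z \<tau> \<partial>H i)"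
    proof -
      have "(\<Sum>j\<in>{-1, 1}. \<integral>\<^sup>+\<tau>. K j z \<tau> \<partial>H j) = (\<Sum>j\<in>{i}. \<integral>\<^sup>+\<tau>. K j z \<tau> \<partial>H j)"
        using zx by (intro sum.mono_neutral_right) (auto simp: K_def)
      then show ?thesis by simp
    qed
    finally show "emeasure (kernel S R t z) ?X = (\<Sum>i\<in>{-1, 1}. \<integral>\<^sup>+\<tau>. K i z \<tau> \<partial>H i)" .
  qed
  also have "\<dots> = (\<Sum>i\<in>{-1, 1}. \<integral>\<^sup>+z. \<integral>\<^sup>+\<tau>. K i z \<tau> \<partial>H i \<partial>\<mu>)"
    by (intro nn_integral_sum H.borel_measurable_nn_integral Km)
  also have "\<dots> = dual t (law \<mu> ?B) c k"
    unfolding dual_def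
  proof (rule sum.cong[OF refl])
    fix i
    interpret P: pair_sigma_finite \<mu> "H i" ..
    have "(\<integral>\<^sup>+z. \<integral>\<^sup>+\<tau>. K i z \<tau> \<partial>H i \<partial>\<mu>) = (\<integral>\<^sup>+\<tau>. \<integral>\<^sup>+z. K i z \<tau> \<partial>\<mu> \<partial>H i)"
      using P.Fubini'[OF Km[of i]] by simp
    also have "\<dots> = (\<integral>\<^sup>+\<tau>. indicator {k} (index_path i \<tau> t) * law \<mu> ?B (c * exp (2 * gr i \<tau> t) - 2 *
        ms i \<tau> t) i \<partial>H i)"
    proof (rule nn_integral_cong)
      fix \<tau>
      let ?L = "{z \<in> space \<mu>. sgn (fst z) \<in> ?B \<and> 1 \<le> c' i \<tau> * (norm (fst z))\<^sup>2 \<and> snd z = i}"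
      have "(\<integral>\<^sup>+z. K i z \<tau> \<partial>\<mu>) = (\<integral>\<^sup>+z. indicator {k} (index_path i \<tau> t) * indicator ?L z \<partial>\<mu>)"
        by (intro nn_integral_cong) (auto simp: K_def indicator_def)
      also have "\<dots> = indicator {k} (index_path i \<tau> t) * emeasure \<mu> ?L"
        by (rule nn_integral_cmult_indicator) (rule law_sets[OF sets_\<mu> B'])
      finally show "(\<integral>\<^sup>+z. K i z \<tau> \<partial>\<mu>) = indicator {k} (index_path i \<tau> t) * law \<mu> ?B (c * exp (2 * gr
          i \<tau> t) - 2 * ms i \<tau> t) i"
        by (simp add: law_def c'_def)
    qed
    finally show "(\<integral>\<^sup>+z. \<integral>\<^sup>+\<tau>. K i z \<tau> \<partial>H i \<partial>\<mu>) =
      (\<integral>\<^sup>+\<tau>. indicator {k} (index_path i \<tau> t) * law \<mu> ?B (c * exp (2 * gr i \<tau> t) - 2 * ms i \<tau> t) i \<partial>H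
          i)" .
  qed
  finally show ?thesis .
qed

end
end

section \<open>Invariant measures of the kernels\<close>

abbreviation inv :: "'a::euclidean_space set \<Rightarrow> (real \<Rightarrow> 'a \<Rightarrow> 'a) \<Rightarrow> ('a \<times> int) measure \<Rightarrow> bool" where
  "inv S R \<mu> \<equiv> invariant_prob (state_space S) (kernel S R) \<mu>"

definition dirm :: "('a::euclidean_space \<times> int) measure \<Rightarrow> 'a set \<Rightarrow> ennreal" where
  "dirm \<mu> B = emeasure \<mu> {z \<in> space \<mu>. sgn (fst z) \<in> B \<and> fst z \<noteq> 0}"

lemma origin_field_zero: "admissible S R \<Longrightarrow> R t 0 = 0"
  using R_scaleR[of S R t 0 0] by simp

context
  fixes S :: "'a::euclidean_space set" and R :: "real \<Rightarrow> 'a \<Rightarrow> 'a"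
  assumes adm: "admissible S R"
begin

lemma invD:
  assumes "inv S R \<mu>"
  shows "prob_space \<mu>" "sets \<mu> = sets (state_space S)" "0 \<le> t \<Longrightarrow> \<mu> \<bind> kernel S R t = \<mu>"
  using assms by (auto simp: invariant_prob_def)

lemma emeasure_kernel_index:
  assumes t: "0 \<le> t" and z: "z \<in> space (state_space S)" and k: "k \<in> {-1, 1}"
  shows "emeasure (kernel S R t z) {z \<in> space (state_space S). snd z = k} =
      ennreal (trans t (snd z) k)"
proof -
  have z': "fst z \<in> S" "snd z \<in> {-1, 1}" using z by (auto simp: space_state_space)
  have X: "{z \<in> space (state_space S). snd z = k} \<in> sets (state_space S)"
    using state_space_measurable_snd[of S] by measurable
  have ev: "evolve R t (snd z) (fst z) \<tau> \<in> space (state_space S)" for \<tau>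
    using measurable_space[OF evolve_measurable'[OF adm t, of "fst z" "snd z"], of \<tau>] z by simp
  have "emeasure (kernel S R t z) {z \<in> space (state_space S). snd z = k} =
      (\<integral>\<^sup>+\<tau>. indicator {k} (index_path (snd z) \<tau> t) \<partial>H (snd z))"
    unfolding emeasure_kernel[OF adm t z X]
    by (intro nn_integral_cong) (use ev in \<open>auto simp: indicator_def evolve_def\<close>)
  then show ?thesis by (simp add: nn_integral_indicator_index[OF t z'(2) k])
qed

lemma index_bind:
  assumes \<mu>: "prob_space \<mu>" and s: "sets \<mu> = sets (state_space S)" and t: "0 \<le> t"
      and k: "k \<in> {-1, 1}"
  shows "emeasure (\<mu> \<bind> kernel S R t) {z \<in> space (state_space S). snd z = k} =
    (\<Sum>i\<in>{-1, 1}. ennreal (trans t i k) * emeasure \<mu> {z \<in> space (state_space S). snd z = i})"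
proof -
  have X: "{z \<in> space (state_space S). snd z = k} \<in> sets (state_space S)" for k
    using state_space_measurable_snd[of S] by measurable
  have sp: "space \<mu> = space (state_space S)" using sets_eq_imp_space_eq[OF s] .
  have "emeasure (\<mu> \<bind> kernel S R t) {z \<in> space (state_space S). snd z = k} =
      (\<integral>\<^sup>+z. emeasure (kernel S R t z) {z \<in> space (state_space S). snd z = k} \<partial>\<mu>)"
    by (rule emeasure_bind_kernel[OF adm \<mu> s t X])
  also have "\<dots> = (\<integral>\<^sup>+z. (\<Sum>i\<in>{-1, 1}. ennreal (trans t i k) * indicator {z \<in>
      space (state_space S). snd z = i} z) \<partial>\<mu>)"
  proof (rule nn_integral_cong)
    fix z assume z: "z \<in> space \<mu>"
    then have "snd z \<in> {-1, 1}" by (auto simp: sp space_state_space)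
    then show "emeasure (kernel S R t z) {z \<in> space (state_space S). snd z = k} =
        (\<Sum>i\<in>{-1, 1}. ennreal (trans t i k) * indicator {z \<in> space (state_space S). snd z = i} z)"
      using z by (subst emeasure_kernel_index[OF t _ k]) (auto simp: sp indicator_def)
  qed
  also have "\<dots> = (\<Sum>i\<in>{-1, 1}. \<integral>\<^sup>+z. ennreal (trans t i k) * indicator {z \<in>
      space (state_space S). snd z = i} z \<partial>\<mu>)"
    using X s by (intro nn_integral_sum) auto
  also have "\<dots> = (\<Sum>i\<in>{-1, 1}. ennreal (trans t i k) * emeasure \<mu> {z \<in> space (state_space S). snd z =
      i})"
    using X s by (intro sum.cong refl nn_integral_cmult_indicator) auto
  finally show ?thesis .
qed

text \<open>The index marginal is invariant under the two-state chain; its deviation from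
  \<open>\<pi>\<close> is multiplied by \<open>?e < 1\<close> in unit time and hence is 0.\<close>

lemma inv_index:
  assumes \<mu>: "inv S R \<mu>" and k: "k \<in> {-1, 1}"
  shows "emeasure \<mu> {z \<in> space (state_space S). snd z = k} = ennreal (\<pi> k)"
proof -
  note D = invD[OF \<mu>]
  interpret prob_space \<mu> by (rule D)
  have sp: "space \<mu> = space (state_space S)" using sets_eq_imp_space_eq[OF D(2)] .
  have X: "{z \<in> space (state_space S). snd z = k} \<in> sets \<mu>" for k
    unfolding D(2) using state_space_measurable_snd[of S] by measurable
  define m where "m k = measure \<mu> {z \<in> space (state_space S). snd z = k}" for k
  have em: "emeasure \<mu> {z \<in> space (state_space S). snd z = k} = ennreal (m k)" for k
    by (simp add: m_def emeasure_eq_measure)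
  have m0: "0 \<le> m k" for k by (simp add: m_def)
  have "m (-1) + m 1 = measure \<mu> ({z \<in> space (state_space S). snd z = -1} \<union> {z \<in>
      space (state_space S). snd z = 1})"
    unfolding m_def using X by (intro finite_measure_Union[symmetric]) auto
  also have "\<dots> = measure \<mu> (space \<mu>)"
    by (rule arg_cong[where f = "measure \<mu>"]) (auto simp: sp space_state_space)
  finally have sum: "m (-1) + m 1 = 1" by (simp add: prob_space)
  let ?e = "exp (- (lm + lp) * 1)"
  have "ennreal (m k) = (\<Sum>i\<in>{-1, 1}. ennreal (trans 1 i k) * ennreal (m i))"
    using index_bind[OF D(1,2), of 1 k] k unfolding D(3)[of 1, simplified] em by simp
  also have "\<dots> = ennreal (\<Sum>i\<in>{-1, 1}. trans 1 i k * m i)"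
    using m0 trans_nonneg[of 1] by (simp add: ennreal_mult)
  finally have "m k = (\<Sum>i\<in>{-1, 1}. trans 1 i k * m i)"
    using m0 trans_nonneg[of 1] by (subst (asm) ennreal_inj) auto
  also have "\<dots> = (m (-1) + m 1) * (\<pi> k - \<pi> k * ?e) + m k * ?e"
    using k by (auto simp: trans_def algebra_simps)
  finally have "(m k - \<pi> k) * (1 - ?e) = 0" unfolding sum by (simp add: algebra_simps)
  moreover have "?e < 1" using lm lp by simp
  then have "1 - ?e \<noteq> 0" by linarith
  ultimately have "m k - \<pi> k = 0" by (metis mult_eq_0_iff)
  then show ?thesis by (simp add: em)
qed

lemma zero_absorbing:
  assumes t: "0 \<le> t" and z: "z \<in> space (state_space S)" "fst z = 0"
  shows "emeasure (kernel S R t z) {z \<in> space (state_space S). fst z = 0} = 1"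
proof -
  have X: "{z \<in> space (state_space S). fst z = 0} \<in> sets (state_space S)"
    using state_space_measurable_fst[of S] by measurable
  have ev: "evolve R t (snd z) (fst z) \<tau> \<in> space (state_space S)" for \<tau>
    using measurable_space[OF evolve_measurable'[OF adm t, of "fst z" "snd z"], of \<tau>] z(1) by simp
  have "emeasure (kernel S R t z) {z \<in> space (state_space S). fst z = 0} = (\<integral>\<^sup>+\<tau>. 1 \<partial>H (snd z))"
    unfolding emeasure_kernel[OF adm t z(1) X]
    by (intro nn_integral_cong) (use ev z origin_field_zero[OF adm] in \<open>auto simp: indicator_def
        evolve_def\<close>)
  then show ?thesis by simp
qed

text \<open>Paths that start in \<open>A\<close> are in \<open>A\<close> at time \<open>t\<close> as
  well, so the mass moved from \<open>A\<close> into \<open>X\<close> is at most the invariant mass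
  of \<open>A \<inter> X\<close>. This gives one inequality between two probability
  measures.\<close>

lemma conditioned_inv:
  assumes \<mu>: "inv S R \<mu>" and A: "A \<in> sets (state_space S)" and pos: "measure \<mu> A \<noteq> 0"
    and abs: "\<And>t. 0 \<le> t \<Longrightarrow> AE z in \<mu>. z \<in> A \<longrightarrow> measure (kernel S R t z) A = 1"
  shows "inv S R (uniform_measure \<mu> A)"
proof -
  note D = invD[OF \<mu>]
  interpret prob_space \<mu> by (rule D)
  let ?U = "uniform_measure \<mu> A"
  have sp: "space \<mu> = space (state_space S)" using sets_eq_imp_space_eq[OF D(2)] .
  have A\<mu>: "A \<in> sets \<mu>" using A D(2) by simp
  have e0: "emeasure \<mu> A \<noteq> 0" using pos by (simp add: emeasure_eq_measure)
  have U: "prob_space ?U" using e0 by (intro prob_space_uniform_measure) auto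
  have sU: "sets ?U = sets (state_space S)" using D(2) by simp
  have "?U \<bind> kernel S R t = ?U" if t: "0 \<le> t" for t
  proof -
    let ?V = "?U \<bind> kernel S R t"
    interpret V: prob_space ?V by (rule prob_space_bind_kernel[OF adm U sU t])
    interpret U: prob_space ?U by (rule U)
    have sV: "sets ?V = sets (state_space S)" by (rule sets_bind_kernel[OF adm U sU t])
    have km: "(\<lambda>z. emeasure (kernel S R t z) X) \<in> borel_measurable \<mu>" if "X \<in> sets (state_space S)"
        for X
      using measurable_compose[OF kernel_measurable_\<mu>[OF adm D(1,2) t]
          measurable_emeasure_subprob_algebra[OF that]] .
    have le: "emeasure ?V X \<le> emeasure ?U X" if X: "X \<in> sets (state_space S)" for X
    proof -
      have "emeasure ?V X = (\<integral>\<^sup>+z. emeasure (kernel S R t z) X \<partial>?U)"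
        by (rule emeasure_bind_kernel[OF adm U sU t X])
      also have "\<dots> = (\<integral>\<^sup>+z\<in>A. emeasure (kernel S R t z) X \<partial>\<mu>) / emeasure \<mu> A"
        by (rule nn_integral_uniform_measure[OF km[OF X] A\<mu>])
      also have "(\<integral>\<^sup>+z\<in>A. emeasure (kernel S R t z) X \<partial>\<mu>) \<le> (\<integral>\<^sup>+z. emeasure (kernel S R t z) (A \<inter> X)
          \<partial>\<mu>)"
      proof (rule nn_integral_mono_AE)
        have "AE z in \<mu>. z \<in> space \<mu>" by simp
        then show "AE z in \<mu>. emeasure (kernel S R t z) X * indicator A z \<le>
            emeasure (kernel S R t z) (A \<inter> X)"
          using abs[OF t]
        proof eventually_elim
          case (elim z)
          show ?case
          proof (cases "z \<in> A")
            case True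
            interpret K: prob_space "kernel S R t z"
              using elim by (intro kernel_prob_space[OF adm t]) (simp add: sp)
            have "emeasure (kernel S R t z) A = 1" using elim True
                by (simp add: K.emeasure_eq_measure)
            then have "AE y in kernel S R t z. y \<in> A" using A
                by (intro K.AE_prob_1) (simp add: measure_def)
            then have "emeasure (kernel S R t z) X = emeasure (kernel S R t z) (A \<inter> X)"
              using X A by (intro emeasure_eq_AE) (auto simp: sets_kernel[OF adm])
            then show ?thesis by (simp add: indicator_def)
          qed simp
        qed
      qed
      also have "(\<integral>\<^sup>+z. emeasure (kernel S R t z) (A \<inter> X) \<partial>\<mu>) = emeasure \<mu> (A \<inter> X)"
        using emeasure_bind_kernel[OF adm D(1,2) t, of "A \<inter> X"] A X D(3)[OF t] by simp
      also have "emeasure \<mu> (A \<inter> X) / emeasure \<mu> A = emeasure ?U X"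
        using A\<mu> X D(2) by (intro emeasure_uniform_measure[symmetric]) auto
      finally show ?thesis by (simp add: divide_right_mono_ennreal)
    qed
    show "?V = ?U"
    \<comment> \<open>Applied to \<open>X\<close> and to its complement, the inequality between
      probability measures becomes an equality.\<close>
    proof (rule measure_eqI)
      show "sets ?V = sets ?U" using sV sU by simp
      fix X assume "X \<in> sets ?V"
      then have X: "X \<in> sets (state_space S)" using sV by simp
      have "measure ?V X \<le> measure ?U X"
        using le[OF X] by (simp add: V.emeasure_eq_measure U.emeasure_eq_measure)
      moreover have "measure ?V (space (state_space S) - X) \<le> measure ?U (space (state_space S) -
          X)"
        using le[of "space (state_space S) - X"] X
            by (simp add: V.emeasure_eq_measure U.emeasure_eq_measure)
      moreover have "measure ?V (space (state_space S) - X) = 1 - measure ?V X"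
        using V.prob_compl[of X] X sV sets_eq_imp_space_eq[OF sV] by simp
      moreover have "measure ?U (space (state_space S) - X) = 1 - measure ?U X"
        using U.prob_compl[of X] X sU sets_eq_imp_space_eq[OF sU] by simp
      ultimately show "emeasure ?V X = emeasure ?U X"
        by (simp add: V.emeasure_eq_measure U.emeasure_eq_measure)
    qed
  qed
  then show ?thesis using U sU by (simp add: invariant_prob_def)
qed

lemma law_zero_AE:
  assumes \<mu>: "prob_space \<mu>" and s: "sets \<mu> = sets (state_space S)"
      and z: "\<And>c k. k \<in> {-1, 1} \<Longrightarrow> law \<mu> UNIV c k = 0"
  shows "AE z in \<mu>. fst z = 0"
proof -
  let ?L = "\<lambda>c k. {z \<in> space \<mu>. sgn (fst z) \<in> UNIV \<and> 1 \<le> c * (norm (fst z))\<^sup>2 \<and> snd z = k}"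
  have nz: "AE z in \<mu>. \<forall>n::nat. \<forall>k\<in>{-1, 1}. z \<notin> ?L (real n) k"
  proof (subst AE_all_countable, rule allI)
    fix n
    have "?L (real n) k \<in> null_sets \<mu>" if "k \<in> {-1, 1}" for k
      using z[OF that] law_sets[OF s, of UNIV] by (auto simp: law_def)
    then have "AE z in \<mu>. z \<notin> ?L (real n) k" if "k \<in> {-1, 1}" for k
      using that AE_not_in by blast
    then show "AE z in \<mu>. \<forall>k\<in>{-1, 1}. z \<notin> ?L (real n) k"
      by (subst AE_ball_countable) auto
  qed
  have sp: "space \<mu> = S \<times> {-1, 1}" using sets_eq_imp_space_eq[OF s]
      by (simp only: space_state_space)
  have "AE z in \<mu>. z \<in> space \<mu>" by simp
  with nz show ?thesis
  proof eventually_elim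
    case (elim z)
    show ?case
    proof (rule ccontr)
      assume "fst z \<noteq> 0"
      then have "0 < (norm (fst z))\<^sup>2" by simp
      then obtain n where "1 < real n * (norm (fst z))\<^sup>2" by (metis reals_Archimedean3)
      then have "z \<in> ?L (real n) (snd z)" using elim(2) by (simp add: less_imp_le)
      moreover have "snd z \<in> {-1, 1}" using elim(2) unfolding sp by (simp only: mem_Times_iff)
      ultimately show False using elim(1) by blast
    qed
  qed
qed

lemma inv_law_fixed:
  assumes \<mu>: "inv S R \<mu>" and T: "0 < T" "R T = (\<lambda>x. x)" and B: "B \<in> sets borel" and k: "k \<in> {-1, 1}"
  shows "dual T (law \<mu> B) c k = law \<mu> B c k"
  using law_bind[OF adm invD(1,2)[OF \<mu>] _ B k, of T c] T invD(3)[OF \<mu>, of T] by simp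

lemma inv_zero:
  assumes \<mu>: "inv S R \<mu>" and T: "0 < T" "R T = (\<lambda>x. x)" and drift: "drift \<le> 0"
  shows "AE z in \<mu>. fst z = 0"
proof (rule law_zero_AE[OF invD(1,2)[OF \<mu>]])
  fix c k assume k: "k \<in> {-1, 1::int}"
  show "law \<mu> UNIV c k = 0"
    by (rule fixed_zero[OF T(1) distribution_law[OF adm invD(1,2)[OF \<mu>]] inv_law_fixed[OF \<mu> T] drift
        k]) auto
qed

text \<open>As \<open>c\<close> tends to infinity the sets exhaust all states off the origin with
  direction in \<open>B\<close>, while \<open>Flim\<close> tends to \<open>\<pi>\<close>, whose sum
  is 1.\<close>

lemma dirm_eqI:
  assumes \<mu>: "prob_space \<mu>" and s: "sets \<mu> = sets (state_space S)" and B: "B \<in> sets borel"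
      and drift: "0 < drift"
    and a: "a < \<top>" and eq: "\<And>c k. k \<in> {-1, 1} \<Longrightarrow> law \<mu> B c k = a * Flim c k"
  shows "dirm \<mu> B = a"
proof -
  let ?L = "\<lambda>c k. {z \<in> space \<mu>. sgn (fst z) \<in> B \<and> 1 \<le> c * (norm (fst z))\<^sup>2 \<and> snd z = k}"
  have s': "?L c k \<in> sets \<mu>" for c k by (rule law_sets[OF s B])
  have sp: "space \<mu> = S \<times> {-1, 1}" using sets_eq_imp_space_eq[OF s]
      by (simp only: space_state_space)
  define W where "W n = ?L (real n) (-1) \<union> ?L (real n) 1" for n :: nat
  have "(\<lambda>n. emeasure \<mu> (W n)) \<longlonglongrightarrow> emeasure \<mu> (\<Union>n. W n)"
  proof (rule Lim_emeasure_incseq)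
    show "range W \<subseteq> sets \<mu>" using s' by (auto simp: W_def)
    show "incseq W"
    proof (rule incseq_SucI)
      fix n
      have "real n * (norm x)\<^sup>2 \<le> real (Suc n) * (norm x)\<^sup>2" for x :: 'a
          by (intro mult_right_mono) auto
      then show "W n \<subseteq> W (Suc n)" unfolding W_def using order_trans by blast
    qed
  qed
  also have "(\<Union>n. W n) = {z \<in> space \<mu>. sgn (fst z) \<in> B \<and> fst z \<noteq> 0}"
  proof (intro set_eqI iffI)
    fix z assume z: "z \<in> {z \<in> space \<mu>. sgn (fst z) \<in> B \<and> fst z \<noteq> 0}"
    then have "0 < (norm (fst z))\<^sup>2" by simp
    then obtain n where n: "1 < real n * (norm (fst z))\<^sup>2" by (metis reals_Archimedean3)
    have "z \<in> S \<times> {-1, 1}" using z sp by (simp only: mem_Collect_eq)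
    then have "snd z = -1 \<or> snd z = 1" by (simp only: mem_Times_iff insert_iff empty_iff) simp
    moreover have "1 \<le> real n * (norm (fst z))\<^sup>2" using n by (rule less_imp_le)
    ultimately have "z \<in> W n" using z unfolding W_def
        by (simp only: mem_Collect_eq Un_iff simp_thms)
    then show "z \<in> (\<Union>n. W n)" by blast
  qed (auto simp: W_def)
  also have "(\<lambda>n. emeasure \<mu> (W n)) = (\<lambda>n. law \<mu> B (real n) (-1) + law \<mu> B (real n) 1)"
    unfolding W_def law_def by (intro ext plus_emeasure[symmetric] s') auto
  also have "\<dots> = (\<lambda>n. a * Flim (real n) (-1) + a * Flim (real n) 1)" by (simp add: eq)
  finally have "(\<lambda>n. a * Flim (real n) (-1) + a * Flim (real n) 1) \<longlonglongrightarrow> dirm \<mu> B"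
      by (simp add: dirm_def)
  moreover have "(\<lambda>n. a * Flim (real n) (-1) + a * Flim (real n) 1) \<longlonglongrightarrow> a * ennreal (\<pi> (-1)) +
      a * ennreal (\<pi> 1)"
    by (intro tendsto_add ennreal_tendsto_cmult a filterlim_compose[OF Flim_limit[OF drift]
        filterlim_real_sequentially]) auto
  moreover have "a * ennreal (\<pi> (-1)) + a * ennreal (\<pi> 1) = a"
    using \<pi>_pos \<pi>_sum by (simp add: less_imp_le flip: distrib_left ennreal_plus)
  ultimately show ?thesis using LIMSEQ_unique by metis
qed

text \<open>Every set of directions yields a multiple of the same \<open>Flim\<close>: off the
  origin, the direction is independent of radius and index.\<close>

lemma inv_law:
  assumes \<mu>: "inv S R \<mu>" and T: "0 < T" "R T = (\<lambda>x. x)" and drift: "0 < drift"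
      and B: "B \<in> sets borel" and k: "k \<in> {-1, 1}"
  shows "law \<mu> B c k = dirm \<mu> B * Flim c k"
proof -
  note D = invD[OF \<mu>]
  obtain \<beta> where "0 \<le> \<beta>" and \<beta>: "\<And>c k. k \<in> {-1, 1} \<Longrightarrow> law \<mu> B c k = ennreal \<beta> * Flim c k"
    by (rule fixed_unique[OF T(1) distribution_law[OF adm D(1,2) B] inv_law_fixed[OF \<mu> T B] drift])
        (assumption, rule that)
  have "dirm \<mu> B = ennreal \<beta>" by (rule dirm_eqI[OF D(1,2) B drift _ \<beta>]) auto
  then show ?thesis using \<beta>[OF k] by simp
qed

lemma dirm_AE:
  assumes \<mu>: "prob_space \<mu>" and s: "sets \<mu> = sets (state_space S)"
  shows "dirm \<mu> UNIV = 1 \<longleftrightarrow> (AE z in \<mu>. fst z \<noteq> 0)"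
proof -
  interpret prob_space \<mu> by (rule \<mu>)
  have [measurable]: "(\<lambda>z. fst z) \<in> \<mu> \<rightarrow>\<^sub>M borel"
    using state_space_measurable_fst[of S] measurable_cong_sets[OF s refl] by blast
  have "{z \<in> space \<mu>. fst z \<noteq> 0} \<in> sets \<mu>" by measurable
  then show ?thesis by (simp add: dirm_def emeasure_eq_measure prob_Collect_eq_1)
qed

text \<open>\<open>a UNIV = 1\<close> excludes mass at the origin, the one part of a measure that
  \<open>law\<close> does not see.\<close>

lemma law_unique:
  assumes \<mu>1: "prob_space \<mu>1" "sets \<mu>1 = sets (state_space S)"
      and \<mu>2: "prob_space \<mu>2" "sets \<mu>2 = sets (state_space S)"
    and drift: "0 < drift" and a: "a UNIV = 1" "\<And>B. a B < \<top>"
    and eq1: "\<And>B c k. B \<in> sets borel \<Longrightarrow> k \<in> {-1, 1} \<Longrightarrow> law \<mu>1 B c k = a B * Flim c k"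
    and eq2: "\<And>B c k. B \<in> sets borel \<Longrightarrow> k \<in> {-1, 1} \<Longrightarrow> law \<mu>2 B c k = a B * Flim c k"
  shows "\<mu>1 = \<mu>2"
proof -
  obtain s0 where s0: "s0 \<in> S" using S_nonempty[OF adm] by auto
  have "AE z in \<mu>1. fst z \<noteq> 0"
    using dirm_eqI[OF \<mu>1 _ drift, of UNIV "a UNIV"] eq1 a dirm_AE[OF \<mu>1] by simp
  moreover have "AE z in \<mu>2. fst z \<noteq> 0"
    using dirm_eqI[OF \<mu>2 _ drift, of UNIV "a UNIV"] eq2 a dirm_AE[OF \<mu>2] by simp
  ultimately show ?thesis
    using \<mu>1(1) eq1 eq2
    by (intro law_determines[OF S_borel[OF adm] s0 \<mu>1(2) \<mu>2(2)]) (auto simp: prob_space_def)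
qed

end
end

subsection \<open>The invariant measure at the origin\<close>

lemma sum_two_states: "(\<Sum>k\<in>{-1, 1}. f k) = f (-1) + f (1 :: int)"
  by simp

context switching begin

lemma origin_measure_eq: "origin_measure lm lp = return borel 0 \<Otimes>\<^sub>M point_measure {-1, 1} (\<lambda>i.
    ennreal (\<pi> i))"
  by (simp add: origin_measure_def \<pi>_def)

lemma sets_origin: "sets (origin_measure lm lp) = sets (state_space UNIV)"
  unfolding origin_measure_eq sets_state_space_UNIV
  by (rule sets_pair_measure_cong) (auto simp: sets_point_measure)

lemma emeasure_origin:
  assumes A: "A \<in> sets (state_space (UNIV :: (real \<times> real) set))"
  shows "emeasure (origin_measure lm lp) A = (\<Sum>k\<in>{-1, 1}. ennreal (\<pi> k) * indicator A (0, k))"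
proof -
  let ?P = "point_measure {-1, 1} (\<lambda>i. ennreal (\<pi> i))"
  interpret P: finite_measure ?P
    by (rule finite_measureI) (simp add: emeasure_point_measure_finite space_point_measure)
  have "A \<in> sets (return borel 0 \<Otimes>\<^sub>M ?P)" using A sets_origin by (simp only: origin_measure_eq)
  then have "emeasure (origin_measure lm lp) A = (\<integral>\<^sup>+x. emeasure ?P (Pair x -` A) \<partial>return borel 0)"
    unfolding origin_measure_eq by (rule P.emeasure_pair_measure_alt)
  also have "\<dots> = emeasure ?P (Pair 0 -` A)"
    using P.measurable_emeasure_Pair[OF \<open>A \<in> sets (return borel 0 \<Otimes>\<^sub>M ?P)\<close>]
    by (intro nn_integral_return) auto
  also have "\<dots> = (\<integral>\<^sup>+k. indicator (Pair 0 -` A) k \<partial>?P)"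
  proof (rule nn_integral_indicator[symmetric])
    have "A \<subseteq> UNIV \<times> {-1, 1}" using sets.sets_into_space[OF A] by (auto simp: space_state_space)
    then show "Pair 0 -` A \<in> sets ?P" by (auto simp: sets_point_measure)
  qed
  also have "\<dots> = (\<Sum>k\<in>{-1, 1}. ennreal (\<pi> k) * indicator A (0, k))"
    using \<pi>_pos by (subst nn_integral_point_measure_finite) (auto simp: indicator_def)
  finally show ?thesis .
qed

lemma prob_space_origin: "prob_space (origin_measure lm lp)"
proof
  have "emeasure (origin_measure lm lp) (space (state_space UNIV)) = ennreal (\<pi> (-1)) +
      ennreal (\<pi> 1)"
    by (subst emeasure_origin[OF sets.top]) (simp add: space_state_space)
  also have "\<dots> = 1" using \<pi>_pos \<pi>_sum by (simp add: less_imp_le flip: ennreal_plus)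
  finally show "emeasure (origin_measure lm lp) (space (origin_measure lm lp)) = 1"
    using sets_eq_imp_space_eq[OF sets_origin] by simp
qed

lemma origin_eqI:
  fixes \<mu> :: "((real \<times> real) \<times> int) measure"
  assumes s: "sets \<mu> = sets (state_space UNIV)" and z: "AE z in \<mu>. fst z = 0"
    and idx: "\<And>k. k \<in> {-1, 1} \<Longrightarrow> emeasure \<mu> {z \<in> space (state_space UNIV). snd z = k} =
        ennreal (\<pi> k)"
  shows "\<mu> = origin_measure lm lp"
proof (rule measure_eqI)
  show "sets \<mu> = sets (origin_measure lm lp)" using s sets_origin by simp
  fix A assume A: "A \<in> sets \<mu>"
  let ?X = "\<lambda>k. {z \<in> space (state_space UNIV). snd z = k}"
  have X: "?X k \<in> sets \<mu>" for k
    unfolding s using state_space_measurable_snd[of UNIV] by measurable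
  have sp: "space \<mu> = UNIV \<times> {-1, 1}" using sets_eq_imp_space_eq[OF s]
      by (simp only: space_state_space)
  have "emeasure \<mu> A = (\<Sum>k\<in>{-1, 1}. emeasure \<mu> (A \<inter> ?X k))"
  proof -
    have "A = (A \<inter> ?X (-1)) \<union> (A \<inter> ?X 1)"
      using sets.sets_into_space[OF A] unfolding sp by (auto simp: space_state_space)
    moreover have "emeasure \<mu> ((A \<inter> ?X (-1)) \<union> (A \<inter> ?X 1)) = emeasure \<mu> (A \<inter> ?X (-1)) +
        emeasure \<mu> (A \<inter> ?X 1)"
      using A X by (intro plus_emeasure[symmetric]) auto
    ultimately show ?thesis by simp
  qed
  also have "\<dots> = (\<Sum>k\<in>{-1, 1}. ennreal (\<pi> k) * indicator A (0, k))"
  proof (rule sum.cong[OF refl])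
    fix k :: int assume k: "k \<in> {-1, 1}"
    show "emeasure \<mu> (A \<inter> ?X k) = ennreal (\<pi> k) * indicator A (0, k)"
    proof (cases "(0, k) \<in> A")
      case True
      have "emeasure \<mu> (A \<inter> ?X k) = emeasure \<mu> (?X k)"
      proof (rule emeasure_eq_AE)
        show "AE x in \<mu>. (x \<in> A \<inter> ?X k) = (x \<in> ?X k)"
          using z by eventually_elim (use True in auto)
      qed (use A X in auto)
      then show ?thesis using True idx[OF k] by simp
    next
      case False
      have "emeasure \<mu> (A \<inter> ?X k) = emeasure \<mu> {}"
      proof (rule emeasure_eq_AE)
        show "AE x in \<mu>. (x \<in> A \<inter> ?X k) = (x \<in> {})"
          using z by eventually_elim (use False in auto)
      qed (use A X in auto)
      then show ?thesis using False by simp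
    qed
  qed
  also have "\<dots> = emeasure (origin_measure lm lp) A" using A s by (simp add: emeasure_origin)
  finally show "emeasure \<mu> A = emeasure (origin_measure lm lp) A" .
qed

lemma AE_origin: "AE z in origin_measure lm lp. fst z = 0"
proof -
  have X: "{z \<in> space (state_space (UNIV :: (real \<times> real) set)). fst z \<noteq> 0} \<in>
      sets (state_space UNIV)"
    using state_space_measurable_fst[of UNIV] by measurable
  then have "emeasure (origin_measure lm lp) {z \<in> space (state_space UNIV). fst z \<noteq> 0} = 0"
    by (subst emeasure_origin) auto
  then show ?thesis
    using X sets_eq_imp_space_eq[OF sets_origin] sets_origin
    by (intro AE_I[where N = "{z \<in> space (state_space UNIV). fst z \<noteq> 0}"]) auto
qed

lemma origin_index:
  assumes "k \<in> {-1, 1}"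
  shows "emeasure (origin_measure lm lp) {z \<in> space (state_space UNIV). snd z = k} = ennreal (\<pi> k)"
proof -
  have "{z \<in> space (state_space (UNIV :: (real \<times> real) set)). snd z = k} \<in> sets (state_space UNIV)"
    using state_space_measurable_snd[of UNIV] by measurable
  then show ?thesis unfolding emeasure_origin[OF \<open>_ \<in> sets (state_space UNIV)\<close>] sum_two_states
    using assms by (auto simp: space_state_space)
qed

lemma inv_origin: "inv UNIV rot (origin_measure lm lp)"
  unfolding invariant_prob_def
proof (intro conjI allI impI prob_space_origin sets_origin)
  fix t :: real assume t: "0 \<le> t"
  let ?\<delta> = "origin_measure lm lp"
  let ?V = "?\<delta> \<bind> kernel UNIV rot t"
  note adm = admissible_planar
  have sV: "sets ?V = sets (state_space UNIV)"
    by (rule sets_bind_kernel[OF adm prob_space_origin sets_origin t])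
  interpret V: prob_space ?V by (rule prob_space_bind_kernel[OF adm prob_space_origin sets_origin
      t])
  interpret O: prob_space ?\<delta> by (rule prob_space_origin)
  show "?V = ?\<delta>"
  proof (rule origin_eqI[OF sV])
    let ?Z = "{z \<in> space (state_space (UNIV :: (real \<times> real) set)). fst z = 0}"
    have Z: "?Z \<in> sets (state_space UNIV)"
      using state_space_measurable_fst[of UNIV] by measurable
    have "emeasure ?V ?Z = (\<integral>\<^sup>+z. emeasure (kernel UNIV rot t z) ?Z \<partial>?\<delta>)"
      by (rule emeasure_bind_kernel[OF adm prob_space_origin sets_origin t Z])
    also have "\<dots> = (\<integral>\<^sup>+z. 1 \<partial>?\<delta>)"
    proof (rule nn_integral_cong_AE)
      have "AE z in ?\<delta>. z \<in> space ?\<delta>" by simp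
      then show "AE z in ?\<delta>. emeasure (kernel UNIV rot t z) ?Z = 1"
        using AE_origin
        by eventually_elim (use sets_eq_imp_space_eq[OF sets_origin] in \<open>auto intro!:
            zero_absorbing[OF adm t]\<close>)
    qed
    finally have "emeasure ?V ?Z = 1" by (simp add: O.emeasure_space_1)
    then have "AE z in ?V. z \<in> ?Z" using Z sV by (intro V.AE_prob_1) (simp add: measure_def)
    then show "AE z in ?V. fst z = 0" by eventually_elim simp
    fix k :: int assume k: "k \<in> {-1, 1}"
    have "emeasure ?V {z \<in> space (state_space UNIV). snd z = k} =
        (\<Sum>i\<in>{-1, 1}. ennreal (trans t i k) * ennreal (\<pi> i))"
      using index_bind[OF adm prob_space_origin sets_origin t k] origin_index by simp
    also have "\<dots> = (\<Sum>i\<in>{-1, 1}. ennreal (\<pi> i * trans t i k))"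
      using \<pi>_pos trans_nonneg[OF t] by (intro sum.cong refl) (simp add: ennreal_mult less_imp_le
          mult.commute)
    also have "\<dots> = ennreal (\<Sum>i\<in>{-1, 1}. \<pi> i * trans t i k)"
      using \<pi>_pos trans_nonneg[OF t] by (intro sum_ennreal) (auto simp: less_imp_le)
    finally show "emeasure ?V {z \<in> space (state_space UNIV). snd z = k} = ennreal (\<pi> k)"
      unfolding \<pi>_trans[OF k] .
  qed
qed

lemma inv_origin_unique:
  assumes "inv UNIV rot \<mu>" "AE z in \<mu>. fst z = 0"
  shows "\<mu> = origin_measure lm lp"
  using assms invD(2)[OF admissible_planar assms(1)] inv_index[OF admissible_planar assms(1)]
  by (intro origin_eqI) auto

subsection \<open>The radial invariant measure\<close>

context
  assumes drift: "0 < drift"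
begin

text \<open>The conditional distribution function of \<open>1 / r ^ 2\<close> given the index
  \<open>k\<close>.\<close>

definition radial_cdf :: "int \<Rightarrow> real \<Rightarrow> real" where
  "radial_cdf k c = enn2real (Flim c k) / \<pi> k"

lemma Flim_eq_radial_cdf: "Flim c k = ennreal (\<pi> k * radial_cdf k c)"
  using \<pi>_pos[of k] le_less_trans[OF Flim_le_1[of c k], of \<top>] by (simp add: radial_cdf_def)

lemma real_distribution_radial_cdf:
  assumes k: "k \<in> {-1, 1}"
  shows "real_distribution (interval_measure (radial_cdf k))" "cdf (interval_measure (radial_cdf k)) =
      radial_cdf k"
proof -
  have mono: "radial_cdf k c \<le> radial_cdf k d" if "c \<le> d" for c d
    unfolding radial_cdf_def using \<pi>_pos[of k] Flim_mono[OF that, of k] le_less_trans[OF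
        Flim_le_1[of d k], of \<top>]
    by (intro divide_right_mono enn2real_mono) (auto simp: less_imp_le)
  have seq: "(\<lambda>m. radial_cdf k (c + 1 / real (Suc m))) \<longlonglongrightarrow> radial_cdf k c" for c
  proof -
    have "Flim c k = ennreal (enn2real (Flim c k))" using le_less_trans[OF Flim_le_1[of c k], of \<top>]
        by simp
    then have "(\<lambda>m. Flim (c + 1 / real (Suc m)) k) \<longlonglongrightarrow> ennreal (enn2real (Flim c k))"
      using Flim_right_continuous[of c k] by simp
    from tendsto_enn2real[OF this] show ?thesis
      unfolding radial_cdf_def using \<pi>_pos[of k] by (intro tendsto_divide) auto
  qed
  have rc: "continuous (at_right c) (radial_cdf k)" for c
    unfolding continuous_within
  proof (rule order_tendstoI)
    fix a assume "a < radial_cdf k c"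
    then have "\<And>d. c < d \<Longrightarrow> a < radial_cdf k d" using mono by (meson less_le_trans less_imp_le)
    then show "\<forall>\<^sub>F d in at_right c. a < radial_cdf k d"
      by (auto simp: eventually_at_right_field intro!: exI[of _ "c + 1"])
  next
    fix a assume "radial_cdf k c < a"
    then have "\<forall>\<^sub>F m in sequentially. radial_cdf k (c + 1 / real (Suc m)) < a"
        by (rule order_tendstoD(2)[OF seq])
    then obtain m where m: "radial_cdf k (c + 1 / real (Suc m)) < a"
        by (auto simp: eventually_sequentially)
    have "radial_cdf k d < a" if "d < c + 1 / real (Suc m)" for d
      using mono[of d "c + 1 / real (Suc m)"] m that by linarith
    then show "\<forall>\<^sub>F d in at_right c. radial_cdf k d < a"
      unfolding eventually_at_right_field by (intro exI[of _ "c + 1 / real (Suc m)"]) auto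
  qed
  have bot: "(radial_cdf k \<longlongrightarrow> 0) at_bot"
  proof (rule tendsto_eventually)
    have "\<forall>\<^sub>F c in at_bot. c \<le> (0::real)" by (rule eventually_le_at_bot)
    then show "\<forall>\<^sub>F c in at_bot. radial_cdf k c = 0"
        by eventually_elim (simp add: radial_cdf_def Flim_nonpos)
  qed
  \<comment> \<open>Positivity of \<open>drift\<close> enters here: no mass is lost at
    \<open>1 / r ^ 2 = \<infinity>\<close>, so the total mass is 1.\<close>
  have "((\<lambda>c. enn2real (Flim c k)) \<longlongrightarrow> \<pi> k) at_top"
    using \<pi>_pos[of k] by (intro tendsto_enn2real Flim_limit drift k) (simp add: less_imp_le)
  then have "((\<lambda>c. enn2real (Flim c k) / \<pi> k) \<longlongrightarrow> \<pi> k / \<pi> k) at_top"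
    using \<pi>_pos[of k] by (intro tendsto_divide tendsto_const) auto
  then have top: "(radial_cdf k \<longlongrightarrow> 1) at_top" using \<pi>_pos[of k]
      by (simp add: radial_cdf_def[abs_def])
  show "real_distribution (interval_measure (radial_cdf k))"
    by (rule real_distribution_interval_measure[OF mono rc bot top])
  show "cdf (interval_measure (radial_cdf k)) = radial_cdf k"
    by (rule cdf_interval_measure[OF mono rc bot])
qed

text \<open>The inverse of \<open>r \<mapsto> 1 / r ^ 2\<close>. The value 1 for
  \<open>w \<le> 0\<close> is a default on a null set.\<close>

definition to_state :: "int \<Rightarrow> real \<Rightarrow> real \<times> int" where
  "to_state k w = (if 0 < w then 1 / sqrt w else 1, k)"

definition \<nu> :: "(real \<times> int) measure" where
  "\<nu> = point_measure {-1, 1} (\<lambda>k. ennreal (\<pi> k)) \<bind>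
    (\<lambda>k. distr (interval_measure (radial_cdf k)) (state_space {0<..}) (to_state k))"

lemma to_state_measurable: "k \<in> {-1, 1} \<Longrightarrow> to_state k \<in> borel \<rightarrow>\<^sub>M state_space {0<..}"
proof -
  assume k: "k \<in> {-1, 1}"
  have "(\<lambda>w::real. if 0 < w then 1 / sqrt w else 1) \<in> borel \<rightarrow>\<^sub>M restrict_space borel {0<..}"
    by (intro measurable_restrict_space2) auto
  then show ?thesis
    unfolding state_space_def to_state_def[abs_def]
        by (intro measurable_Pair measurable_const) (use k in auto)
qed

lemma to_state_measurable': "k \<in> {-1, 1} \<Longrightarrow> to_state k \<in> interval_measure G \<rightarrow>\<^sub>M state_space {0<..}"
  unfolding measurable_cong_sets[OF sets_interval_measure refl] by (rule to_state_measurable)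

lemma \<nu>_kernel:
  "(\<lambda>k. distr (interval_measure (radial_cdf k)) (state_space {0<..}) (to_state k)) \<in>
     point_measure {-1, 1} (\<lambda>k. ennreal (\<pi> k)) \<rightarrow>\<^sub>M subprob_algebra (state_space {0<..})"
proof -
  have "distr (interval_measure (radial_cdf k)) (state_space {0<..}) (to_state k) \<in>
      space (subprob_algebra (state_space {0<..}))"
    if k: "k \<in> {-1, 1}" for k
  proof -
    interpret G: real_distribution "interval_measure (radial_cdf k)"
        by (rule real_distribution_radial_cdf[OF k])
    have "prob_space (distr (interval_measure (radial_cdf k)) (state_space {0<..}) (to_state k))"
      by (rule G.prob_space_distr[OF to_state_measurable'[OF k]])
    then show ?thesis by (simp add: space_subprob_algebra prob_space_imp_subprob_space)
  qed
  then show ?thesis by (auto simp: measurable_point_measure_eq1)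
qed

lemma sets_\<nu>: "sets \<nu> = sets (state_space {0<..})"
  unfolding \<nu>_def by (rule sets_bind) (auto simp: space_point_measure)

lemma emeasure_\<nu>:
  assumes A: "A \<in> sets (state_space {0<..})"
  shows "emeasure \<nu> A = (\<Sum>k\<in>{-1, 1}. ennreal (\<pi> k) * emeasure (interval_measure (radial_cdf k))
      (to_state k -` A))"
proof -
  have "emeasure \<nu> A = (\<integral>\<^sup>+k. emeasure (distr (interval_measure (radial_cdf k)) (state_space {0<..})
      (to_state k)) A
      \<partial>point_measure {-1, 1} (\<lambda>k. ennreal (\<pi> k)))"
    unfolding \<nu>_def by (rule emeasure_bind[OF _ \<nu>_kernel A]) (simp add: space_point_measure)
  also have "\<dots> = (\<Sum>k\<in>{-1, 1}. ennreal (\<pi> k) * emeasure (distr (interval_measure (radial_cdf k))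
      (state_space {0<..}) (to_state k)) A)"
    using \<pi>_pos by (subst nn_integral_point_measure_finite) auto
  also have "\<dots> = (\<Sum>k\<in>{-1, 1}. ennreal (\<pi> k) * emeasure (interval_measure (radial_cdf k)) (to_state k
      -` A))"
  proof (rule sum.cong[OF refl])
    fix k :: int assume k: "k \<in> {-1, 1}"
    from emeasure_distr[OF to_state_measurable'[OF k] A]
    show "ennreal (\<pi> k) * emeasure (distr (interval_measure (radial_cdf k)) (state_space {0<..})
        (to_state k)) A =
      ennreal (\<pi> k) * emeasure (interval_measure (radial_cdf k)) (to_state k -` A)" by simp
  qed
  finally show ?thesis .
qed

lemma prob_space_\<nu>: "prob_space \<nu>"
proof
  have "emeasure (interval_measure (radial_cdf k)) (to_state k -` space (state_space {0<..})) = 1"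
      if k: "k \<in> {-1, 1}" for k
  proof -
    interpret G: real_distribution "interval_measure (radial_cdf k)"
        by (rule real_distribution_radial_cdf[OF k])
    have "to_state k -` space (state_space {0<..}) = UNIV" using k
        by (auto simp: to_state_def space_state_space)
    then show ?thesis using G.emeasure_space_1 by simp
  qed
  then have "emeasure \<nu> (space (state_space {0<..})) = ennreal (\<pi> (-1)) + ennreal (\<pi> 1)"
    by (subst emeasure_\<nu>) auto
  also have "\<dots> = 1" using \<pi>_pos \<pi>_sum by (simp add: less_imp_le flip: ennreal_plus)
  finally show "emeasure \<nu> (space \<nu>) = 1" using sets_eq_imp_space_eq[OF sets_\<nu>] by simp
qed

text \<open>On the half-line the only direction is 1, so \<open>B\<close> matters only through the
  question whether it contains 1.\<close>

lemma law_\<nu>: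
  assumes B: "B \<in> sets borel" and k: "k \<in> {-1, 1}"
  shows "law \<nu> B c k = indicator B 1 * Flim c k"
proof (cases "0 < c")
  case False
  have "law \<nu> B c k = 0" "Flim c k = 0"
    using False distributionD(3)[OF distribution_law[OF admissible_radial prob_space_\<nu> sets_\<nu> B], of
        c k]
    by (simp_all add: Flim_nonpos)
  then show ?thesis by simp
next
  case True
  let ?X = "{z \<in> space (state_space {0<..}). sgn (fst z) \<in> B \<and> 1 \<le> c * (norm (fst z))\<^sup>2 \<and> snd z = k}"
  have "law \<nu> B c k = (\<Sum>j\<in>{-1, 1}. ennreal (\<pi> j) * emeasure (interval_measure (radial_cdf j))
      (to_state j -` ?X))"
    unfolding law_def sets_eq_imp_space_eq[OF sets_\<nu>]
        by (rule emeasure_\<nu>) (rule law_sets[OF refl B])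
  also have "\<dots> = (\<Sum>j\<in>{k}. ennreal (\<pi> j) * emeasure (interval_measure (radial_cdf j)) (to_state j -`
      ?X))"
    using k by (intro sum.mono_neutral_right) (auto simp: to_state_def vimage_def)
  also have "\<dots> = ennreal (\<pi> k) * emeasure (interval_measure (radial_cdf k)) (to_state k -` ?X)"
      by simp
  also have "emeasure (interval_measure (radial_cdf k)) (to_state k -` ?X) =
      indicator B 1 * ennreal (radial_cdf k c)"
  proof -
    interpret G: real_distribution "interval_measure (radial_cdf k)"
        by (rule real_distribution_radial_cdf[OF k])
    have cdf: "emeasure (interval_measure (radial_cdf k)) {..c} = ennreal (radial_cdf k c)" for c
      using real_distribution_radial_cdf(2)[OF k] by (metis G.emeasure_eq_measure cdf_def)
    \<comment> \<open>\<open>Flim\<close> vanishes at 0, so the default branch of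
      \<open>to_state\<close> is never taken almost surely.\<close>
    have "AE w in interval_measure (radial_cdf k). w \<notin> {..0}"
      using cdf[of 0] by (intro AE_not_in) (auto simp: null_sets_def radial_cdf_def Flim_nonpos)
    then have "emeasure (interval_measure (radial_cdf k)) (to_state k -` ?X) =
        emeasure (interval_measure (radial_cdf k)) (if 1 \<in> B then {..c} else {})"
    proof (intro emeasure_eq_AE, elim eventually_mono)
      fix w assume "w \<notin> {..0::real}"
      then have "0 < w" by simp
      then show "(w \<in> to_state k -` ?X) = (w \<in> (if 1 \<in> B then {..c} else {}))"
        using k by (auto simp: to_state_def space_state_space power_divide sgn_div_norm
            divide_simps)
    next
      have "to_state k -` ?X \<inter> space borel \<in> sets borel"
        by (rule measurable_sets[OF to_state_measurable[OF k] law_sets[OF refl B]])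
      then show "to_state k -` ?X \<in> sets (interval_measure (radial_cdf k))" by simp
    qed auto
    then show ?thesis using cdf by (auto simp: indicator_def)
  qed
  finally show ?thesis
    using \<pi>_pos[of k] by (simp add: Flim_eq_radial_cdf ennreal_mult' less_imp_le mult.left_commute)
qed

lemma inv_\<nu>: "inv {0<..} (\<lambda>_ x. x) \<nu>"
  unfolding invariant_prob_def
proof (intro conjI allI impI prob_space_\<nu> sets_\<nu>)
  fix t :: real assume t: "0 \<le> t"
  note adm = admissible_radial
  show "\<nu> \<bind> kernel {0<..} (\<lambda>_ x. x) t = \<nu>"
  proof (rule law_unique[OF adm prob_space_bind_kernel[OF adm prob_space_\<nu> sets_\<nu> t]
      sets_bind_kernel[OF adm prob_space_\<nu> sets_\<nu> t] prob_space_\<nu> sets_\<nu> drift, where a =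
          "\<lambda>B. indicator B 1"])
    fix B :: "real set" and c and k :: int assume B: "B \<in> sets borel" and k: "k \<in> {-1, 1}"
    show "law \<nu> B c k = indicator B 1 * Flim c k" by (rule law_\<nu>[OF B k])
    have "law (\<nu> \<bind> kernel {0<..} (\<lambda>_ x. x) t) B c k = dual t (law \<nu> B) c k"
      using law_bind[OF adm prob_space_\<nu> sets_\<nu> t B k] by simp
    also have "\<dots> = dual t (\<lambda>c k. indicator B 1 * Flim c k) c k"
      by (rule dual_cong) (rule law_\<nu>[OF B])
    also have "\<dots> = indicator B 1 * Flim c k"
      by (simp add: dual_cmult[OF Flim_measurable] dual_Flim[OF t k])
    finally show "law (\<nu> \<bind> kernel {0<..} (\<lambda>_ x. x) t) B c k = indicator B 1 * Flim c k" .
  qed (auto simp: indicator_def)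
qed

lemma inv_\<nu>_unique:
  assumes \<mu>: "inv {0<..} (\<lambda>_ x. x) \<mu>"
  shows "\<mu> = \<nu>"
proof -
  note adm = admissible_radial
  note D = invD[OF adm \<mu>]
  interpret prob_space \<mu> by (rule D)
  have sp: "space \<mu> = {0<..} \<times> {-1, 1}" using sets_eq_imp_space_eq[OF D(2)]
      by (simp only: space_state_space)
  have dir: "dirm \<mu> B = indicator B 1" for B
  proof -
    have "{z \<in> space \<mu>. sgn (fst z) \<in> B \<and> fst z \<noteq> 0} = (if 1 \<in> B then space \<mu> else {})"
      by (auto simp: sp sgn_if)
    then show ?thesis unfolding dirm_def by (simp add: emeasure_space_1)
  qed
  show ?thesis
  proof (rule law_unique[OF adm D(1,2) prob_space_\<nu> sets_\<nu> drift, where a = "\<lambda>B. indicator B 1"])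
    fix B :: "real set" and c and k :: int assume B: "B \<in> sets borel" and k: "k \<in> {-1, 1}"
    show "law \<mu> B c k = indicator B 1 * Flim c k"
      using inv_law[OF adm \<mu> zero_less_one refl drift B k] by (simp add: dir)
    show "law \<nu> B c k = indicator B 1 * Flim c k" by (rule law_\<nu>[OF B k])
  qed (auto simp: indicator_def)
qed

end
end

subsection \<open>Rotations\<close>

text \<open>The window from \<open>a\<close> to \<open>a + 2 * pi\<close> is cut at
  \<open>2 * pi\<close>, and the part beyond is moved back by one period.\<close>

lemma nn_integral_periodic_shift:
  fixes f :: "real \<Rightarrow> ennreal"
  assumes [measurable]: "f \<in> borel_measurable borel" and per: "\<And>x. f (x + 2 * pi) = f x"
      and a: "a \<in> {0..<2 * pi}"
  shows "(\<integral>\<^sup>+x. f (x + a) * indicator {0..<2 * pi} x \<partial>lborel) = (\<integral>\<^sup>+x. f x * indicator {0..<2 * pi} x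
      \<partial>lborel)"
proof -
  have "(\<integral>\<^sup>+x. f x * indicator {a..<a + 2 * pi} x \<partial>lborel) = (\<integral>\<^sup>+x. f (a + x) * indicator {a..<a +
      2 * pi} (a + x) \<partial>lborel)"
    using nn_integral_real_affine[of "\<lambda>x. f x * indicator {a..<a + 2 * pi} x" 1 a] by simp
  then have "(\<integral>\<^sup>+x. f (x + a) * indicator {0..<2 * pi} x \<partial>lborel) = (\<integral>\<^sup>+x. f x * indicator {a..<a +
      2 * pi} x \<partial>lborel)"
    by (simp add: indicator_def add.commute)
  also have "\<dots> = (\<integral>\<^sup>+x. f x * indicator {a..<2 * pi} x + f x * indicator {2 * pi..<a +
      2 * pi} x \<partial>lborel)"
    using a by (intro nn_integral_cong) (auto simp: indicator_def)
  also have "\<dots> = (\<integral>\<^sup>+x. f x * indicator {a..<2 * pi} x \<partial>lborel) + (\<integral>\<^sup>+x. f x * indicator {2 * pi..<a +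
      2 * pi} x \<partial>lborel)"
    by (rule nn_integral_add) measurable
  also have "(\<integral>\<^sup>+x. f x * indicator {2 * pi..<a + 2 * pi} x \<partial>lborel) = (\<integral>\<^sup>+x. f (2 * pi +
      x) * indicator {2 * pi..<a + 2 * pi} (2 * pi + x) \<partial>lborel)"
    using nn_integral_real_affine[of "\<lambda>x. f x * indicator {2 * pi..<a + 2 * pi} x" 1 "2 * pi"]
        by simp
  also have "\<dots> = (\<integral>\<^sup>+x. f x * indicator {0..<a} x \<partial>lborel)"
    by (intro nn_integral_cong) (use per in \<open>auto simp: indicator_def add.commute\<close>)
  also have "(\<integral>\<^sup>+x. f x * indicator {a..<2 * pi} x \<partial>lborel) + (\<integral>\<^sup>+x. f x * indicator {0..<a} x
      \<partial>lborel) =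
      (\<integral>\<^sup>+x. f x * indicator {a..<2 * pi} x + f x * indicator {0..<a} x \<partial>lborel)"
    by (rule nn_integral_add[symmetric]) measurable
  also have "\<dots> = (\<integral>\<^sup>+x. f x * indicator {0..<2 * pi} x \<partial>lborel)"
    using a by (intro nn_integral_cong) (auto simp: indicator_def)
  finally show ?thesis .
qed

lemma cos_sin_angle: obtains a where "a \<in> {0..<2 * pi}" "cos a = cos t" "sin a = sin (t :: real)"
  using sincos_total_2pi[of "cos t" "sin t"] by (metis atLeastLessThan_iff sin_cos_squared_add2)

abbreviation circ :: "real measure" where
  "circ \<equiv> uniform_measure lborel {0..<2 * pi}"

definition unif :: "(real \<times> real) set \<Rightarrow> ennreal" where
  "unif B = (\<integral>\<^sup>+\<theta>. indicator B (cos \<theta>, sin \<theta>) \<partial>circ)"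

lemma circ_ident: "(\<lambda>x. x) \<in> circ \<rightarrow>\<^sub>M borel"
  by (rule measurable_ident_sets) simp

lemma prob_space_circ: "prob_space circ"
  by (rule prob_space_uniform_measure) auto

lemma cos_sin_measurable [measurable]: "(\<lambda>\<theta>. (cos \<theta>, sin \<theta>)) \<in> borel_measurable (borel :: real
    measure)"
  by (intro borel_measurable_Pair) auto

lemma unif_shift:
  assumes [measurable]: "B \<in> sets borel"
  shows "(\<integral>\<^sup>+\<theta>. indicator B (cos (\<theta> + t), sin (\<theta> + t)) \<partial>circ) = unif B"
proof -
  obtain a where a: "a \<in> {0..<2 * pi}" "cos a = cos t" "sin a = sin t" by (rule cos_sin_angle)
  let ?f = "\<lambda>\<theta>. indicator B (cos \<theta>, sin \<theta>) :: ennreal"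
  have [measurable]: "?f \<in> borel_measurable borel"
    by (rule measurable_compose[OF cos_sin_measurable]) simp
  have [measurable]: "(\<lambda>\<theta>. ?f (\<theta> + a)) \<in> borel_measurable borel" by measurable
  have "(\<integral>\<^sup>+\<theta>. indicator B (cos (\<theta> + t), sin (\<theta> + t)) \<partial>circ) = (\<integral>\<^sup>+\<theta>. ?f (\<theta> + a) \<partial>circ)"
    by (simp add: cos_add sin_add a)
  also have "\<dots> = (\<integral>\<^sup>+\<theta>. ?f (\<theta> + a) * indicator {0..<2 * pi} \<theta> \<partial>lborel) / emeasure lborel {0..<2 *
      pi}"
    by (rule nn_integral_uniform_measure) auto
  also have "(\<integral>\<^sup>+\<theta>. ?f (\<theta> + a) * indicator {0..<2 * pi} \<theta> \<partial>lborel) =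
      (\<integral>\<^sup>+\<theta>. ?f \<theta> * indicator {0..<2 * pi} \<theta> \<partial>lborel)"
    by (rule nn_integral_periodic_shift[OF _ _ a(1)]) (auto simp: cos_add sin_add)
  also have "\<dots> / emeasure lborel {0..<2 * pi} = unif B"
    unfolding unif_def by (rule nn_integral_uniform_measure[symmetric]) auto
  finally show ?thesis .
qed

context switching begin

lemma rot_polar: "rot t (cos \<theta>, sin \<theta>) = (cos (\<theta> + t), sin (\<theta> + t))"
  by (simp add: rot_def cos_add sin_add)

lemma unif_rot: "B \<in> sets borel \<Longrightarrow> unif (rot t -` B) = unif B"
proof -
  assume B: "B \<in> sets borel"
  have "unif (rot t -` B) = (\<integral>\<^sup>+\<theta>. indicator B (cos (\<theta> + t), sin (\<theta> + t)) \<partial>circ)"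
    unfolding unif_def by (intro nn_integral_cong) (simp add: indicator_def rot_polar)
  then show ?thesis by (simp only: unif_shift[OF B])
qed

text \<open>A unit vector has some angle \<open>a\<close>, so its orbit over one turn is the circle
  traversed from \<open>a\<close> on.\<close>

lemma rot_orbit_unif:
  assumes d: "norm d = 1" and B: "B \<in> sets borel"
  shows "(\<integral>\<^sup>+t. indicator B (rot t d) \<partial>circ) = unif B"
proof -
  obtain x y where xy: "d = (x, y)" by (cases d)
  have "x\<^sup>2 + y\<^sup>2 = 1" using d by (simp add: xy norm_Pair)
  then obtain a where "x = cos a" "y = sin a" using sincos_total_2pi by metis
  then have "rot t d = (cos (t + a), sin (t + a))" for t
    by (simp add: xy rot_polar add.commute)
  then show ?thesis by (simp add: unif_shift[OF B])
qed

context
  assumes drift: "0 < drift"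
begin

lemma circle_map_measurable: "(\<lambda>(\<theta>, r, i). (polar \<theta> r, i)) \<in> circ \<Otimes>\<^sub>M \<nu> \<rightarrow>\<^sub>M state_space UNIV"
proof -
  have [measurable]: "(\<lambda>z. fst z) \<in> \<nu> \<rightarrow>\<^sub>M borel" "(\<lambda>z. snd z) \<in> \<nu> \<rightarrow>\<^sub>M count_space {-1, 1}"
    using state_space_measurable_fst[of "{0<..}"] state_space_measurable_snd[of "{0<..}"]
      measurable_cong_sets[OF sets_\<nu>[OF drift] refl] by blast+
  have [measurable]: "(\<lambda>z. fst z) \<in> circ \<Otimes>\<^sub>M \<nu> \<rightarrow>\<^sub>M borel"
    by (rule measurable_compose[OF measurable_fst circ_ident])
  have "(\<lambda>z. polar (fst z) (fst (snd z))) \<in> circ \<Otimes>\<^sub>M \<nu> \<rightarrow>\<^sub>M borel"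
    unfolding polar_def by (intro borel_measurable_Pair borel_measurable_times) measurable
  then show ?thesis
    unfolding measurable_cong_sets[OF refl sets_state_space_UNIV] case_prod_beta by measurable
qed

lemma sets_circle: "sets (circle_product \<nu>) = sets (state_space UNIV)"
  by (simp add: circle_product_def)

lemma prob_space_circle: "prob_space (circle_product \<nu>)"
proof -
  interpret pair_prob_space circ \<nu>
    using prob_space_circ prob_space_\<nu>[OF drift]
        by (simp add: pair_prob_space_def pair_sigma_finite_def prob_space_imp_sigma_finite)
  show ?thesis unfolding circle_product_def by (rule prob_space_distr[OF circle_map_measurable])
qed

text \<open>In polar coordinates the set is the product of a condition on the angle and a condition
  on radius and index.\<close>

lemma law_circle:
  assumes B: "B \<in> sets borel" and k: "k \<in> {-1, 1}"
  shows "law (circle_product \<nu>) B c k = unif B * Flim c k"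
proof -
  interpret N: prob_space \<nu> by (rule prob_space_\<nu>[OF drift])
  let ?X = "{z \<in> space (state_space UNIV). sgn (fst z) \<in> B \<and> 1 \<le> c * (norm (fst z))\<^sup>2 \<and> snd z = k}"
  let ?L = "{z \<in> space \<nu>. sgn (fst z) \<in> UNIV \<and> 1 \<le> c * (norm (fst z))\<^sup>2 \<and> snd z = k}"
  let ?\<Theta> = "{\<theta>. (cos \<theta>, sin \<theta>) \<in> B}"
  have \<Theta>: "?\<Theta> \<in> sets borel"
    using measurable_sets[OF cos_sin_measurable B] by (simp add: vimage_def)
  have X: "?X \<in> sets (state_space UNIV)" by (rule law_sets[OF refl B])
  have sp: "space \<nu> = {0<..} \<times> {-1, 1}" using sets_eq_imp_space_eq[OF sets_\<nu>[OF drift]]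
      by (simp only: space_state_space)
  have polar: "norm (polar \<theta> r) = r" "sgn (polar \<theta> r) = (cos \<theta>, sin \<theta>)" if "0 < r" for \<theta> r :: real
  proof -
    have "(r * cos \<theta>)\<^sup>2 + (r * sin \<theta>)\<^sup>2 = r\<^sup>2"
      by (simp add: power_mult_distrib flip: distrib_left)
    then show n: "norm (polar \<theta> r) = r" using that by (simp add: polar_def norm_Pair)
    show "sgn (polar \<theta> r) = (cos \<theta>, sin \<theta>)" using that
        by (simp add: sgn_div_norm n) (simp add: polar_def)
  qed
  have "law (circle_product \<nu>) B c k = emeasure (circle_product \<nu>) ?X"
    by (simp add: law_def sets_eq_imp_space_eq[OF sets_circle])
  also have "\<dots> = emeasure (circ \<Otimes>\<^sub>M \<nu>) ((\<lambda>(\<theta>, r, i). (polar \<theta> r, i)) -` ?X \<inter> space (circ \<Otimes>\<^sub>M \<nu>))"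
    unfolding circle_product_def by (rule emeasure_distr[OF circle_map_measurable X])
  also have "(\<lambda>(\<theta>, r, i). (polar \<theta> r, i)) -` ?X \<inter> space (circ \<Otimes>\<^sub>M \<nu>) = ?\<Theta> \<times> ?L"
    using polar by (auto simp: space_pair_measure sp space_state_space)
  also have "emeasure (circ \<Otimes>\<^sub>M \<nu>) (?\<Theta> \<times> ?L) = emeasure circ ?\<Theta> * emeasure \<nu> ?L"
    using \<Theta> law_sets[OF sets_\<nu>[OF drift], of UNIV] by (intro N.emeasure_pair_measure_Times) auto
  also have "emeasure \<nu> ?L = Flim c k" using law_\<nu>[OF drift _ k, of UNIV c] by (simp add: law_def)
  also have "emeasure circ ?\<Theta> = unif B"
  proof -
    have "unif B = (\<integral>\<^sup>+\<theta>. indicator ?\<Theta> \<theta> \<partial>circ)" unfolding unif_def by (simp add: indicator_def)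
    then show ?thesis using \<Theta> by simp
  qed
  finally show ?thesis .
qed

lemma unif_UNIV: "unif UNIV = 1"
  using prob_space.emeasure_space_1[OF prob_space_circ] by (simp add: unif_def)

lemma unif_finite: "unif B < \<top>"
proof -
  have "unif B \<le> unif UNIV" unfolding unif_def by (intro nn_integral_mono) (simp add: indicator_def)
  then show ?thesis unfolding unif_UNIV by (rule le_less_trans) simp
qed

lemma rot_vimage: "B \<in> sets borel \<Longrightarrow> rot t -` B \<in> sets borel"
  using measurable_sets[OF R_measurable[OF admissible_planar]] by fastforce

text \<open>By \<open>law_bind\<close> the set \<open>B\<close> is replaced by its preimage under
  \<open>rot t\<close>, which \<open>unif\<close> does not notice, and \<open>dual t\<close> fixes
  \<open>Flim\<close>.\<close>

lemma inv_circle: "inv UNIV rot (circle_product \<nu>)"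
  unfolding invariant_prob_def
proof (intro conjI allI impI prob_space_circle sets_circle)
  fix t :: real assume t: "0 \<le> t"
  note adm = admissible_planar
  let ?\<mu> = "circle_product \<nu>"
  show "?\<mu> \<bind> kernel UNIV rot t = ?\<mu>"
  proof (rule law_unique[where a = unif, OF adm prob_space_bind_kernel[OF adm prob_space_circle
      sets_circle t]
      sets_bind_kernel[OF adm prob_space_circle sets_circle t] prob_space_circle sets_circle drift
          unif_UNIV unif_finite])
    fix B :: "(real \<times> real) set" and c and k :: int assume B: "B \<in> sets borel" and k: "k \<in> {-1, 1}"
    show "law ?\<mu> B c k = unif B * Flim c k" by (rule law_circle[OF B k])
    have "law (?\<mu> \<bind> kernel UNIV rot t) B c k = dual t (law ?\<mu> (rot t -` B)) c k"
      by (rule law_bind[OF adm prob_space_circle sets_circle t B k])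
    also have "\<dots> = dual t (\<lambda>c k. unif B * Flim c k) c k"
      by (rule dual_cong) (simp add: law_circle[OF rot_vimage[OF B]] unif_rot[OF B])
    also have "\<dots> = unif B * Flim c k"
      by (simp add: dual_cmult[OF Flim_measurable] dual_Flim[OF t k])
    finally show "law (?\<mu> \<bind> kernel UNIV rot t) B c k = unif B * Flim c k" .
  qed
qed

lemma AE_circle: "AE z in circle_product \<nu>. fst z \<noteq> 0"
proof -
  have "dirm (circle_product \<nu>) UNIV = unif UNIV"
    by (rule dirm_eqI[OF admissible_planar prob_space_circle sets_circle _ drift unif_finite
        law_circle]) auto
  then show ?thesis
    using dirm_AE[OF admissible_planar prob_space_circle sets_circle] by (simp add: unif_UNIV)
qed

text \<open>The full turn shows only that direction and radius are independent. With this product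
  form, \<open>law_bind\<close> at an arbitrary time gives invariance of \<open>dirm \<mu>\<close>
  under every rotation.\<close>

lemma inv_dirm_unif:
  assumes \<mu>: "inv UNIV rot \<mu>" and nz: "AE z in \<mu>. fst z \<noteq> 0" and B: "B \<in> sets borel"
  shows "dirm \<mu> B = unif B"
proof -
  note adm = admissible_planar
  note D = invD[OF adm \<mu>]
  interpret prob_space \<mu> by (rule D)
  have T: "0 < 2 * pi" "rot (2 * pi) = (\<lambda>x. x)" by auto
  have inv: "dirm \<mu> (rot t -` B) = dirm \<mu> B" if t: "0 \<le> t" for t
  proof -
    have "dirm \<mu> B = dirm \<mu> (rot t -` B)"
    proof (rule dirm_eqI[OF adm D(1,2) B drift])
      have "dirm \<mu> (rot t -` B) \<le> 1" unfolding dirm_def by (rule emeasure_le_1)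
      then show "dirm \<mu> (rot t -` B) < \<top>" by (rule le_less_trans) simp
      fix c and k :: int assume k: "k \<in> {-1, 1}"
      have "law \<mu> B c k = dual t (law \<mu> (rot t -` B)) c k"
        using law_bind[OF adm D(1,2) t B k, of c] D(3)[OF t] by simp
      also have "\<dots> = dual t (\<lambda>c k. dirm \<mu> (rot t -` B) * Flim c k) c k"
        by (rule dual_cong) (rule inv_law[OF adm \<mu> T drift rot_vimage[OF B]])
      also have "\<dots> = dirm \<mu> (rot t -` B) * Flim c k"
        by (simp add: dual_cmult[OF Flim_measurable] dual_Flim[OF t k])
      finally show "law \<mu> B c k = dirm \<mu> (rot t -` B) * Flim c k" .
    qed
    then show ?thesis ..
  qed
  interpret C: prob_space circ by (rule prob_space_circ)
  interpret P: pair_sigma_finite circ \<mu> ..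
  have [measurable]: "(\<lambda>z. fst z) \<in> \<mu> \<rightarrow>\<^sub>M borel"
    using state_space_measurable_fst[of UNIV] measurable_cong_sets[OF D(2) refl] by blast
  have fm: "(\<lambda>w. fst w) \<in> circ \<Otimes>\<^sub>M \<mu> \<rightarrow>\<^sub>M borel"
    by (rule measurable_compose[OF measurable_fst circ_ident])
  have sgnm: "(\<lambda>w. sgn (fst (snd w))) \<in> circ \<Otimes>\<^sub>M \<mu> \<rightarrow>\<^sub>M borel"
    unfolding sgn_div_norm by measurable
  have c1: "(\<lambda>w. fst (sgn (fst (snd w)))) \<in> borel_measurable (circ \<Otimes>\<^sub>M \<mu>)"
    by (rule borel_measurable_continuous_on[OF _ sgnm]) (intro continuous_intros)
  have c2: "(\<lambda>w. snd (sgn (fst (snd w)))) \<in> borel_measurable (circ \<Otimes>\<^sub>M \<mu>)"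
    by (rule borel_measurable_continuous_on[OF _ sgnm]) (intro continuous_intros)
  have rm: "(\<lambda>w. rot (fst w) (sgn (fst (snd w)))) \<in> circ \<Otimes>\<^sub>M \<mu> \<rightarrow>\<^sub>M borel"
  proof -
    have cs: "(\<lambda>w. cos (fst w)) \<in> borel_measurable (circ \<Otimes>\<^sub>M \<mu>)" "(\<lambda>w. sin (fst w)) \<in>
        borel_measurable (circ \<Otimes>\<^sub>M \<mu>)"
      by (rule borel_measurable_continuous_on[OF _ fm], intro continuous_intros)+
    show ?thesis unfolding rot_def case_prod_beta
      by (intro borel_measurable_Pair borel_measurable_diff borel_measurable_add
          borel_measurable_times c1 c2 cs)
  qed
  have m: "(\<lambda>(t, z). indicator B (rot t (sgn (fst z))) :: ennreal) \<in> borel_measurable (circ \<Otimes>\<^sub>M \<mu>)"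
    unfolding case_prod_beta by (rule measurable_compose[OF rm borel_measurable_indicator[OF B]])
  have eq: "dirm \<mu> (rot t -` B) = (\<integral>\<^sup>+z. indicator B (rot t (sgn (fst z))) \<partial>\<mu>)" for t
  proof -
    have Z: "{z \<in> space \<mu>. sgn (fst z) \<in> rot t -` B \<and> fst z \<noteq> 0} \<in> sets \<mu>"
    proof -
      have [measurable]: "(sgn :: real \<times> real \<Rightarrow> real \<times> real) \<in> borel_measurable borel"
        unfolding sgn_div_norm[abs_def] by measurable
      note [measurable] = rot_vimage[OF B, of t]
      show ?thesis by measurable
    qed
    have "dirm \<mu> (rot t -` B) = (\<integral>\<^sup>+z. indicator {z \<in> space \<mu>. sgn (fst z) \<in>
        rot t -` B \<and> fst z \<noteq> 0} z \<partial>\<mu>)"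
      unfolding dirm_def by (rule nn_integral_indicator[symmetric, OF Z])
    also have "\<dots> = (\<integral>\<^sup>+z. indicator B (rot t (sgn (fst z))) \<partial>\<mu>)"
    proof (rule nn_integral_cong_AE)
      have "AE z in \<mu>. z \<in> space \<mu>" by simp
      then show "AE z in \<mu>. indicator {z \<in> space \<mu>. sgn (fst z) \<in> rot t -` B \<and> fst z \<noteq> 0} z =
          (indicator B (rot t (sgn (fst z))) :: ennreal)"
        using nz by eventually_elim (auto simp: indicator_def)
    qed
    finally show ?thesis .
  qed
  \<comment> \<open>Averaging over all rotations and exchanging the integrals replaces each
    direction by its orbit, whose distribution is uniform.\<close>
  have "dirm \<mu> B = (\<integral>\<^sup>+t. dirm \<mu> B \<partial>circ)" using C.emeasure_space_1 by simp
  also have "\<dots> = (\<integral>\<^sup>+t. dirm \<mu> (rot t -` B) \<partial>circ)"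
  proof (rule nn_integral_cong_AE)
    have "AE t in circ. t \<in> {0..<2 * pi}" by (rule AE_uniform_measureI) auto
    then show "AE t in circ. dirm \<mu> B = dirm \<mu> (rot t -` B)" by eventually_elim (simp add: inv)
  qed
  also have "\<dots> = (\<integral>\<^sup>+t. \<integral>\<^sup>+z. indicator B (rot t (sgn (fst z))) \<partial>\<mu> \<partial>circ)" unfolding eq ..
  also have "\<dots> = (\<integral>\<^sup>+z. \<integral>\<^sup>+t. indicator B (rot t (sgn (fst z))) \<partial>circ \<partial>\<mu>)"
    using P.Fubini'[OF m] by simp
  also have "\<dots> = (\<integral>\<^sup>+z. unif B \<partial>\<mu>)"
    by (rule nn_integral_cong_AE, use nz in eventually_elim) (rule rot_orbit_unif[OF _ B], simp add:
        norm_sgn)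
  also have "\<dots> = unif B" using emeasure_space_1 by simp
  finally show ?thesis .
qed

lemma inv_circle_unique:
  assumes \<mu>: "inv UNIV rot \<mu>" and nz: "AE z in \<mu>. fst z \<noteq> 0"
  shows "\<mu> = circle_product \<nu>"
proof -
  note adm = admissible_planar
  note D = invD[OF adm \<mu>]
  have T: "0 < 2 * pi" "rot (2 * pi) = (\<lambda>x. x)" by auto
  show ?thesis
    by (rule law_unique[where a = unif, OF adm D(1,2) prob_space_circle sets_circle drift unif_UNIV
        unif_finite _ law_circle])
      (simp add: inv_law[OF adm \<mu> T drift] inv_dirm_unif[OF \<mu> nz])
qed

section \<open>Ergodic measures\<close>

lemma ergodic_iff:
  "ergodic_prob (state_space UNIV) (kernel UNIV rot) \<mu> \<longleftrightarrow> \<mu> = origin_measure lm lp \<or> \<mu> =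
      circle_product \<nu>"
proof
  note adm = admissible_planar
  assume erg: "ergodic_prob (state_space UNIV) (kernel UNIV rot) \<mu>"
  then have \<mu>: "inv UNIV rot \<mu>" by (simp add: ergodic_prob_def)
  note D = invD[OF adm \<mu>]
  interpret prob_space \<mu> by (rule D)
  \<comment> \<open>The origin is absorbing, so an ergodic measure gives it mass 0 or 1, and in each
    case the invariant measure is unique.\<close>
  let ?Z = "{z \<in> space (state_space (UNIV :: (real \<times> real) set)). fst z = 0}"
  have sp: "space \<mu> = space (state_space UNIV)" using sets_eq_imp_space_eq[OF D(2)] .
  have Z: "?Z \<in> sets (state_space UNIV)"
    using state_space_measurable_fst[of UNIV] by measurable
  have "AE z in \<mu>. z \<in> ?Z \<longrightarrow> measure (kernel UNIV rot t z) ?Z = 1" if "0 \<le> t" for t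
    using zero_absorbing[OF adm that] by (intro AE_I2) (simp add: measure_def)
  then have "measure \<mu> ?Z = 0 \<or> measure \<mu> ?Z = 1"
    using erg Z by (auto simp: ergodic_prob_def)
  then show "\<mu> = origin_measure lm lp \<or> \<mu> = circle_product \<nu>"
  proof
    assume "measure \<mu> ?Z = 0"
    then have "?Z \<in> null_sets \<mu>" using Z D(2) by (auto simp: null_sets_def emeasure_eq_measure)
    then have "AE z in \<mu>. z \<notin> ?Z" by (rule AE_not_in)
    moreover have "AE z in \<mu>. z \<in> space \<mu>" by simp
    ultimately have "AE z in \<mu>. fst z \<noteq> 0" by eventually_elim (simp add: sp)
    then show ?thesis using inv_circle_unique[OF \<mu>] by simp
  next
    assume "measure \<mu> ?Z = 1"
    then have "AE z in \<mu>. z \<in> ?Z" using Z D(2) by (intro AE_prob_1) simp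
    then have "AE z in \<mu>. fst z = 0" by eventually_elim simp
    then show ?thesis using inv_origin_unique[OF \<mu>] by simp
  qed
next
  note adm = admissible_planar
  \<comment> \<open>The property \<open>P\<close> singles out a class with one invariant measure and
    passes to conditioned measures. Conditioning on an absorbing set of positive mass thus returns
    \<open>\<mu>\<close>, so that set has mass 1.\<close>
  have erg: "ergodic_prob (state_space UNIV) (kernel UNIV rot) \<mu>"
    if \<mu>: "inv UNIV rot \<mu>" and P: "AE z in \<mu>. P z"
        and uniq: "\<And>\<mu>'. inv UNIV rot \<mu>' \<Longrightarrow> AE z in \<mu>'. P z \<Longrightarrow> \<mu>' = \<mu>" for P
            and \<mu> :: "((real \<times> real) \<times> int) measure"
    unfolding ergodic_prob_def
  proof (intro conjI \<mu> ballI impI)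
    note D = invD[OF adm \<mu>]
    interpret prob_space \<mu> by (rule D)
    fix A assume A: "A \<in> sets (state_space (UNIV :: (real \<times> real) set))"
      and abs: "\<forall>t\<ge>0. AE z in \<mu>. z \<in> A \<longrightarrow> measure (kernel UNIV rot t z) A = 1"
    show "measure \<mu> A = 0 \<or> measure \<mu> A = 1"
    proof (cases "measure \<mu> A = 0")
      case False
      let ?U = "uniform_measure \<mu> A"
      have A\<mu>: "A \<in> sets \<mu>" using A D(2) by simp
      have "inv UNIV rot ?U" using abs by (intro conditioned_inv[OF adm \<mu> A False]) auto
      moreover have "AE z in ?U. P z"
        using P A\<mu> False by (intro AE_uniform_measureI) (auto simp: emeasure_eq_measure elim:
            eventually_mono)
      ultimately have "?U = \<mu>" by (rule uniq)
      moreover have "emeasure ?U A = 1"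
        using A\<mu> False by (simp add: emeasure_uniform_measure_1 emeasure_eq_measure)
      ultimately have "emeasure \<mu> A = 1" by simp
      then show ?thesis by (simp add: measure_def)
    qed simp
  qed
  assume "\<mu> = origin_measure lm lp \<or> \<mu> = circle_product \<nu>"
  then show "ergodic_prob (state_space UNIV) (kernel UNIV rot) \<mu>"
    using erg[OF inv_origin AE_origin inv_origin_unique] erg[OF inv_circle AE_circle
        inv_circle_unique] by blast
qed

lemma origin_neq_circle: "origin_measure lm lp \<noteq> circle_product \<nu>"
proof
  interpret prob_space "origin_measure lm lp" by (rule prob_space_origin)
  assume eq: "origin_measure lm lp = circle_product \<nu>"
  have "AE z in origin_measure lm lp. fst z \<noteq> 0" unfolding eq by (rule AE_circle)
  with AE_origin have "AE z in origin_measure lm lp. False" by eventually_elim simp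
  then show False by simp
qed

end

lemma inv_iff_origin:
  assumes "drift \<le> 0"
  shows "inv UNIV rot \<mu> \<longleftrightarrow> \<mu> = origin_measure lm lp"
proof
  have T: "0 < 2 * pi" "rot (2 * pi) = (\<lambda>x. x)" by auto
  assume \<mu>: "inv UNIV rot \<mu>"
  show "\<mu> = origin_measure lm lp"
    by (rule inv_origin_unique[OF \<mu> inv_zero[OF admissible_planar \<mu> T assms]])
qed (simp add: inv_origin)

section \<open>Translation to the parameters and processes of the statement\<close>

lemma drift_pos_iff: "0 < drift \<longleftrightarrow> lp / pp < - (lm / pm)"
proof -
  have "drift = (lp * pm + lm * pp) / (lp + lm)"
    by (simp add: drift_def \<pi>_def by_index_def add_divide_distrib)
  then have "0 < drift \<longleftrightarrow> 0 < lp * pm + lm * pp" using lm lp by (simp add: zero_less_divide_iff)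
  also have "\<dots> \<longleftrightarrow> lp * (- pm) < lm * pp" by auto
  also have "\<dots> \<longleftrightarrow> lp / pp < lm / (- pm)"
  proof -
    have "0 < - pm" using pm by simp
    then show ?thesis
      by (simp only: pos_divide_less_eq[OF pp] times_divide_eq_left pos_less_divide_eq)
  qed
  finally show ?thesis by (simp only: divide_minus_right)
qed

lemma invariant_radial_iff:
  "invariant_prob (state_space {0<..}) (radial_pdmp pm pp lm lp) \<mu> \<longleftrightarrow> inv {0<..} (\<lambda>_ x. x) \<mu>"
proof -
  have "\<mu> \<bind> radial_pdmp pm pp lm lp t = \<mu> \<bind> kernel {0<..} (\<lambda>_ x. x) t"
    if "sets \<mu> = sets (state_space {0<..})" "0 \<le> t" for t
    using sets_eq_imp_space_eq[OF that(1)] that(2)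
    by (intro bind_cong refl) (simp add: radial_pdmp_eq_kernel)
  then show ?thesis unfolding invariant_prob_def by auto
qed

lemma planar_pdmp_kernel: "0 \<le> t \<Longrightarrow> planar_pdmp pm pp lm lp t = kernel UNIV rot t"
  by (rule ext) (rule planar_pdmp_eq_kernel)

lemma invariant_planar_iff:
  "invariant_prob (state_space UNIV) (planar_pdmp pm pp lm lp) \<mu> \<longleftrightarrow> inv UNIV rot \<mu>"
  by (simp add: invariant_prob_def planar_pdmp_kernel)

lemma ergodic_planar_iff:
  "ergodic_prob (state_space UNIV) (planar_pdmp pm pp lm lp) \<mu> \<longleftrightarrow>
    ergodic_prob (state_space UNIV) (kernel UNIV rot) \<mu>"
  by (simp add: ergodic_prob_def invariant_planar_iff planar_pdmp_kernel)

end

theorem theorem3p3: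
  fixes pm pp lm lp :: real
  assumes "pm < 0" and "0 < pp" and "0 < lm" and "0 < lp"
  shows "(lp / pp < - (lm / pm) \<longrightarrow>
           (\<exists>\<nu>. {\<nu>'. invariant_prob (state_space {0<..}) (radial_pdmp pm pp lm lp) \<nu>'} = {\<nu>} \<and>
                {\<mu>. ergodic_prob (state_space UNIV) (planar_pdmp pm pp lm lp) \<mu>}
                  = {origin_measure lm lp, circle_product \<nu>} \<and>
                origin_measure lm lp \<noteq> circle_product \<nu>)) \<and>
         (lp / pp \<ge> - (lm / pm) \<longrightarrow>
           {\<mu>. invariant_prob (state_space UNIV) (planar_pdmp pm pp lm lp) \<mu>}
             = {origin_measure lm lp})"
proof -
  interpret switching pm pp lm lp by unfold_locales fact+
  show ?thesis
  proof (intro conjI impI)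
    assume "lp / pp < - (lm / pm)"
    then have drift: "0 < drift" by (simp add: drift_pos_iff)
    show "\<exists>\<nu>. {\<nu>'. invariant_prob (state_space {0<..}) (radial_pdmp pm pp lm lp) \<nu>'} = {\<nu>} \<and>
        {\<mu>. ergodic_prob (state_space UNIV) (planar_pdmp pm pp lm lp) \<mu>}
          = {origin_measure lm lp, circle_product \<nu>} \<and>
        origin_measure lm lp \<noteq> circle_product \<nu>"
    proof (intro exI[of _ \<nu>] conjI)
      show "{\<nu>'. invariant_prob (state_space {0<..}) (radial_pdmp pm pp lm lp) \<nu>'} = {\<nu>}"
      proof -
        have "inv {0<..} (\<lambda>_ x. x) \<nu>' \<longleftrightarrow> \<nu>' = \<nu>" for \<nu>'
          using inv_\<nu>[OF drift] inv_\<nu>_unique[OF drift, of \<nu>'] by blast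
        then show ?thesis by (simp only: invariant_radial_iff) simp
      qed
      show "{\<mu>. ergodic_prob (state_space UNIV) (planar_pdmp pm pp lm lp) \<mu>} =
          {origin_measure lm lp, circle_product \<nu>}"
        by (auto simp: ergodic_planar_iff ergodic_iff[OF drift])
    qed (rule origin_neq_circle[OF drift])
  next
    assume "lp / pp \<ge> - (lm / pm)"
    then have "drift \<le> 0" using drift_pos_iff by linarith
    then show "{\<mu>. invariant_prob (state_space UNIV) (planar_pdmp pm pp lm lp) \<mu>} =
        {origin_measure lm lp}"
      by (auto simp: invariant_planar_iff inv_iff_origin)
  qed
qed

end
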